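(* If $M$ is a weakly holomorphic homogeneous regular (wHHR) manifold, then the Kobayashi distance $d_M^K$ on $M$ is Cauchy complete (i.e. $d_M^K$ is a genuine distance and every Cauchy sequence of $(M,d_M^K)$ converges in $M$).
   Context: $\mathbb{B}^m\subset\mathbb{C}^m$ is the open unit ball, $\mathbb{D}\subset\mathbb{C}$ is the open unit disk, $g_{\mathrm{Euc}}$ is the Euclidean metric on $\mathbb{C}^m$. Levi form: for a $\mathcal{C}^2$ real-valued function $f$ on a complex $m$-manifold, $\mathscr{L}(f)=\sum_{1\le j,k\le m}\frac{\partial^2 f}{\partial z^j\partial\bar z^k}\,dz^j\otimes d\bar z^k$ in local holomorphic coordinates. For $f$ on $\mathbb{B}^m$, the inequality $\mathscr{L}(f)\ge c\, g_{\mathrm{Euc}}$ means $\sum_{j,k}\frac{\partial^2 f}{\partial z^j\partial\bar z^k}(w)\,x_j\bar x_k\ge c\sum_j|x_j|^2$ for all $w\in\mathbb{B}^m$ and $x\in\mathbb{C}^m$. wHHR: a complex $m$-manifold $M$ is a weakly holomorphic homogeneous regular (wHHR) manifold if there exists $s>0$ such that for every $\zeta\in M$ there exist a holomorphic embedding $\Phi:\mathbb{B}^m\to M$ and a $\mathcal{C}^2$ plurisubharmonic function $\phi:M\to[0,1]$ with $\Phi(0)=\zeta$ and $\mathscr{L}(\phi\circ\Phi)\ge s^2 g_{\mathrm{Euc}}$ on $\mathbb{B}^m$. Kobayashi metric and distance: for $z\in M$, $X\in T_zM$, $k_M(z;X)=\inf\{|\xi|:\xi\in T_0\mathbb{C}\simeq\mathbb{C},\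 \varphi:\mathbb{D}\to M\text{ holomorphic},\ \varphi(0)=z,\ d(\varphi)_0\xi=X\}$, and $d_M^K(z_1,z_2)=\inf_\sigma\int_0^1k_M(\sigma(t);\sigma'(t))\,dt$, the infimum being over piecewise $\mathcal{C}^1$ curves $\sigma:[0,1]\to M$ joining $z_1$ to $z_2$. *)

theory Defs
  imports "HOL-Analysis.Analysis"
begin

section \<open>Several complex variables in \<^typ>\<open>complex ^ 'n\<close>\<close>

definition holomorphic_vec :: "(complex ^ 'm) set \<Rightarrow> (complex ^ 'm \<Rightarrow> complex ^ 'n) \<Rightarrow> bool" where
  "holomorphic_vec S f \<longleftrightarrow>
     (\<forall>z\<in>S. \<exists>D. (f has_derivative D) (at z) \<and> Vector_Spaces.linear (*s) (*s) D)"

text \<open>Twice continuously differentiable in the real sense; meant for open \<open>S\<close>.\<close>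

definition C2_on :: "('b::real_normed_vector) set \<Rightarrow> ('b \<Rightarrow> real) \<Rightarrow> bool" where
  "C2_on S f \<longleftrightarrow>
     (\<exists>(f' :: 'b \<Rightarrow> 'b \<Rightarrow>\<^sub>L real) (f'' :: 'b \<Rightarrow> 'b \<Rightarrow>\<^sub>L 'b \<Rightarrow>\<^sub>L real).
        (\<forall>x\<in>S. (f has_derivative blinfun_apply (f' x)) (at x)) \<and>
        (\<forall>x\<in>S. (f' has_derivative blinfun_apply (f'' x)) (at x)) \<and>
        continuous_on S f'')"

text \<open>The Wirtinger derivatives
  \<open>\<partial>/\<partial>z\<^sup>j = (\<partial>/\<partial>x\<^sup>j - i \<partial>/\<partial>y\<^sup>j) / 2\<close> and
  its conjugate operator, where \<open>z\<^sup>j = x\<^sup>j + i y\<^sup>j\<close>.\<close>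

definition wirtinger :: "'n \<Rightarrow> (complex ^ 'n \<Rightarrow> complex) \<Rightarrow> complex ^ 'n \<Rightarrow> complex" where
  "wirtinger j g w =
     (frechet_derivative g (at w) (axis j 1) - \<i> * frechet_derivative g (at w) (axis j \<i>)) / 2"

definition wirtinger_bar :: "'n \<Rightarrow> (complex ^ 'n \<Rightarrow> complex) \<Rightarrow> complex ^ 'n \<Rightarrow> complex" where
  "wirtinger_bar k g w =
     (frechet_derivative g (at w) (axis k 1) + \<i> * frechet_derivative g (at w) (axis k \<i>)) / 2"

text \<open>For a \<open>C\<^sup>2\<close> function the matrix of mixed derivatives is Hermitian, so that the double
  sum is real and taking the real part only changes its type.\<close>

definition levi_form :: "(complex ^ 'n \<Rightarrow> real) \<Rightarrow> complex ^ 'n \<Rightarrow> complex ^ 'n \<Rightarrow> real" where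
  "levi_form f w x =
     Re (\<Sum>j\<in>UNIV. \<Sum>k\<in>UNIV.
           wirtinger j (wirtinger_bar k (\<lambda>z. complex_of_real (f z))) w * (x $ j) * cnj (x $ k))"


section \<open>Complex manifolds\<close>

type_synonym ('a, 'n) chart = "'a set \<times> ('a \<Rightarrow> complex ^ 'n)"

text \<open>A complex manifold of dimension \<open>CARD('n)\<close> is a topological space \<open>X\<close> with a holomorphic
  atlas \<open>A\<close>, not necessarily maximal.  Manifolds are connected, as is needed for
  the Kobayashi distance to be finite.\<close>

definition complex_manifold :: "'a topology \<Rightarrow> ('a, 'n::finite) chart set \<Rightarrow> bool" where
  "complex_manifold X A \<longleftrightarrow>
     Hausdorff_space X \<and> second_countable X \<and> connected_space X \<and>
     (\<Union>(U, \<kappa>)\<in>A. U) = topspace X \<and>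
     (\<forall>(U, \<kappa>)\<in>A. openin X U \<and> open (\<kappa> ` U) \<and>
        homeomorphic_map (subtopology X U) (top_of_set (\<kappa> ` U)) \<kappa>) \<and>
     (\<forall>(U, \<kappa>)\<in>A. \<forall>(V, \<mu>)\<in>A. holomorphic_vec (\<kappa> ` (U \<inter> V)) (\<mu> \<circ> inv_into U \<kappa>))"

definition holomorphic_to ::
  "(complex ^ 'm) set \<Rightarrow> 'a topology \<Rightarrow> ('a, 'n::finite) chart set \<Rightarrow> (complex ^ 'm \<Rightarrow> 'a) \<Rightarrow> bool" where
  "holomorphic_to S X A F \<longleftrightarrow>
     continuous_map (top_of_set S) X F \<and>
     (\<forall>(U, \<kappa>)\<in>A. holomorphic_vec {z\<in>S. F z \<in> U} (\<kappa> \<circ> F))"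

definition holomorphic_embedding ::
  "(complex ^ 'm) set \<Rightarrow> 'a topology \<Rightarrow> ('a, 'n::finite) chart set \<Rightarrow> (complex ^ 'm \<Rightarrow> 'a) \<Rightarrow> bool" where
  "holomorphic_embedding S X A F \<longleftrightarrow>
     holomorphic_to S X A F \<and> embedding_map (top_of_set S) X F \<and>
     (\<forall>(U, \<kappa>)\<in>A. \<forall>z\<in>S. F z \<in> U \<longrightarrow> inj (frechet_derivative (\<kappa> \<circ> F) (at z)))"

definition C2_function :: "('a, 'n::finite) chart set \<Rightarrow> ('a \<Rightarrow> real) \<Rightarrow> bool" where
  "C2_function A u \<longleftrightarrow> (\<forall>(U, \<kappa>)\<in>A. C2_on (\<kappa> ` U) (u \<circ> inv_into U \<kappa>))"

text \<open>Plurisubharmonicity of a continuous real-valued function: in every chart, the sub-mean value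
  inequality holds on each closed disc \<open>{a + \<zeta> b | \<bar>\<zeta>\<bar> \<le> 1}\<close> in a complex line.\<close>

definition continuous_psh :: "'a topology \<Rightarrow> ('a, 'n::finite) chart set \<Rightarrow> ('a \<Rightarrow> real) \<Rightarrow> bool" where
  "continuous_psh X A u \<longleftrightarrow>
     continuous_map X euclideanreal u \<and>
     (\<forall>(U, \<kappa>)\<in>A. \<forall>a b. (\<forall>\<zeta>\<in>cball 0 1. a + \<zeta> *s b \<in> \<kappa> ` U) \<longrightarrow>
        u (inv_into U \<kappa> a)
          \<le> 1 / (2 * pi) * integral {0..2 * pi} (\<lambda>\<theta>. u (inv_into U \<kappa> (a + cis \<theta> *s b))))"

definition wHHR :: "'a topology \<Rightarrow> ('a, 'n::finite) chart set \<Rightarrow> bool" where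
  "wHHR X A \<longleftrightarrow>
     (\<exists>s>0. \<forall>p\<in>topspace X. \<exists>(\<Phi> :: complex ^ 'n \<Rightarrow> 'a) (\<phi> :: 'a \<Rightarrow> real).
        holomorphic_embedding (ball 0 1) X A \<Phi> \<and> \<Phi> 0 = p \<and>
        C2_function A \<phi> \<and> continuous_psh X A \<phi> \<and> \<phi> ` topspace X \<subseteq> {0..1} \<and>
        (\<forall>w\<in>ball 0 1. \<forall>x. levi_form (\<phi> \<circ> \<Phi>) w x \<ge> s\<^sup>2 * (\<Sum>j\<in>UNIV. (cmod (x $ j))\<^sup>2)))"


section \<open>Kobayashi metric and distance\<close>

definition holomorphic_disc ::
  "'a topology \<Rightarrow> ('a, 'n::finite) chart set \<Rightarrow> (complex \<Rightarrow> 'a) \<Rightarrow> bool" where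
  "holomorphic_disc X A f \<longleftrightarrow>
     continuous_map (top_of_set (ball 0 1)) X f \<and>
     (\<forall>(U, \<kappa>)\<in>A. \<forall>i. (\<lambda>z. \<kappa> (f z) $ i) holomorphic_on {z\<in>ball 0 1. f z \<in> U})"

text \<open>A tangent vector at \<open>p\<close> is encoded by the family of its coordinate
  vectors: it maps each chart of the atlas around \<open>p\<close> to the coordinates of the vector in that
  chart, and everything else to 0.\<close>

type_synonym ('a, 'n) tangent = "('a, 'n) chart \<Rightarrow> complex ^ 'n"

text \<open>The image of \<open>\<xi>\<close> under the differential of \<open>f\<close> at 0.\<close>

definition disc_differential ::
  "('a, 'n::finite) chart set \<Rightarrow> (complex \<Rightarrow> 'a) \<Rightarrow> complex \<Rightarrow> ('a, 'n) tangent" where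
  "disc_differential A f \<xi> =
     (\<lambda>(U, \<kappa>). if (U, \<kappa>) \<in> A \<and> f 0 \<in> U
               then \<xi> *s (\<chi> i. deriv (\<lambda>z. \<kappa> (f z) $ i) 0) else 0)"

definition velocity ::
  "('a, 'n::finite) chart set \<Rightarrow> (real \<Rightarrow> 'a) \<Rightarrow> real \<Rightarrow> ('a, 'n) tangent" where
  "velocity A \<sigma> t =
     (\<lambda>(U, \<kappa>). if (U, \<kappa>) \<in> A \<and> \<sigma> t \<in> U
               then vector_derivative (\<kappa> \<circ> \<sigma>) (at t within {0..1}) else 0)"

definition kobayashi_metric ::
  "'a topology \<Rightarrow> ('a, 'n::finite) chart set \<Rightarrow> 'a \<Rightarrow> ('a, 'n) tangent \<Rightarrow> ennreal" where
  "kobayashi_metric X A p v =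
     Inf {ennreal (cmod \<xi>) | \<xi> f. holomorphic_disc X A f \<and> f 0 = p \<and> disc_differential A f \<xi> = v}"

definition C1_curve_on ::
  "'a topology \<Rightarrow> ('a, 'n::finite) chart set \<Rightarrow> real \<Rightarrow> real \<Rightarrow> (real \<Rightarrow> 'a) \<Rightarrow> bool" where
  "C1_curve_on X A a b \<sigma> \<longleftrightarrow>
     continuous_map (top_of_set {a..b}) X \<sigma> \<and>
     (\<forall>(U, \<kappa>)\<in>A. \<exists>D. continuous_on {t\<in>{a..b}. \<sigma> t \<in> U} D \<and>
        (\<forall>t\<in>{a..b}. \<sigma> t \<in> U \<longrightarrow> ((\<kappa> \<circ> \<sigma>) has_vector_derivative D t) (at t within {a..b})))"

text \<open>The finite set \<open>S\<close> consists of the break points; the curve is \<open>C\<^sup>1\<close> up to the end points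
  of each closed piece between consecutive ones.\<close>

definition piecewise_C1_curve ::
  "'a topology \<Rightarrow> ('a, 'n::finite) chart set \<Rightarrow> (real \<Rightarrow> 'a) \<Rightarrow> bool" where
  "piecewise_C1_curve X A \<sigma> \<longleftrightarrow>
     continuous_map (top_of_set {0..1}) X \<sigma> \<and>
     (\<exists>S. finite S \<and>
        (\<forall>a b. 0 \<le> a \<and> a < b \<and> b \<le> 1 \<and> {a<..<b} \<inter> S = {} \<longrightarrow> C1_curve_on X A a b \<sigma>))"

text \<open>At the finitely many break points, a null set, the value of the integrand is irrelevant.
  Elsewhere it is piecewise upper semicontinuous by a theorem of Royden, hence Borel measurable.\<close>

definition kobayashi_dist ::
  "'a topology \<Rightarrow> ('a, 'n::finite) chart set \<Rightarrow> 'a \<Rightarrow> 'a \<Rightarrow> ennreal" where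
  "kobayashi_dist X A p q =
     Inf {\<integral>\<^sup>+t\<in>{0..1}. kobayashi_metric X A (\<sigma> t) (velocity A \<sigma> t) \<partial>lborel | \<sigma>.
            piecewise_C1_curve X A \<sigma> \<and> \<sigma> 0 = p \<and> \<sigma> 1 = q}"

end

theory Submission
  imports Defs "HOL-Complex_Analysis.Cauchy_Integral_Formula"
begin

text \<open>Let \<open>\<Phi>\<close> be the embedded ball at a point and \<open>\<phi>\<close> the bounded plurisubharmonic function that is
  strictly plurisubharmonic on it. Following Sibony, a multiple of \<open>\<phi>\<close> absorbs the negative part of
  the Levi form of a truncation of \<open>log |\<Phi>\<^sup>-\<^sup>1 - w|\<^sup>2\<close>, which yields a bounded log-plurisubharmonic
  function on the whole manifold vanishing to second order at \<open>\<Phi> w\<close>. Comparing its pullback under a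
  holomorphic disc with \<open>|z|\<^sup>2\<close> by the maximum principle bounds the derivative of the disc, so
  the Kobayashi metric dominates a fixed multiple of the Euclidean metric on the half ball, with a constant
  that depends only on \<open>s\<close>. Hence every Kobayashi ball of a certain uniform radius is contained
  in a compact set, and a Cauchy sequence has a convergent subsequence.\<close>

subsection \<open>Complex scalars and holomorphic maps\<close>

text \<open>The obstacle is that Sibony's function is neither smooth nor given by one formula on the
  manifold. The profile x exp(-x) replaces the usual cutoff function: its maximum is at x = 1, so
  truncating t = 4 |p - w| at 1, with p the inverse of \<Phi>, can only raise t^2 exp(-t^2). At a
  maximum point of the comparison function a C^2 minorant touching there is enough. Likewise |p - w|
  is replaced by |l| for a complex linear functional l of p - w, because log |l|^2 is harmonic along
  discs where l is nonzero. Only -t^2 then contributes negatively to the Levi form, by -16 times the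
  Euclidean metric, and this fixes the multiple of \<phi> as 16 / s^2. The maximum principle thus
  becomes a second-derivative test at one point. It is applied to \<Lambda>(f z) |z|^(-\<beta>)
  exp(\<epsilon> |z|^2): \<beta> < 2 forces decay at the origin, \<epsilon> > 0 makes the test
  strict, and both perturbations are removed in a limit.\<close>

lemma norm_smult: "norm (c *s x) = cmod c * norm (x :: complex ^ 'n)"
  by (simp add: norm_vec_def L2_set_def norm_mult power_mult_distrib
      sum_distrib_left[symmetric] real_sqrt_mult)

lemma smult_of_real: "complex_of_real r *s x = r *\<^sub>R (x :: complex ^ 'n)"
  by (simp add: vec_eq_iff scaleR_conv_of_real[where 'a=complex])

lemma bounded_bilinear_smult: "bounded_bilinear ((*s) :: complex \<Rightarrow> complex ^ 'n \<Rightarrow> complex ^ 'n)"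
proof
  show "\<exists>K. \<forall>a (b::complex ^ 'n). norm (a *s b) \<le> norm a * norm b * K"
    by (rule exI[of _ 1]) (simp add: norm_smult)
qed (simp_all add: vec_eq_iff algebra_simps)

lemmas continuous_on_smult [continuous_intros] =
  bounded_bilinear.continuous_on[OF bounded_bilinear_smult]
lemmas bounded_linear_smult_right = bounded_bilinear.bounded_linear_right[OF bounded_bilinear_smult]
lemmas bounded_linear_smult_left = bounded_bilinear.bounded_linear_left[OF bounded_bilinear_smult]

lemma linear_smultD:
  fixes D :: "complex ^ 'm \<Rightarrow> complex ^ 'n"
  assumes "Vector_Spaces.linear (*s) (*s) D"
  shows "D (c *s x) = c *s D x"
  using assms by (simp add: Vector_Spaces.linear_iff)

text \<open>Discs are given coordinate by coordinate, as on the right; the chain rule for Frechet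
  derivatives needs the form on the left. The two agree because a complex linear map on the plane
  multiplies a fixed vector.\<close>

lemma has_derivative_smult_iff:
  fixes g :: "complex \<Rightarrow> complex ^ 'n"
  shows "(g has_derivative (\<lambda>c. c *s d)) (at z) \<longleftrightarrow>
         (\<forall>i. ((\<lambda>z. g z $ i) has_field_derivative d $ i) (at z))"
proof
  assume "(g has_derivative (\<lambda>c. c *s d)) (at z)"
  then have "((\<lambda>z. g z $ i) has_derivative (\<lambda>c. (c *s d) $ i)) (at z)" for i
    by (rule bounded_linear.has_derivative[OF bounded_linear_vec_nth])
  then show "\<forall>i. ((\<lambda>z. g z $ i) has_field_derivative d $ i) (at z)"
    by (simp add: has_field_derivative_def mult_commute_abs)
next
  assume *: "\<forall>i. ((\<lambda>z. g z $ i) has_field_derivative d $ i) (at z)"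
  have "((\<lambda>z. g z \<bullet> b) has_derivative (\<lambda>c. (c *s d) \<bullet> b)) (at z)" if "b \<in> Basis" for b
  proof -
    obtain i u where b: "b = axis i u" using \<open>b \<in> Basis\<close> by (auto simp: Basis_vec_def)
    have "((\<lambda>z. g z $ i) has_derivative (\<lambda>c. c * d $ i)) (at z)"
      using * by (simp add: has_field_derivative_def mult_commute_abs)
    from bounded_linear.has_derivative[OF bounded_linear_inner_left this, of u]
    show ?thesis by (simp add: b inner_axis)
  qed
  then show "(g has_derivative (\<lambda>c. c *s d)) (at z)"
    by (subst has_derivative_componentwise_within) auto
qed

lemma has_derivative_smult_line:
  "((\<lambda>c. z + c *s v) has_derivative (\<lambda>c. c *s (v :: complex ^ 'n))) (at c)"
  using has_derivative_add[OF has_derivative_const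
      bounded_linear_imp_has_derivative[OF bounded_linear_smult_left]] by simp

section \<open>Cauchy's formula on complex lines and regularity of holomorphic maps\<close>

lemma cauchy_has_integral_circle:
  assumes "f holomorphic_on S" "open S" "cball 0 r \<subseteq> S" "0 < r"
    and "(f has_field_derivative d) (at 0)"
  shows "((\<lambda>t. exp (- (2 * of_real pi * \<i> * of_real t)) / r * f (of_real r * exp (2 * of_real pi * \<i> * of_real t)))
           has_integral d) {0..1}"
proof -
  have "((\<lambda>u. f u / (u-0) ^ (Suc 1)) has_contour_integral ((2 * pi * \<i>) / (fact 1) * (deriv ^^ 1) f 0))
           (circlepath 0 r)"
    using assms by (intro Cauchy_has_contour_integral_higher_derivative_circlepath
        holomorphic_on_imp_continuous_on holomorphic_on_subset[OF assms(1)])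
      (auto dest: ball_subset_cball[THEN subsetD])
  moreover have "deriv f 0 = d"
    using assms(5) by (rule DERIV_imp_deriv)
  ultimately have "((\<lambda>u. f u / u ^ 2) has_contour_integral (2 * pi * \<i> * d)) (circlepath 0 r)"
    by (simp add: power2_eq_square)
  then have "((\<lambda>t. f (circlepath 0 r t) / (circlepath 0 r t) ^ 2 *
      vector_derivative (circlepath 0 r) (at t within {0..1})) has_integral (2 * pi * \<i> * d)) {0..1}"
    by (simp add: has_contour_integral_def)
  then have "((\<lambda>t. 1 / (2 * pi * \<i>) * (f (circlepath 0 r t) / (circlepath 0 r t) ^ 2 *
      vector_derivative (circlepath 0 r) (at t within {0..1}))) has_integral (1 / (2 * pi * \<i>) * (2 * pi * \<i> * d))) {0..1}"
    by (rule has_integral_mult_right)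
  moreover have "1 / (2 * pi * \<i>) * (f (circlepath 0 r t) / (circlepath 0 r t) ^ 2 *
      vector_derivative (circlepath 0 r) (at t within {0..1})) =
      exp (- (2 * of_real pi * \<i> * of_real t)) / r * f (of_real r * exp (2 * of_real pi * \<i> * of_real t))"
    if "t \<in> {0..1}" for t
  proof -
    have "vector_derivative (circlepath 0 r) (at t within {0..1}) = 2 * pi * \<i> * r * exp (2 * of_real pi * \<i> * t)"
      using that by (simp add: vector_derivative_circlepath01)
    then show ?thesis
      using assms(4) by (simp only:) (simp add: circlepath exp_minus field_simps power2_eq_square)
  qed
  ultimately have "((\<lambda>t. exp (- (2 * of_real pi * \<i> * of_real t)) / r * f (of_real r * exp (2 * of_real pi * \<i> * of_real t)))
           has_integral (1 / (2 * pi * \<i>) * (2 * pi * \<i> * d))) {0..1}"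
    by (rule has_integral_eq[rotated])
  then show ?thesis by simp
qed

text \<open>This is the one-variable formula on the line sending c to z + c v;
  \<open>norm v \<le> 1\<close> keeps the image of \<open>cball 0 r\<close> inside
  \<open>cball z r\<close>. The interval of integration is fixed and z enters only through the
  integrand, so the formula can be differentiated in z.\<close>

lemma holomorphic_vec_cauchy:
  fixes h :: "complex ^ 'm \<Rightarrow> complex ^ 'n"
  assumes h: "holomorphic_vec S h" and S: "open S" "cball z r \<subseteq> S" "0 < r" "norm v \<le> 1"
    and D: "(h has_derivative D) (at z)"
  shows "D v = integral {0..1} (\<lambda>t. (exp (- (2 * of_real pi * \<i> * of_real t)) / r) *s
                 h (z + (of_real r * exp (2 * of_real pi * \<i> * of_real t)) *s v))"
    (is "_ = integral _ ?I")
proof -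
  obtain D' where D': "(h has_derivative D') (at z)" "Vector_Spaces.linear (*s) (*s) D'"
    using h S unfolding holomorphic_vec_def
    by (meson centre_in_cball less_imp_le subsetD)
  then have DD: "D = D'" using D has_derivative_unique by blast
  define T where "T = (\<lambda>c. z + c *s v) -` S"
  have cont_line: "continuous_on UNIV (\<lambda>c. z + c *s v)"
    by (intro continuous_intros)
  have oT: "open T" unfolding T_def
    by (rule open_vimage[OF S(1) cont_line])
  have cT: "cball 0 r \<subseteq> T"
  proof
    fix c assume c: "c \<in> cball (0::complex) r"
    have "cmod c * norm v \<le> r * 1" using c S by (intro mult_mono) auto
    then have "z + c *s v \<in> cball z r" by (simp add: dist_norm norm_smult)
    then show "c \<in> T" using S by (auto simp: T_def)
  qed
  have deriv_line: "\<exists>d. ((\<lambda>c. h (z + c *s v)) has_derivative (\<lambda>c. c *s d)) (at c)" if "c \<in> T" for c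
  proof -
    obtain E where E: "(h has_derivative E) (at (z + c *s v))" "Vector_Spaces.linear (*s) (*s) E"
      using h[unfolded holomorphic_vec_def, rule_format, of "z + c *s v"] \<open>c \<in> T\<close>
      unfolding T_def vimage_eq by blast
    have "((\<lambda>c. z + c *s v) has_derivative (\<lambda>c. c *s v)) (at c)"
      by (rule has_derivative_smult_line)
    from diff_chain_at[OF this E(1)] linear_smultD[OF E(2)]
    show ?thesis by (auto simp: o_def)
  qed
  have hol: "(\<lambda>c. h (z + c *s v) $ i) holomorphic_on T" for i
    unfolding holomorphic_on_open[OF oT] using deriv_line by (auto simp: has_derivative_smult_iff)
  have "((\<lambda>c. z + c *s v) has_derivative (\<lambda>c. c *s v)) (at 0)"
    by (rule has_derivative_smult_line)
  from diff_chain_at[OF this, of h D'] D'(1) linear_smultD[OF D'(2)]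
  have "((\<lambda>c. h (z + c *s v)) has_derivative (\<lambda>c. c *s D' v)) (at 0)" by (simp add: o_def)
  then have d0: "((\<lambda>c. h (z + c *s v) $ i) has_field_derivative D' v $ i) (at 0)" for i
    by (simp add: has_derivative_smult_iff)
  have hi: "((\<lambda>t. ?I t $ i) has_integral D' v $ i) {0..1}" for i
    using cauchy_has_integral_circle[OF hol oT cT S(3) d0[of i]] by simp
  have conth: "continuous_on S h"
    using h unfolding holomorphic_vec_def
    by (meson continuous_at_imp_continuous_on has_derivative_continuous)
  have "continuous_on {0..1} ?I"
  proof (intro continuous_intros continuous_on_compose2[OF conth])
    show "(\<lambda>t. z + (of_real r * exp (2 * of_real pi * \<i> * of_real t)) *s v) ` {0..1} \<subseteq> S"
    proof safe
      fix t :: real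
      have "of_real r * exp (2 * of_real pi * \<i> * of_real t) \<in> cball 0 r"
        using S by (simp add: norm_mult)
      then show "z + (of_real r * exp (2 * of_real pi * \<i> * of_real t)) *s v \<in> S"
        using cT by (auto simp: T_def)
    qed
  qed (use S in auto)
  then have "?I integrable_on {0..1}" by (rule integrable_continuous_real)
  then have "integral {0..1} ?I $ i = D' v $ i" for i
    using integral_linear[OF _ bounded_linear_vec_nth[of i], of ?I] integral_unique[OF hi[of i]]
    by (simp add: o_def)
  then show ?thesis by (simp add: DD vec_eq_iff)
qed

text \<open>Cauchy's formula controls \<open>h' z v\<close> for one fixed v at a time. This
  expansion turns that into continuity and differentiability of the operator-valued map
  \<open>h'\<close>.\<close>

lemma blinfun_basis_sum:
  fixes f :: "'a::euclidean_space \<Rightarrow>\<^sub>L 'b::real_normed_vector"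
  shows "f = (\<Sum>j\<in>Basis. blinfun_scaleR_left (f j) o\<^sub>L blinfun_inner_left j)"
proof (rule blinfun_eqI)
  fix x
  have "f x = f (\<Sum>j\<in>Basis. (x \<bullet> j) *\<^sub>R j)" by (simp add: euclidean_representation)
  then show "f x = (\<Sum>j\<in>Basis. blinfun_scaleR_left (f j) o\<^sub>L blinfun_inner_left j) x"
    by (simp add: blinfun.sum_left blinfun.sum_right blinfun.scaleR_right)
qed

lemma bounded_linear_blinfun_basis_summand:
  "bounded_linear (\<lambda>y. blinfun_scaleR_left y o\<^sub>L blinfun_inner_left j)"
  by (intro bounded_linear_compose[OF bounded_bilinear.bounded_linear_left[OF bounded_bilinear_blinfun_compose]]
      bounded_linear_blinfun_scaleR_left)

text \<open>Cauchy's formula is differentiated under the integral sign. This needs continuity of the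
  derivative of \<open>h\<close> first, which the same formula provides.\<close>

lemma holomorphic_vec_twice_differentiable:
  fixes h :: "complex ^ 'm \<Rightarrow> complex ^ 'n"
  assumes h: "holomorphic_vec S h" and S: "open S"
  obtains h' :: "complex ^ 'm \<Rightarrow> (complex ^ 'm) \<Rightarrow>\<^sub>L (complex ^ 'n)" where
    "\<And>z. z \<in> S \<Longrightarrow> (h has_derivative blinfun_apply (h' z)) (at z)"
    "\<And>z c x. z \<in> S \<Longrightarrow> blinfun_apply (h' z) (c *s x) = c *s blinfun_apply (h' z) x"
    "\<And>z. z \<in> S \<Longrightarrow> h' differentiable (at z)"
proof -
  define h' where "h' z = Blinfun (frechet_derivative h (at z))" for z
  have h'1: "(h has_derivative blinfun_apply (h' z)) (at z) \<and> Vector_Spaces.linear (*s) (*s) (blinfun_apply (h' z))"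
    if "z \<in> S" for z
  proof -
    obtain D where D: "(h has_derivative D) (at z)" "Vector_Spaces.linear (*s) (*s) D"
      using h[unfolded holomorphic_vec_def, rule_format, OF \<open>z \<in> S\<close>] by blast
    have "frechet_derivative h (at z) = D" using frechet_derivative_at[OF D(1)] by (rule sym)
    then have "blinfun_apply (h' z) = D"
      by (simp add: h'_def bounded_linear_Blinfun_apply[OF has_derivative_bounded_linear[OF D(1)]])
    then show ?thesis using D by simp
  qed
  have conth: "continuous_on S h"
    using h'1 by (meson continuous_at_imp_continuous_on has_derivative_continuous)
  define e where "e t = exp (2 * of_real pi * \<i> * complex_of_real t)" for t
  have ce: "continuous_on T e" for T unfolding e_def by (intro continuous_intros)
  have ce': "continuous_on T (\<lambda>x. e (snd x))" for T :: "((complex ^ 'm) \<times> real) set"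
    unfolding e_def by (intro continuous_intros)
  have ne: "e t \<noteq> 0" for t by (simp add: e_def)
  have norme: "cmod (e t) = 1" for t by (simp add: e_def)
  have formula: "blinfun_apply (h' z) v = integral {0..1} (\<lambda>t. (inverse (e t) / of_real r) *s h (z + (of_real r * e t) *s v))"
    if "cball z r \<subseteq> S" "0 < r" "norm v \<le> 1" for z r v
  proof -
    have "z \<in> S" using that by (auto intro: subsetD)
    then show ?thesis
      using holomorphic_vec_cauchy[OF h S that, of "h' z"] h'1[of z] by (simp add: e_def exp_minus)
  qed
  have inS: "z + (complex_of_real r * e t) *s v \<in> S"
    if "cball z0 (2 * r) \<subseteq> S" "z \<in> ball z0 r" "norm v \<le> 1" "0 < r" for z z0 r v t
  proof -
    have "r * norm v \<le> r * 1" using that by (intro mult_left_mono) auto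
    moreover have "norm ((complex_of_real r * e t) *s v) = r * norm v"
      using that by (simp add: norm_smult norm_mult norme)
    moreover have "norm (z0 - z) < r" using that by (simp add: dist_norm)
    moreover have "norm (z0 - (z + (complex_of_real r * e t) *s v)) = norm ((z0 - z) - (complex_of_real r * e t) *s v)"
      by (simp add: algebra_simps)
    ultimately have "dist z0 (z + (complex_of_real r * e t) *s v) \<le> 2 * r"
      using norm_triangle_ineq4[of "z0 - z" "(complex_of_real r * e t) *s v"]
      unfolding dist_norm by linarith
    then show ?thesis using that by auto
  qed
  have sub: "cball z r \<subseteq> S" if "cball z0 (2 * r) \<subseteq> S" "z \<in> ball z0 r" for z z0 r
  proof
    fix y assume "y \<in> cball z r"
    then have "dist z0 y \<le> 2 * r" using that dist_triangle[of z0 y z] by (simp add: dist_commute)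
    then show "y \<in> S" using that by auto
  qed
  have cont': "continuous_on S h'"
  proof (rule continuous_at_imp_continuous_on, safe)
    fix z0 assume z0: "z0 \<in> S"
    obtain r0 where r0: "r0 > 0" "cball z0 r0 \<subseteq> S" using S z0 open_contains_cball by blast
    \<comment> \<open>Circles of radius \<open>r\<close> about every point of
      \<open>ball z0 r\<close> stay in \<open>S\<close>, so a formula with one fixed radius serves a
      whole neighbourhood of \<open>z0\<close>.\<close>
    define r where "r = r0 / 2"
    have r: "0 < r" "cball z0 (2 * r) \<subseteq> S" using r0 by (auto simp: r_def)
    have "continuous_on (ball z0 r) (\<lambda>z. blinfun_apply (h' z) v)" if v: "norm v \<le> 1" for v
    proof -
      have "continuous_on (ball z0 r) (\<lambda>z. integral (cbox 0 1) (\<lambda>t. (inverse (e t) / of_real r) *s h (z + (of_real r * e t) *s v)))"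
      proof (rule integral_continuous_on_param)
        show "continuous_on (ball z0 r \<times> cbox 0 1) (\<lambda>(z, t). (inverse (e t) / of_real r) *s h (z + (of_real r * e t) *s v))"
          unfolding split_beta
          by (intro continuous_intros ce' continuous_on_compose2[OF conth])
             (use r inS v ne in auto)
      qed
      then show ?thesis
        by (rule continuous_on_eq) (use formula[OF sub[OF r(2)] r(1) v] in auto)
    qed
    then have "continuous (at z0) (\<lambda>z. blinfun_apply (h' z) v)" if "norm v \<le> 1" for v
      using that r continuous_on_eq_continuous_at[OF open_ball] by (metis centre_in_ball)
    then have "continuous (at z0) (\<lambda>z. \<Sum>j\<in>Basis. blinfun_scaleR_left (blinfun_apply (h' z) j) o\<^sub>L blinfun_inner_left j)"
      by (intro continuous_sum bounded_linear.continuous[OF bounded_linear_blinfun_basis_summand]) auto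
    then show "isCont h' z0"
      by (simp add: blinfun_basis_sum[symmetric])
  qed
  have "h' differentiable (at z0)" if z0: "z0 \<in> S" for z0
  proof -
    obtain r0 where r0: "r0 > 0" "cball z0 r0 \<subseteq> S" using S z0 open_contains_cball by blast
    define r where "r = r0 / 2"
    have r: "0 < r" "cball z0 (2 * r) \<subseteq> S" using r0 by (auto simp: r_def)
    have dv: "(\<lambda>z. blinfun_apply (h' z) v) differentiable (at z0)" if v: "norm v \<le> 1" for v
    proof -
      \<comment> \<open>Multiplication by \<open>c\<close> as a bounded operator: differentiation
        under the integral sign takes the derivative of the integrand as an operator-valued
        function.\<close>
      define m where "m c = Blinfun (\<lambda>x::complex ^ 'n. c *s x)" for c
      have m: "blinfun_apply (m c) x = c *s x" for c x
        by (simp add: m_def bounded_linear_Blinfun_apply[OF bounded_linear_smult_right])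
      have mo: "blinfun_apply (m c o\<^sub>L k) = (\<lambda>x. c *s k x)"
        for c and k :: "(complex ^ 'm) \<Rightarrow>\<^sub>L (complex ^ 'n)"
        by (auto simp: m)
      have bm: "bounded_linear m"
      proof (rule bounded_linear_intro[where K=1])
        fix c :: complex
        show "norm (m c) \<le> norm c * 1"
          by (rule norm_blinfun_bound) (auto simp: m norm_smult)
      qed (auto intro!: blinfun_eqI simp: m blinfun.add_left blinfun.scaleR_left vec_eq_iff algebra_simps)
      have "((\<lambda>z. integral (cbox 0 1) (\<lambda>t. (inverse (e t) / of_real r) *s h (z + (of_real r * e t) *s v)))
         has_derivative blinfun_apply (integral (cbox 0 1) (\<lambda>t. m (inverse (e t) / of_real r) o\<^sub>L h' (z0 + (of_real r * e t) *s v))))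
          (at z0 within ball z0 r)"
      proof (rule leibniz_rule)
        fix z t assume z: "z \<in> ball z0 r"
        have 1: "(h has_derivative blinfun_apply (h' (z + (of_real r * e t) *s v))) (at (z + (of_real r * e t) *s v))"
          using h'1 inS r z v by blast
        have 2: "((\<lambda>z. z + (of_real r * e t) *s v) has_derivative (\<lambda>x. x)) (at z)"
          by (auto intro!: derivative_eq_intros)
        have "((\<lambda>z. h (z + (of_real r * e t) *s v)) has_derivative blinfun_apply (h' (z + (of_real r * e t) *s v))) (at z)"
          using diff_chain_at[OF 2 1] by (simp add: o_def)
        from bounded_linear.has_derivative[OF bounded_linear_smult_right this]
        show "((\<lambda>z. (inverse (e t) / of_real r) *s h (z + (of_real r * e t) *s v)) has_derivative
           blinfun_apply (m (inverse (e t) / of_real r) o\<^sub>L h' (z + (of_real r * e t) *s v))) (at z within ball z0 r)"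
          unfolding mo by (rule has_derivative_at_withinI)
      next
        fix z assume z: "z \<in> ball z0 r"
        have "continuous_on {0..1} (\<lambda>t. (inverse (e t) / complex_of_real r) *s h (z + (of_real r * e t) *s v))"
          by (intro continuous_intros ce continuous_on_compose2[OF conth])
             (use r inS v ne z in auto)
        then show "(\<lambda>t. (inverse (e t) / complex_of_real r) *s h (z + (of_real r * e t) *s v)) integrable_on cbox 0 1"
          by (auto intro: integrable_continuous_real)
      next
        show "continuous_on (ball z0 r \<times> cbox 0 1)
          (\<lambda>(z, t). m (inverse (e t) / of_real r) o\<^sub>L h' (z + (of_real r * e t) *s v))"
          unfolding split_beta
          by (intro bounded_bilinear.continuous_on[OF bounded_bilinear_blinfun_compose]
              bounded_linear.continuous_on[OF bm] continuous_intros ce' continuous_on_compose2[OF cont'])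
             (use r inS v ne in auto)
      qed (use r in auto)
      then obtain E where "((\<lambda>z. integral (cbox 0 1) (\<lambda>t. (inverse (e t) / of_real r) *s h (z + (of_real r * e t) *s v)))
         has_derivative E) (at z0 within ball z0 r)" by blast
      then have "((\<lambda>z. blinfun_apply (h' z) v) has_derivative E) (at z0 within ball z0 r)"
        by (rule has_derivative_transform_within[OF _ r(1)]) (use r formula[OF sub[OF r(2)] r(1) v] in auto)
      then show ?thesis
        using r at_within_open[of z0 "ball z0 r"] unfolding differentiable_def by auto
    qed
    have "(\<lambda>z. \<Sum>j\<in>Basis. blinfun_scaleR_left (blinfun_apply (h' z) j) o\<^sub>L blinfun_inner_left j) differentiable (at z0)"
    proof (intro differentiable_sum finite_Basis ballI)
      fix j :: "complex ^ 'm" assume "j \<in> Basis"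
      with dv[of j] obtain E where "((\<lambda>z. blinfun_apply (h' z) j) has_derivative E) (at z0)"
        unfolding differentiable_def by auto
      from bounded_linear.has_derivative[OF bounded_linear_blinfun_basis_summand this]
      show "(\<lambda>z. blinfun_scaleR_left (blinfun_apply (h' z) j) o\<^sub>L blinfun_inner_left j) differentiable (at z0)"
        unfolding differentiable_def by blast
    qed
    then show ?thesis by (simp add: blinfun_basis_sum[symmetric])
  qed
  moreover have "blinfun_apply (h' z) (c *s x) = c *s blinfun_apply (h' z) x" if "z \<in> S" for z c x
    using h'1[OF that] linear_smultD by blast
  ultimately show ?thesis using that[of h'] h'1 by simp
qed

subsection \<open>Second derivatives and the Levi form\<close>

text \<open>Weaker than \<open>C2_on\<close>. It passes to pullbacks under holomorphic maps, whose
  derivative is only known to be differentiable, and it is what the pointwise second-order tests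
  use.\<close>

definition has_hessian_on ::
  "('b::real_normed_vector \<Rightarrow> real) \<Rightarrow> ('b \<Rightarrow> 'b \<Rightarrow>\<^sub>L real) \<Rightarrow> ('b \<Rightarrow> 'b \<Rightarrow> 'b \<Rightarrow>\<^sub>L real) \<Rightarrow> 'b set \<Rightarrow> bool" where
  "has_hessian_on u u' u'' S \<longleftrightarrow>
     (\<forall>x\<in>S. (u has_derivative blinfun_apply (u' x)) (at x) \<and> (u' has_derivative u'' x) (at x))"

lemma has_hessian_onD:
  assumes "has_hessian_on u u' u'' S" "x \<in> S"
  shows "(u has_derivative blinfun_apply (u' x)) (at x)" "(u' has_derivative u'' x) (at x)"
  using assms by (auto simp: has_hessian_on_def)

lemma C2_on_has_hessian:
  assumes "C2_on S u"
  obtains u' u'' where "has_hessian_on u u' u'' S"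
proof -
  obtain u' u'' where "\<forall>x\<in>S. (u has_derivative blinfun_apply (u' x)) (at x)"
      "\<forall>x\<in>S. (u' has_derivative blinfun_apply (u'' x)) (at x)"
    using assms unfolding C2_on_def by blast
  then have "has_hessian_on u u' (\<lambda>x. blinfun_apply (u'' x)) S"
    by (auto simp: has_hessian_on_def)
  with that show ?thesis by blast
qed

lemma has_hessian_on_compose_holomorphic_vec:
  fixes h :: "complex ^ 'm \<Rightarrow> complex ^ 'n"
  assumes u: "has_hessian_on u u' u'' T" and h: "holomorphic_vec S h" "open S" "h ` S \<subseteq> T"
  obtains k' k'' where "has_hessian_on (u \<circ> h) k' k'' S"
proof -
  obtain h' where h': "\<And>z. z \<in> S \<Longrightarrow> (h has_derivative blinfun_apply (h' z)) (at z)"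
    "\<And>z. z \<in> S \<Longrightarrow> h' differentiable (at z)"
    using holomorphic_vec_twice_differentiable[OF h(1,2)] by metis
  define k' where "k' z = u' (h z) o\<^sub>L h' z" for z
  have 1: "((u \<circ> h) has_derivative blinfun_apply (k' z)) (at z)" if "z \<in> S" for z
  proof -
    have "h z \<in> T" using that h(3) by blast
    from diff_chain_at[OF h'(1)[OF that] has_hessian_onD(1)[OF u this]]
    show ?thesis by (simp add: k'_def blinfun_compose.rep_eq)
  qed
  have 2: "\<exists>D. (k' has_derivative D) (at z)" if "z \<in> S" for z
  proof -
    have "h z \<in> T" using that h(3) by blast
    from diff_chain_at[OF h'(1)[OF that] has_hessian_onD(2)[OF u this]]
    have a: "((\<lambda>z. u' (h z)) has_derivative (u'' (h z) \<circ> h' z)) (at z)" by (simp add: o_def)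
    obtain E where b: "(h' has_derivative E) (at z)"
      using h'(2)[OF \<open>z \<in> S\<close>] unfolding differentiable_def by blast
    show ?thesis
      unfolding k'_def
      using bounded_bilinear.FDERIV[OF bounded_bilinear_blinfun_compose a b] by blast
  qed
  \<comment> \<open>No formula for this second derivative is kept: where its values matter, they are
    recovered from the Levi form by \<open>levi_form_eq_hessian\<close>.\<close>
  define k'' where "k'' z = (SOME D. (k' has_derivative D) (at z))" for z
  have "(k' has_derivative k'' z) (at z)" if "z \<in> S" for z
    unfolding k''_def using someI_ex[OF 2[OF that]] .
  with 1 have "has_hessian_on (u \<circ> h) k' k'' S"
    by (simp add: has_hessian_on_def)
  with that show ?thesis by blast
qed

lemma bilinear_expansion:
  fixes B :: "complex ^ 'n \<Rightarrow> (complex ^ 'n) \<Rightarrow>\<^sub>L real" and a b :: complex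
  assumes "bounded_linear B"
  shows "blinfun_apply (B (axis j a)) (axis k b) =
    Re a * Re b * B (axis j 1) (axis k 1) + Re a * Im b * B (axis j 1) (axis k \<i>) +
    Im a * Re b * B (axis j \<i>) (axis k 1) + Im a * Im b * B (axis j \<i>) (axis k \<i>)"
proof -
  interpret bounded_linear B by fact
  have ax: "axis i c = Re c *\<^sub>R axis i 1 + Im c *\<^sub>R axis i \<i>" for i :: 'n and c :: complex
    by (simp add: vec_eq_iff axis_def complex_eq_iff)
  show ?thesis
    by (subst ax[of j a], subst ax[of k b])
       (simp add: add scaleR blinfun.add_left blinfun.add_right blinfun.scaleR_left blinfun.scaleR_right algebra_simps)
qed

text \<open>The identity holds for each pair of indices j, k separately, by expanding both Wirtinger
  operators into real directions; the 4 comes from their two halves. It replaces mixed complex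
  derivatives by a real Hessian, which behaves well under restriction to real lines.\<close>

lemma levi_form_eq_hessian:
  assumes u: "has_hessian_on u u' u'' S" and S: "open S" "w \<in> S"
  shows "4 * levi_form u w x = u'' w x x + u'' w (\<i> *s x) (\<i> *s x)"
proof -
  note blu = has_derivative_bounded_linear[OF has_hessian_onD(2)[OF u S(2)]]
  interpret B: bounded_linear "u'' w" by (rule blu)
  have fd: "frechet_derivative (\<lambda>z. complex_of_real (u z)) (at y) = (\<lambda>h. of_real (u' y h))" if "y \<in> S" for y
    using bounded_linear.has_derivative[OF bounded_linear_of_real has_hessian_onD(1)[OF u that]]
    by (rule frechet_derivative_at[symmetric])
  have wb: "wirtinger_bar k (\<lambda>z. complex_of_real (u z)) y =
     (of_real (u' y (axis k 1)) + \<i> * of_real (u' y (axis k \<i>))) / 2" if "y \<in> S" for y k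
    by (simp add: wirtinger_bar_def fd[OF that])
  have d: "((\<lambda>y. complex_of_real (u' y v)) has_derivative (\<lambda>h. of_real (u'' w h v))) (at w)" for v
    by (intro bounded_linear.has_derivative[OF bounded_linear_of_real]
        bounded_linear.has_derivative[OF blinfun.bounded_linear_left] has_hessian_onD(2)[OF u S(2)])
  have "((\<lambda>y. (of_real (u' y (axis k 1)) + \<i> * of_real (u' y (axis k \<i>))) / 2) has_derivative
      (\<lambda>h. (of_real (u'' w h (axis k 1)) + \<i> * of_real (u'' w h (axis k \<i>))) / 2)) (at w)" for k
    by (intro bounded_linear.has_derivative[OF bounded_linear_divide] has_derivative_add d
        bounded_linear.has_derivative[OF bounded_linear_mult_right])
  then have "((wirtinger_bar k (\<lambda>z. complex_of_real (u z))) has_derivative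
      (\<lambda>h. (of_real (u'' w h (axis k 1)) + \<i> * of_real (u'' w h (axis k \<i>))) / 2)) (at w)" for k
    by (rule has_derivative_transform_within_open[OF _ S]) (simp add: wb)
  then have fw: "frechet_derivative (wirtinger_bar k (\<lambda>z. complex_of_real (u z))) (at w) =
      (\<lambda>h. (of_real (u'' w h (axis k 1)) + \<i> * of_real (u'' w h (axis k \<i>))) / 2)" for k
    by (rule frechet_derivative_at[symmetric])
  have summand: "4 * Re (wirtinger j (wirtinger_bar k (\<lambda>z. complex_of_real (u z))) w * (x $ j) * cnj (x $ k)) =
     u'' w (axis j (x $ j)) (axis k (x $ k)) + u'' w (axis j (\<i> * x $ j)) (axis k (\<i> * x $ k))" for j k
    unfolding bilinear_expansion[OF blu, of _ "_ $ _"] bilinear_expansion[OF blu, of _ "\<i> * _"]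
    by (simp add: wirtinger_def fw field_simps)
  have dec: "y = (\<Sum>j\<in>UNIV. axis j (y $ j))" for y :: "complex ^ 'a"
    by (simp add: vec_eq_iff axis_def if_distrib cong: if_cong)
  have sumB: "u'' w y y = (\<Sum>j\<in>UNIV. \<Sum>k\<in>UNIV. u'' w (axis j (y $ j)) (axis k (y $ k)))" for y
  proof -
    have "u'' w y y = u'' w (\<Sum>j\<in>UNIV. axis j (y $ j)) (\<Sum>k\<in>UNIV. axis k (y $ k))"
      by (simp only: dec[symmetric])
    then show ?thesis by (simp only: B.sum blinfun.sum_left blinfun.sum_right) (rule sum.swap)
  qed
  show ?thesis
    unfolding levi_form_def
    by (subst sumB[of x], subst sumB[of "\<i> *s x"])
       (simp only: Re_sum sum_distrib_left summand sum.distrib vector_smult_component)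
qed

section \<open>Taylor bounds, sub-mean values and second-derivative tests\<close>

lemma second_order_bound:
  fixes u :: "'b::real_normed_vector \<Rightarrow> real"
  assumes u: "has_hessian_on u u' u'' S" and S: "open S" "a \<in> S" and e: "e > 0"
  obtains d where "d > 0" "ball a d \<subseteq> S"
    "\<And>h. norm h < d \<Longrightarrow> u (a + h) \<le> u a + u' a h + u'' a h h / 2 + e * (norm h)\<^sup>2"
proof -
  obtain d1 where d1: "d1 > 0" "ball a d1 \<subseteq> S" using S openE by blast
  obtain d2 where d2: "d2 > 0"
    "\<And>y. norm (y - a) < d2 \<Longrightarrow> norm (u' y - u' a - u'' a (y - a)) \<le> e * norm (y - a)"
    using has_hessian_onD(2)[OF u S(2)] e unfolding has_derivative_at_alt by blast
  interpret B: bounded_linear "u'' a"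
    by (rule has_derivative_bounded_linear[OF has_hessian_onD(2)[OF u S(2)]])
  have "u (a + h) \<le> u a + u' a h + u'' a h h / 2 + e * (norm h)\<^sup>2" if h: "norm h < min d1 d2" for h
  proof -
    \<comment> \<open>The Taylor remainder along the segment. Its derivative \<open>r'\<close> is
      small because \<open>u'\<close> is differentiable at \<open>a\<close>, and the mean value
      theorem transfers this to \<open>r 1\<close>.\<close>
    define r where "r t = u (a + t *\<^sub>R h) - t * u' a h - t\<^sup>2 / 2 * u'' a h h" for t
    define r' where "r' t = (u' (a + t *\<^sub>R h) - u' a - u'' a (t *\<^sub>R h)) h" for t
    have der: "(r has_real_derivative r' t) (at t)" if t: "0 \<le> t" "t \<le> 1" for t
    proof -
      have "norm (t *\<^sub>R h) \<le> norm h" using t by (simp add: mult_left_le_one_le)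
      then have "a + t *\<^sub>R h \<in> S" using h d1 by (auto simp: dist_norm)
      from has_hessian_onD(1)[OF u this]
      have "((\<lambda>t. u (a + t *\<^sub>R h)) has_derivative (\<lambda>s. u' (a + t *\<^sub>R h) (s *\<^sub>R h))) (at t)"
        by (rule has_derivative_compose[rotated]) (auto intro!: derivative_eq_intros)
      then have 1: "((\<lambda>t. u (a + t *\<^sub>R h)) has_real_derivative u' (a + t *\<^sub>R h) h) (at t)"
        by (simp add: has_field_derivative_def blinfun.scaleR_right mult_commute_abs)
      show ?thesis
        unfolding r_def r'_def
        by (auto intro!: derivative_eq_intros 1 simp: blinfun.diff_left B.scaleR blinfun.scaleR_left)
    qed
    obtain x where x: "0 < x" "x < 1" "r 1 - r 0 = (1 - 0) * r' x"
      using MVT2[of 0 1 r r'] der by auto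
    have xh: "norm (x *\<^sub>R h) \<le> norm h" using x by (simp add: mult_left_le_one_le)
    have "\<bar>r' x\<bar> \<le> norm (u' (a + x *\<^sub>R h) - u' a - u'' a (x *\<^sub>R h)) * norm h"
      unfolding r'_def using norm_blinfun[of _ h] by (metis real_norm_def)
    also have "\<dots> \<le> (e * norm (x *\<^sub>R h)) * norm h"
      using d2(2)[of "a + x *\<^sub>R h"] xh h by (intro mult_right_mono) auto
    also have "\<dots> \<le> (e * norm h) * norm h"
      using xh e by (intro mult_right_mono mult_left_mono) auto
    finally have "r' x \<le> e * (norm h)\<^sup>2" by (simp add: power2_eq_square)
    then show ?thesis using x by (simp add: r_def)
  qed
  then show ?thesis using that[of "min d1 d2"] d1 d2 by (auto simp: subset_iff)
qed

text \<open>The linear and mixed terms integrate to zero and each square contributes \<pi>. Hence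
  the mean of a second-order Taylor polynomial over a circle is its value at the centre plus a
  quarter of the Hessian summed over the directions b and \<i> b.\<close>

lemma has_integral_trig_quadratic:
  "((\<lambda>t. c + al * cos t + be * sin t + p * (cos t)\<^sup>2 + q * (sin t * cos t) + s * (sin t)\<^sup>2)
     has_integral (2 * pi * c + pi * (p + s))) {0..2 * pi}"
proof -
  define F where "F t = c * t + al * sin t - be * cos t + p * ((t + sin t * cos t) / 2)
      + q * (sin t * sin t / 2) + s * ((t - sin t * cos t) / 2)" for t :: real
  have "((\<lambda>t. c + al * cos t + be * sin t + p * (cos t)\<^sup>2 + q * (sin t * cos t) + s * (sin t)\<^sup>2)
     has_integral (F (2 * pi) - F 0)) {0..2 * pi}"
  proof (rule fundamental_theorem_of_calculus)
    fix t :: real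
    have c2: "cos t * cos t = 1 - sin t * sin t"
      using sin_cos_squared_add[of t] by (simp add: power2_eq_square)
    have "(F has_real_derivative (c + al * cos t + be * sin t + p * (cos t)\<^sup>2 + q * (sin t * cos t) + s * (sin t)\<^sup>2))
       (at t within {0..2 * pi})"
      unfolding F_def
      using c2 by (auto intro!: derivative_eq_intros simp: power2_eq_square)
    then show "(F has_vector_derivative (c + al * cos t + be * sin t + p * (cos t)\<^sup>2 + q * (sin t * cos t) + s * (sin t)\<^sup>2))
       (at t within {0..2 * pi})"
      by (simp add: has_real_derivative_iff_has_vector_derivative)
  qed auto
  moreover have "F (2 * pi) - F 0 = 2 * pi * c + pi * (p + s)"
    by (simp add: F_def algebra_simps)
  ultimately show ?thesis by simp
qed

text \<open>A negative value in some direction x would, by the Taylor bound, push the mean over a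
  small circle in the complex line of x below the value at the centre.\<close>

lemma hessian_nonneg_of_sub_mean_value:
  fixes u :: "complex ^ 'n \<Rightarrow> real"
  assumes u: "has_hessian_on u u' u'' S" and S: "open S" "a \<in> S"
    and mean: "\<And>b. \<forall>\<zeta>\<in>cball 0 1. a + \<zeta> *s b \<in> S \<Longrightarrow>
       u a \<le> 1 / (2 * pi) * integral {0..2 * pi} (\<lambda>\<theta>. u (a + cis \<theta> *s b))"
  shows "u'' a x x + u'' a (\<i> *s x) (\<i> *s x) \<ge> 0"
proof (rule ccontr)
  interpret B: bounded_linear "u'' a"
    by (rule has_derivative_bounded_linear[OF has_hessian_onD(2)[OF u S(2)]])
  define L where "L = u'' a x x + u'' a (\<i> *s x) (\<i> *s x)"
  assume "\<not> u'' a x x + u'' a (\<i> *s x) (\<i> *s x) \<ge> 0"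
  then have L: "L < 0" by (simp add: L_def)
  then have x0: "x \<noteq> 0" by (auto simp: L_def B.zero)
  \<comment> \<open>Chosen so that the Taylor error on the circle of radius r times x is -r^2 L / 8,
    half of the gain r^2 L / 4 in absolute value; r^2 L / 8 < 0 remains.\<close>
  define e where "e = - L / (8 * (norm x)\<^sup>2)"
  have e: "e > 0" using L x0 by (simp add: e_def divide_simps)
  obtain d where d: "d > 0" "ball a d \<subseteq> S"
    "\<And>h. norm h < d \<Longrightarrow> u (a + h) \<le> u a + u' a h + u'' a h h / 2 + e * (norm h)\<^sup>2"
    using second_order_bound[OF u S e] by blast
  define r where "r = d / (2 * norm x)"
  have r: "r > 0" "r * norm x < d" using d x0 by (auto simp: r_def)
  define b where "b = r *\<^sub>R x"
  have nb: "norm b < d" using r by (simp add: b_def)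
  have inS: "a + \<zeta> *s b \<in> S" if "cmod \<zeta> \<le> 1" for \<zeta>
  proof -
    have "norm (\<zeta> *s b) \<le> norm b" using that by (simp add: norm_smult mult_left_le_one_le)
    then show ?thesis using nb d by (auto simp: dist_norm)
  qed
  define M where "M \<theta> = (u a + e * (norm b)\<^sup>2) + u' a b * cos \<theta> + u' a (\<i> *s b) * sin \<theta> + u'' a b b / 2 * (cos \<theta>)\<^sup>2
     + (u'' a b (\<i> *s b) + u'' a (\<i> *s b) b) / 2 * (sin \<theta> * cos \<theta>)
     + u'' a (\<i> *s b) (\<i> *s b) / 2 * (sin \<theta>)\<^sup>2" for \<theta>
  have le: "u (a + cis \<theta> *s b) \<le> M \<theta>" for \<theta>
  proof -
    have c: "cis \<theta> *s b = cos \<theta> *\<^sub>R b + sin \<theta> *\<^sub>R (\<i> *s b)"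
      by (simp add: vec_eq_iff complex_eq_iff algebra_simps)
    have n: "norm (cis \<theta> *s b) = norm b" by (simp add: norm_smult)
    have "u (a + cis \<theta> *s b) \<le> u a + u' a (cis \<theta> *s b) + u'' a (cis \<theta> *s b) (cis \<theta> *s b) / 2 + e * (norm b)\<^sup>2"
      using d(3)[of "cis \<theta> *s b"] n nb by simp
    also have "\<dots> = M \<theta>"
      unfolding M_def c
      by (simp add: B.add B.scaleR blinfun.add_left blinfun.add_right blinfun.scaleR_left blinfun.scaleR_right
          field_simps power2_eq_square)
    finally show ?thesis .
  qed
  have contu: "continuous_on S u"
    using has_hessian_onD(1)[OF u] by (meson continuous_at_imp_continuous_on has_derivative_continuous)
  have "continuous_on {0..2 * pi} (\<lambda>\<theta>. u (a + cis \<theta> *s b))"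
    by (intro continuous_on_compose2[OF contu] continuous_intros) (use inS in auto)
  then have int: "(\<lambda>\<theta>. u (a + cis \<theta> *s b)) integrable_on {0..2 * pi}"
    by (rule integrable_continuous_real)
  have Mint: "(M has_integral (2 * pi * (u a + e * (norm b)\<^sup>2) + pi * (u'' a b b / 2 + u'' a (\<i> *s b) (\<i> *s b) / 2))) {0..2 * pi}"
    unfolding M_def by (rule has_integral_trig_quadratic)
  have "u a \<le> 1 / (2 * pi) * integral {0..2 * pi} (\<lambda>\<theta>. u (a + cis \<theta> *s b))"
    using inS by (intro mean) auto
  also have "\<dots> \<le> 1 / (2 * pi) * (2 * pi * (u a + e * (norm b)\<^sup>2) + pi * (u'' a b b / 2 + u'' a (\<i> *s b) (\<i> *s b) / 2))"
    using has_integral_le[OF integrable_integral[OF int] Mint] le by (intro mult_left_mono) auto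
  also have "\<dots> = u a + e * (norm b)\<^sup>2 + (u'' a b b + u'' a (\<i> *s b) (\<i> *s b)) / 4"
    by (simp add: field_simps)
  also have "u'' a b b + u'' a (\<i> *s b) (\<i> *s b) = r\<^sup>2 * L"
  proof -
    have "\<i> *s b = r *\<^sub>R (\<i> *s x)" by (simp add: b_def vec_eq_iff)
    then show ?thesis
      by (simp add: b_def L_def B.scaleR blinfun.scaleR_left blinfun.scaleR_right power2_eq_square algebra_simps)
  qed
  finally have "0 \<le> e * (norm b)\<^sup>2 + r\<^sup>2 * L / 4" by simp
  also have "\<dots> = r\<^sup>2 * L / 8"
    using x0 by (simp add: e_def b_def power_mult_distrib)
  finally show False using mult_pos_neg[OF _ L, of "r\<^sup>2"] r by simp
qed

lemma second_derivative_at_local_max: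
  fixes v v' :: "real \<Rightarrow> real"
  assumes d: "d > 0" and v: "\<And>t. \<bar>t\<bar> < d \<Longrightarrow> (v has_real_derivative v' t) (at t)"
    and v': "(v' has_real_derivative c) (at 0)" and max: "\<And>t. \<bar>t\<bar> < d \<Longrightarrow> v t \<le> v 0"
  shows "c \<le> 0"
proof (rule ccontr)
  assume "\<not> c \<le> 0"
  have v0: "v' 0 = 0"
    using DERIV_local_max[of v "v' 0" 0 d] v[of 0] max d by auto
  from DERIV_pos_inc_right[OF v'] \<open>\<not> c \<le> 0\<close> obtain e where e: "e > 0"
    "\<And>h. 0 < h \<Longrightarrow> h < e \<Longrightarrow> v' 0 < v' (0 + h)" by force
  define t where "t = min d e / 2"
  have t: "0 < t" "t < d" "t < e" using d e by (auto simp: t_def)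
  obtain x where x: "0 < x" "x < t" "v t - v 0 = (t - 0) * v' x"
    using MVT2[OF t(1), of v v'] v t by fastforce
  have "v' x > 0" using e(2)[of x] x t v0 by auto
  then have "v t - v 0 > 0" using x t by simp
  then show False using max[of t] t by auto
qed

text \<open>Second-derivative test along the real line through \<open>z0\<close> in direction
  \<open>e\<close>. The term \<open>Re (q z)\<close> is there to carry logarithmic weights, which
  are locally real parts of holomorphic functions. The direction stays general so that both 1 and
  \<i> can be inserted.\<close>

lemma hessian_along_holomorphic_line:
  fixes g :: "complex \<Rightarrow> complex ^ 'n"
  assumes u: "has_hessian_on u u' u'' S" and W: "open W" and gS: "g ` W \<subseteq> S"
    and g: "\<And>z. z \<in> W \<Longrightarrow> (g has_derivative (\<lambda>c. c *s g1 z)) (at z)"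
    and g1: "(g1 has_derivative (\<lambda>c. c *s g2)) (at z0)"
    and q: "\<And>z. z \<in> W \<Longrightarrow> (q has_field_derivative q1 z) (at z)"
    and q1: "(q1 has_field_derivative q2) (at z0)"
    and z0: "z0 \<in> W"
    and max: "\<And>z. z \<in> W \<Longrightarrow> u (g z) + Re (q z) + \<epsilon> * (cmod z)\<^sup>2 \<le> u (g z0) + Re (q z0) + \<epsilon> * (cmod z0)\<^sup>2"
    and e: "cmod e = 1"
  shows "u'' (g z0) (e *s g1 z0) (e *s g1 z0) + u' (g z0) ((e * e) *s g2) + Re (e * e * q2) + 2 * \<epsilon> \<le> 0"
proof -
  obtain d where d: "d > 0" "ball z0 d \<subseteq> W" using W z0 openE by blast
  define l where "l t = z0 + of_real t * e" for t
  have lW: "l t \<in> W" if "\<bar>t\<bar> < d" for t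
    using that d e by (auto simp: l_def dist_norm norm_mult)
  have l: "(l has_derivative (\<lambda>s. of_real s * e)) (at t)" for t
    unfolding l_def by (auto intro!: derivative_eq_intros)
  define v where "v t = u (g (l t)) + Re (q (l t)) + \<epsilon> * (cmod (l t))\<^sup>2" for t
  define v' where "v' t = u' (g (l t)) (e *s g1 (l t)) + Re (e * q1 (l t)) + \<epsilon> * (2 * (l t \<bullet> e))" for t
  have gl: "((\<lambda>t. g (l t)) has_derivative (\<lambda>s. s *\<^sub>R (e *s g1 (l t)))) (at t)" if "\<bar>t\<bar> < d" for t
    using has_derivative_compose[OF l g[OF lW[OF that]]]
    by (simp add: vec_eq_iff scaleR_conv_of_real[where 'a=complex] mult_ac vector_scalar_mult_def scaleR_vec_def)
  have q': "((\<lambda>t. Re (k (l t))) has_real_derivative Re (e * k1)) (at t)"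
    if "(k has_field_derivative k1) (at (l t))" for k k1 t
    unfolding has_field_derivative_def
    using bounded_linear.has_derivative[OF bounded_linear_Re
        has_derivative_compose[OF l that[unfolded has_field_derivative_def]]]
    by (rule has_derivative_eq_rhs) (auto simp: algebra_simps)
  have nl: "((\<lambda>t. (cmod (l t))\<^sup>2) has_real_derivative 2 * (l t \<bullet> e)) (at t)" for t
    unfolding power2_norm_eq_inner has_field_derivative_def
    using has_derivative_inner[OF l[of t] l[of t]]
    by (rule has_derivative_eq_rhs) (auto simp: inner_complex_def algebra_simps)
  have dv: "(v has_real_derivative v' t) (at t)" if t: "\<bar>t\<bar> < d" for t
  proof -
    have "g (l t) \<in> S" using lW[OF t] gS by blast
    from has_derivative_compose[OF gl[OF t] has_hessian_onD(1)[OF u this]]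
    have "((\<lambda>t. u (g (l t))) has_real_derivative u' (g (l t)) (e *s g1 (l t))) (at t)"
      by (simp add: has_field_derivative_def blinfun.scaleR_right mult_commute_abs)
    then show ?thesis
      unfolding v_def v'_def by (intro DERIV_add DERIV_cmult nl q' q lW t)
  qed
  have dv': "(v' has_real_derivative (u'' (g z0) (e *s g1 z0) (e *s g1 z0) + u' (g z0) ((e * e) *s g2)
       + Re (e * e * q2) + 2 * \<epsilon>)) (at 0)"
  proof -
    have l0: "l 0 = z0" by (simp add: l_def)
    have "g z0 \<in> S" using z0 gS by blast
    then have B: "(u' has_derivative u'' (g z0)) (at (g (l 0)))" 
      using has_hessian_onD(2)[OF u] l0 by simp
    interpret B: bounded_linear "u'' (g z0)" using B has_derivative_bounded_linear by blast
    have 1: "((\<lambda>t. u' (g (l t))) has_derivative (\<lambda>s. s *\<^sub>R u'' (g z0) (e *s g1 z0))) (at 0)"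
      using has_derivative_compose[OF gl[of 0] B] d by (simp add: B.scaleR l0)
    have "((\<lambda>t. g1 (l t)) has_derivative (\<lambda>s. (of_real s * e) *s g2)) (at 0)"
      by (rule has_derivative_compose[OF l]) (simp add: l0 g1)
    from bounded_linear.has_derivative[OF bounded_linear_smult_right this]
    have 2: "((\<lambda>t. e *s g1 (l t)) has_derivative (\<lambda>s. s *\<^sub>R ((e * e) *s g2))) (at 0)"
      by (rule has_derivative_eq_rhs) (auto simp: vec_eq_iff scaleR_conv_of_real[where 'a=complex] mult_ac)
    have 3: "((\<lambda>t. u' (g (l t)) (e *s g1 (l t))) has_real_derivative
        (u'' (g z0) (e *s g1 z0) (e *s g1 z0) + u' (g z0) ((e * e) *s g2))) (at 0)"
      unfolding has_field_derivative_def
      using bounded_bilinear.FDERIV[OF bounded_bilinear_blinfun_apply 1 2]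
      by (rule has_derivative_eq_rhs)
         (auto simp: l0 blinfun.scaleR_left blinfun.scaleR_right algebra_simps)
    have 4: "((\<lambda>t. Re (e * q1 (l t))) has_real_derivative Re (e * (e * q2))) (at 0)"
      by (rule q') (auto intro!: DERIV_cmult simp: l0 q1)
    have 5: "((\<lambda>t. 2 * (l t \<bullet> e)) has_real_derivative 2) (at 0)"
      unfolding has_field_derivative_def
      using has_derivative_mult_right[OF has_derivative_inner_left[OF l[of 0], of e], of 2]
      by (rule has_derivative_eq_rhs)
         (use e in \<open>auto simp: scaleR_conv_of_real[symmetric] power2_norm_eq_inner[symmetric]\<close>)
    show ?thesis
      unfolding v'_def using DERIV_add[OF DERIV_add[OF 3 4] DERIV_cmult[OF 5, of \<epsilon>]]
      by (simp add: mult_ac)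
  qed
  have "v t \<le> v 0" if "\<bar>t\<bar> < d" for t
    using max[OF lW[OF that]] by (simp add: v_def l_def)
  then show ?thesis
    using second_derivative_at_local_max[OF d(1) dv dv'] by blast
qed

text \<open>The terms containing second derivatives of \<open>g\<close> and \<open>q\<close> cancel when the directions \<open>1\<close> and
  \<open>\<i>\<close> are added, which leaves the Levi form of \<open>u\<close> in the direction of the derivative of \<open>g\<close>.\<close>

lemma no_local_max_holomorphic_pullback:
  fixes g :: "complex \<Rightarrow> complex ^ 'n"
  assumes u: "has_hessian_on u u' u'' S" and W: "open W" "z0 \<in> W" and gS: "g ` W \<subseteq> S"
    and g: "\<And>i. (\<lambda>z. g z $ i) holomorphic_on W" and q: "q holomorphic_on W"
    and levi: "\<And>x. u'' (g z0) x x + u'' (g z0) (\<i> *s x) (\<i> *s x) \<ge> 0"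
    and \<epsilon>: "\<epsilon> > 0"
    and max: "\<And>z. z \<in> W \<Longrightarrow> u (g z) + Re (q z) + \<epsilon> * (cmod z)\<^sup>2 \<le> u (g z0) + Re (q z0) + \<epsilon> * (cmod z0)\<^sup>2"
  shows False
proof -
  define g1 where "g1 z = (\<chi> i. deriv (\<lambda>z. g z $ i) z)" for z
  define g2 where "g2 = (\<chi> i. deriv (deriv (\<lambda>z. g z $ i)) z0)"
  have dg: "(g has_derivative (\<lambda>c. c *s g1 z)) (at z)" if "z \<in> W" for z
    unfolding has_derivative_smult_iff g1_def using holomorphic_derivI[OF g W(1) that] by simp
  have dg1: "(g1 has_derivative (\<lambda>c. c *s g2)) (at z0)"
    unfolding has_derivative_smult_iff g1_def g2_def
    using holomorphic_derivI[OF holomorphic_deriv[OF g W(1)] W] by simp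
  note dq = holomorphic_derivI[OF q W(1)]
  note dq1 = holomorphic_derivI[OF holomorphic_deriv[OF q W(1)] W]
  note * = hessian_along_holomorphic_line[OF u W(1) gS dg dg1 dq dq1 W(2) max]
  have "u'' (g z0) (g1 z0) (g1 z0) + u' (g z0) g2 + Re (deriv (deriv q) z0) + 2 * \<epsilon> \<le> 0"
    using *[of 1] by simp
  moreover have "u'' (g z0) (\<i> *s g1 z0) (\<i> *s g1 z0) - u' (g z0) g2 - Re (deriv (deriv q) z0) + 2 * \<epsilon> \<le> 0"
    using *[of \<i>] by (simp add: blinfun.minus_right)
  ultimately show False using levi[of "g1 z0"] \<epsilon> by linarith
qed

subsection \<open>Lower integrals and lengths of curves\<close>

text \<open>The library's \<open>\<integral>\<^sup>+\<close> of a non-measurable function is the lower integral. The following lemmas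
  do not assume measurability, so that no semicontinuity of the Kobayashi metric is needed.\<close>

lemma nn_integral_le_simpleI:
  assumes "\<And>g. g \<in> borel_measurable M \<Longrightarrow> (\<And>x. g x \<le> f x) \<Longrightarrow> integral\<^sup>N M g \<le> c"
  shows "integral\<^sup>N M f \<le> c"
  unfolding nn_integral_def[of M f]
proof (rule SUP_least)
  fix g assume g: "g \<in> {g. simple_function M g \<and> g \<le> f}"
  then have "integral\<^sup>N M g \<le> c"
    by (intro assms) (auto simp: borel_measurable_simple_function le_fun_def)
  then show "integral\<^sup>S M g \<le> c" using g by (simp add: nn_integral_eq_simple_integral)
qed

text \<open>Lower integrals are not subadditive in general. Here a measurable minorant of
  \<open>f\<close> on the union splits along the measurable sets into minorants on the two
  parts.\<close>

lemma nn_integral_split_le: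
  assumes "A \<in> sets M" "B \<in> sets M"
  shows "(\<integral>\<^sup>+t\<in>A \<union> B. f t \<partial>M) \<le> (\<integral>\<^sup>+t\<in>A. f t \<partial>M) + (\<integral>\<^sup>+t\<in>B. f t \<partial>M)"
proof (rule nn_integral_le_simpleI)
  fix g assume g: "g \<in> borel_measurable M" and le: "\<And>x. g x \<le> f x * indicator (A \<union> B) x"
  have "g x \<le> g x * indicator A x + g x * indicator B x" for x
    using le[of x] by (cases "x \<in> A"; cases "x \<in> B") auto
  then have "integral\<^sup>N M g \<le> (\<integral>\<^sup>+t. g t * indicator A t + g t * indicator B t \<partial>M)"
    by (rule nn_integral_mono)
  also have "\<dots> = (\<integral>\<^sup>+t. g t * indicator A t \<partial>M) + (\<integral>\<^sup>+t. g t * indicator B t \<partial>M)"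
    using g assms by (intro nn_integral_add) auto
  also have "(\<integral>\<^sup>+t. g t * indicator A t \<partial>M) + (\<integral>\<^sup>+t. g t * indicator B t \<partial>M)
      \<le> (\<integral>\<^sup>+t\<in>A. f t \<partial>M) + (\<integral>\<^sup>+t\<in>B. f t \<partial>M)"
  proof -
    have "g x * indicator A x \<le> f x * indicator A x" "g x * indicator B x \<le> f x * indicator B x" for x
      using le[of x] by (auto simp: indicator_def)
    then show ?thesis by (intro add_mono nn_integral_mono)
  qed
  finally show "integral\<^sup>N M g \<le> (\<integral>\<^sup>+t\<in>A. f t \<partial>M) + (\<integral>\<^sup>+t\<in>B. f t \<partial>M)" .
qed

text \<open>A measurable minorant of the left integrand becomes, after the substitution, a
  measurable minorant of \<open>f\<close>; the change of variables is applied only to that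
  minorant.\<close>

lemma nn_integral_affine_le:
  fixes m c :: real
  assumes m: "m \<noteq> 0"
  shows "(\<integral>\<^sup>+t. ennreal \<bar>m\<bar> * f (c + m * t) \<partial>lborel) \<le> (\<integral>\<^sup>+t. f t \<partial>lborel)"
proof (rule nn_integral_le_simpleI)
  fix g :: "real \<Rightarrow> ennreal" assume g[measurable]: "g \<in> borel_measurable lborel"
    and le: "\<And>x. g x \<le> ennreal \<bar>m\<bar> * f (c + m * x)"
  have "integral\<^sup>N lborel g = (\<integral>\<^sup>+x. ennreal \<bar>m\<bar> * (ennreal (1 / \<bar>m\<bar>) * g x) \<partial>lborel)"
    using m by (simp add: mult.assoc[symmetric] ennreal_mult[symmetric])
  also have "\<dots> = ennreal \<bar>m\<bar> * (\<integral>\<^sup>+x. ennreal (1 / \<bar>m\<bar>) * g x \<partial>lborel)"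
    by (rule nn_integral_cmult) measurable
  also have "\<dots> = ennreal \<bar>m\<bar> * (\<integral>\<^sup>+x. ennreal (1 / \<bar>m\<bar>) * g ((c + m * x - c) / m) \<partial>lborel)"
    using m by simp
  also have "\<dots> = (\<integral>\<^sup>+x. ennreal (1 / \<bar>m\<bar>) * g ((x - c) / m) \<partial>lborel)"
    using m by (subst (2) nn_integral_real_affine[where c=m and t=c]) auto
  also have "\<dots> \<le> (\<integral>\<^sup>+t. f t \<partial>lborel)"
  proof (rule nn_integral_mono)
    fix x :: real
    have "ennreal (1 / \<bar>m\<bar>) * g ((x - c) / m) \<le> ennreal (1 / \<bar>m\<bar>) * (ennreal \<bar>m\<bar> * f (c + m * ((x - c) / m)))"
      by (intro mult_left_mono le) auto
    also have "\<dots> = f x"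
      using m by (simp add: mult.assoc[symmetric] ennreal_mult[symmetric])
    finally show "ennreal (1 / \<bar>m\<bar>) * g ((x - c) / m) \<le> f x" .
  qed
  finally show "integral\<^sup>N lborel g \<le> (\<integral>\<^sup>+t. f t \<partial>lborel)" .
qed

lemma nn_integral_cmult_le:
  fixes f :: "'b \<Rightarrow> ennreal"
  assumes c: "0 < c"
  shows "(\<integral>\<^sup>+t. ennreal c * f t \<partial>M) \<le> ennreal c * (\<integral>\<^sup>+t. f t \<partial>M)"
proof (rule nn_integral_le_simpleI)
  fix g :: "'b \<Rightarrow> ennreal" assume g [measurable]: "g \<in> borel_measurable M" and le: "\<And>x. g x \<le> ennreal c * f x"
  have "ennreal (1 / c) * g x \<le> f x" for x
  proof -
    have "ennreal (1 / c) * g x \<le> ennreal (1 / c) * (ennreal c * f x)" by (intro mult_left_mono le) simp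
    then show ?thesis using c by (simp add: mult.assoc[symmetric] ennreal_mult[symmetric])
  qed
  then have "(\<integral>\<^sup>+t. ennreal (1 / c) * g t \<partial>M) \<le> (\<integral>\<^sup>+t. f t \<partial>M)" by (intro nn_integral_mono)
  then have "ennreal c * (ennreal (1 / c) * (\<integral>\<^sup>+t. g t \<partial>M)) \<le> ennreal c * (\<integral>\<^sup>+t. f t \<partial>M)"
    by (intro mult_left_mono) (auto simp: nn_integral_cmult)
  then show "integral\<^sup>N M g \<le> ennreal c * (\<integral>\<^sup>+t. f t \<partial>M)"
    using c by (simp add: mult.assoc[symmetric] ennreal_mult[symmetric])
qed

text \<open>The derivative is neither continuous nor integrable by assumption. It is measurable as a
  limit of difference quotients. If the right side is infinite the claim is trivial; otherwise the
  Lebesgue integral of the derivative coincides with the gauge integral given by the fundamental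
  theorem of calculus.\<close>

lemma norm_diff_le_nn_integral_deriv:
  fixes \<gamma> :: "real \<Rightarrow> 'b::euclidean_space"
  assumes ab: "a \<le> b" and F: "finite F" and cont: "continuous_on {a..b} \<gamma>"
    and der: "\<And>t. a < t \<Longrightarrow> t < b \<Longrightarrow> t \<notin> F \<Longrightarrow> (\<gamma> has_vector_derivative \<gamma>' t) (at t)"
  shows "ennreal (norm (\<gamma> b - \<gamma> a)) \<le> (\<integral>\<^sup>+t\<in>{a<..<b} - F. ennreal (norm (\<gamma>' t)) \<partial>lborel)"
proof -
  define V where "V = {a<..<b} - F"
  define h where "h t = indicator V t *\<^sub>R \<gamma>' t" for t
  \<comment> \<open>Clamping the argument to [a, b] makes the difference quotients continuous on the
    whole line without changing \<open>\<gamma>\<close> near interior points.\<close>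
  define c where "c t = \<gamma> (max a (min b t))" for t
  have contc: "continuous_on UNIV c"
    unfolding c_def by (intro continuous_on_compose2[OF cont] continuous_intros) (use ab in auto)
  have V: "open V" unfolding V_def using F by (intro open_Diff finite_imp_closed) auto
  have lims: "(\<lambda>n. indicator V t *\<^sub>R (real (Suc n) *\<^sub>R (c (t + 1 / real (Suc n)) - c t))) \<longlonglongrightarrow> h t" for t
  proof (cases "t \<in> V")
    case True
    then have t: "a < t" "t < b" "t \<notin> F" by (auto simp: V_def)
    have "(\<gamma> has_vector_derivative \<gamma>' t) (at t)" using der t by blast
    then have "(c has_vector_derivative \<gamma>' t) (at t)"
      by (rule has_vector_derivative_transform_within_open[where S="{a<..<b}"])
         (use t in \<open>auto simp: c_def min_def max_def\<close>)
    then have lim: "((\<lambda>h. norm (c (t + h) - c t - h *\<^sub>R \<gamma>' t) / norm h) \<longlongrightarrow> 0) (at 0)"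
      by (simp add: has_vector_derivative_def has_derivative_at)
    have "norm (c (t + h) - c t - h *\<^sub>R \<gamma>' t) / norm h = norm ((c (t + h) - c t) /\<^sub>R h - \<gamma>' t)"
      if "h \<noteq> 0" for h
    proof -
      have "(c (t + h) - c t) /\<^sub>R h - \<gamma>' t = (c (t + h) - c t - h *\<^sub>R \<gamma>' t) /\<^sub>R h"
        using that by (simp add: scaleR_diff_right)
      then show ?thesis by (simp add: divide_inverse mult.commute)
    qed
    then have "((\<lambda>h. norm ((c (t + h) - c t) /\<^sub>R h - \<gamma>' t)) \<longlongrightarrow> 0) (at 0)"
      by (intro Lim_transform_eventually[OF lim]) (auto simp: eventually_at_filter)
    then have "((\<lambda>h. (c (t + h) - c t) /\<^sub>R h) \<longlongrightarrow> \<gamma>' t) (at 0)"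
      by (rule LIM_zero_cancel[OF tendsto_norm_zero_cancel])
    moreover have "filterlim (\<lambda>n. 1 / real (Suc n)) (at 0) sequentially"
      unfolding filterlim_at
      using LIMSEQ_inverse_real_of_nat by (auto simp: inverse_eq_divide)
    ultimately have "(\<lambda>n. (c (t + 1 / real (Suc n)) - c t) /\<^sub>R (1 / real (Suc n))) \<longlonglongrightarrow> \<gamma>' t"
      by (rule filterlim_compose)
    then show ?thesis using True by (simp add: h_def)
  qed (simp add: h_def)
  have "(\<lambda>t. indicator V t *\<^sub>R (real (Suc n) *\<^sub>R (c (t + 1 / real (Suc n)) - c t))) \<in> borel_measurable lborel" for n
  proof -
    have "continuous_on UNIV (\<lambda>t. real (Suc n) *\<^sub>R (c (t + 1 / real (Suc n)) - c t))"
      by (intro continuous_intros continuous_on_compose2[OF contc]) auto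
    then have "(\<lambda>t. real (Suc n) *\<^sub>R (c (t + 1 / real (Suc n)) - c t)) \<in> borel_measurable borel"
      by (rule borel_measurable_continuous_onI)
    moreover have "indicat_real V \<in> borel_measurable borel" using V by simp
    ultimately show ?thesis
      unfolding measurable_lborel2 by (rule borel_measurable_scaleR[rotated])
  qed
  then have meas: "h \<in> borel_measurable lborel"
    by (rule borel_measurable_LIMSEQ_metric) (rule lims)
  have nh: "ennreal (norm (h t)) = ennreal (norm (\<gamma>' t)) * indicator V t" for t
    by (simp add: h_def indicator_def)
  show ?thesis
  proof (cases "(\<integral>\<^sup>+t. ennreal (norm (h t)) \<partial>lborel) < \<infinity>")
    case True
    then have int: "integrable lborel h" using meas by (intro integrableI_bounded) auto
    have "((\<lambda>t. \<gamma>' t) has_integral (\<gamma> b - \<gamma> a)) {a..b}"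
      by (rule fundamental_theorem_of_calculus_interior_strong[OF F ab])
         (use der cont in auto)
    then have "(h has_integral (\<gamma> b - \<gamma> a)) {a..b}"
      by (rule has_integral_spike_finite[rotated 2, where S="F \<union> {a, b}"])
         (use F in \<open>auto simp: h_def V_def\<close>)
    then have "(h has_integral (\<gamma> b - \<gamma> a)) UNIV"
      by (rule has_integral_on_superset) (auto simp: h_def V_def)
    moreover have "(h has_integral integral\<^sup>L lborel h) UNIV"
      using int by (rule has_integral_integral_lborel)
    ultimately have "\<gamma> b - \<gamma> a = integral\<^sup>L lborel h" using has_integral_unique by blast
    then have "norm (\<gamma> b - \<gamma> a) \<le> (\<integral>t. norm (h t) \<partial>lborel)"
      using integral_norm_bound[of lborel h] by simp
    then have "ennreal (norm (\<gamma> b - \<gamma> a)) \<le> ennreal (\<integral>t. norm (h t) \<partial>lborel)"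
      by (rule ennreal_leI)
    also have "\<dots> = (\<integral>\<^sup>+t. ennreal (norm (h t)) \<partial>lborel)"
      using int by (intro nn_integral_eq_integral[symmetric]) auto
    finally show ?thesis by (simp add: nh V_def)
  next
    case False
    then show ?thesis by (simp add: nh V_def not_less top_unique)
  qed
qed

subsection \<open>Charts and embedded balls\<close>

text \<open>Invariance of domain makes the image open and the inverse continuous. At each point the
  injective derivative is invertible because the dimensions agree, and the inverse of a complex
  linear map is complex linear.\<close>

lemma holomorphic_vec_inv_into:
  fixes h :: "complex ^ 'n \<Rightarrow> complex ^ 'n"
  assumes h: "holomorphic_vec S h" and S: "open S" and inj: "inj_on h S"
    and injD: "\<And>z. z \<in> S \<Longrightarrow> inj (frechet_derivative h (at z))"
  shows "open (h ` S)" "holomorphic_vec (h ` S) (inv_into S h)"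
proof -
  have cont: "continuous_on S h"
    using h unfolding holomorphic_vec_def
    by (meson continuous_at_imp_continuous_on has_derivative_continuous)
  show op: "open (h ` S)" by (rule invariance_of_domain[OF cont S inj])
  have cinv: "continuous_on (h ` S) (inv_into S h)"
    by (rule continuous_on_inverse_open[OF S cont]) (use inj in auto)
  show "holomorphic_vec (h ` S) (inv_into S h)"
    unfolding holomorphic_vec_def
  proof safe
    fix z assume z: "z \<in> S"
    obtain D where D: "(h has_derivative D) (at z)" "Vector_Spaces.linear (*s) (*s) D"
      using h[unfolded holomorphic_vec_def, rule_format, OF z] by blast
    have "frechet_derivative h (at z) = D" using frechet_derivative_at[OF D(1)] by (rule sym)
    then have iD: "inj D" using injD[OF z] by simp
    have lD: "linear D" using D(1) has_derivative_linear by blast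
    obtain L where L: "linear L" "\<And>x. L (D x) = x" "\<And>x. D (L x) = x"
      using linear_injective_isomorphism[OF lD iD] by blast
    have "D (L (c *s y)) = D (c *s L y)" for c y
      by (simp add: L linear_smultD[OF D(2)])
    then have "L (c *s y) = c *s L y" for c y using iD by (simp add: inj_eq)
    then have "Vector_Spaces.linear (*s) (*s) L"
      unfolding Vector_Spaces.linear_iff using D(2) L(1)
      by (auto simp: Vector_Spaces.linear_iff linear_add)
    moreover have "(inv_into S h has_derivative L) (at (h z))"
    proof (rule has_derivative_inverse_basic)
      show "(h has_derivative D) (at (inv_into S h (h z)))" using D z inj by simp
      show "bounded_linear L" using L by (simp add: linear_conv_bounded_linear)
      show "L \<circ> D = id" using L by auto
      show "isCont (inv_into S h) (h z)"
        using cinv op z by (simp add: continuous_on_eq_continuous_at)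
      show "h (inv_into S h y) = y" if "y \<in> h ` S" for y
        using that by (rule f_inv_into_f)
    qed (use op z in auto)
    ultimately show "\<exists>D. (inv_into S h has_derivative D) (at (h z)) \<and> Vector_Spaces.linear (*s) (*s) D"
      by blast
  qed
qed

lemma holomorphic_vec_cong:
  assumes "holomorphic_vec S f" "open S" "\<And>z. z \<in> S \<Longrightarrow> f z = g z"
  shows "holomorphic_vec S g"
  using assms unfolding holomorphic_vec_def
  by (metis has_derivative_transform_within_open)

lemma homeomorphic_map_inv_into:
  assumes "homeomorphic_map Y Z f"
  shows "homeomorphic_maps Y Z f (inv_into (topspace Y) f)"
proof -
  obtain g where g: "homeomorphic_maps Y Z f g"
    using assms by (auto simp: homeomorphic_map_maps)
  have inj: "inj_on f (topspace Y)" using assms by (simp add: homeomorphic_eq_everything_map)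
  have "g z = inv_into (topspace Y) f z" if "z \<in> topspace Z" for z
  proof -
    have "g z \<in> topspace Y" "f (g z) = z"
      using g that by (auto simp: homeomorphic_maps_def continuous_map_def)
    then show ?thesis using inj by (metis inv_into_f_f)
  qed
  then show ?thesis using homeomorphic_maps_eq[OF g] by simp
qed

locale cmanifold =
  fixes X :: "'a topology" and A :: "('a, 'n::finite) chart set"
  assumes complex_manifold: "complex_manifold X A"
begin

lemma Hausdorff: "Hausdorff_space X"
  using complex_manifold by (simp add: complex_manifold_def)

lemma chart_at:
  assumes "p \<in> topspace X"
  obtains U \<kappa> where "(U, \<kappa>) \<in> A" "p \<in> U"
  using assms complex_manifold unfolding complex_manifold_def by blast

lemma chart:
  assumes "(U, \<kappa>) \<in> A"
  shows "openin X U" "open (\<kappa> ` U)" "homeomorphic_map (subtopology X U) (top_of_set (\<kappa> ` U)) \<kappa>"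
  using assms complex_manifold unfolding complex_manifold_def by auto

lemma chart_topspace:
  assumes "(U, \<kappa>) \<in> A"
  shows "topspace (subtopology X U) = U" "U \<subseteq> topspace X"
  using openin_subset[OF chart(1)[OF assms]] by auto

lemma chart_maps:
  assumes "(U, \<kappa>) \<in> A"
  shows "homeomorphic_maps (subtopology X U) (top_of_set (\<kappa> ` U)) \<kappa> (inv_into U \<kappa>)"
  using homeomorphic_map_inv_into[OF chart(3)[OF assms]] by (simp only: chart_topspace(1)[OF assms])

lemma chart_inv:
  assumes "(U, \<kappa>) \<in> A" "p \<in> U"
  shows "inv_into U \<kappa> (\<kappa> p) = p"
proof -
  have "inj_on \<kappa> U"
    using chart(3)[OF assms(1)] chart_topspace(1)[OF assms(1)] by (simp add: homeomorphic_eq_everything_map)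
  then show ?thesis using assms by simp
qed

lemma chart_inv_continuous:
  assumes "(U, \<kappa>) \<in> A"
  shows "continuous_map (top_of_set (\<kappa> ` U)) X (inv_into U \<kappa>)"
  using chart_maps[OF assms] unfolding homeomorphic_maps_def continuous_map_in_subtopology by blast

lemma chart_open_image:
  assumes "(U, \<kappa>) \<in> A" "openin X V"
  shows "open (\<kappa> ` (U \<inter> V))"
proof -
  have "open_map (subtopology X U) (top_of_set (\<kappa> ` U)) \<kappa>"
    using chart(3)[OF assms(1)] homeomorphic_imp_open_map by blast
  moreover have "openin (subtopology X U) (U \<inter> V)"
    using assms(2) by (metis inf_commute openin_subtopology)
  ultimately have "openin (top_of_set (\<kappa> ` U)) (\<kappa> ` (U \<inter> V))"
    by (simp add: open_map_def)
  then show ?thesis using chart(2)[OF assms(1)] openin_open_trans by blast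
qed

lemma transition:
  assumes "(U, \<kappa>) \<in> A" "(V, \<mu>) \<in> A"
  shows "holomorphic_vec (\<kappa> ` (U \<inter> V)) (\<mu> \<circ> inv_into U \<kappa>)"
  using assms complex_manifold unfolding complex_manifold_def by fast

lemma chart_comp_continuous:
  assumes "(U, \<kappa>) \<in> A" "continuous_map (top_of_set S) X c"
  shows "continuous_on {t \<in> S. c t \<in> U} (\<kappa> \<circ> c)"
proof -
  have "continuous_map (top_of_set {t \<in> S. c t \<in> U}) X c"
    using assms(2) by (rule continuous_map_from_subtopology_mono) auto
  then have "continuous_map (top_of_set {t \<in> S. c t \<in> U}) (subtopology X U) c"
    by (auto simp: continuous_map_in_subtopology)
  moreover have "continuous_map (subtopology X U) (top_of_set (\<kappa> ` U)) \<kappa>"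
    using chart(3)[OF assms(1)] homeomorphic_imp_continuous_map by blast
  ultimately have "continuous_map (top_of_set {t \<in> S. c t \<in> U}) (top_of_set (\<kappa> ` U)) (\<kappa> \<circ> c)"
    by (rule continuous_map_compose)
  then show ?thesis by (simp add: continuous_map_in_subtopology)
qed

end

lemma continuous_map_open_preimage:
  assumes "continuous_map (top_of_set S) X c" "openin X V" "open S"
  shows "open {t \<in> S. c t \<in> V}"
  using openin_continuous_map_preimage[OF assms(1,2)] assms(3) openin_open_trans by fastforce

locale embedded_ball = cmanifold X A
  for X :: "'a topology" and A :: "('a, 'n::finite) chart set" +
  fixes \<Phi> :: "complex ^ 'n \<Rightarrow> 'a"
  assumes embedding: "holomorphic_embedding (ball 0 1) X A \<Phi>"
begin

definition B where "B = \<Phi> ` ball 0 1"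

definition P where "P = inv_into (ball 0 1) \<Phi>"

lemma \<Phi>_continuous: "continuous_map (top_of_set (ball 0 1)) X \<Phi>"
  using embedding by (simp add: holomorphic_embedding_def holomorphic_to_def)

lemma \<Phi>_holomorphic:
  assumes "(U, \<kappa>) \<in> A"
  shows "holomorphic_vec {z \<in> ball 0 1. \<Phi> z \<in> U} (\<kappa> \<circ> \<Phi>)"
  using embedding assms unfolding holomorphic_embedding_def holomorphic_to_def by fast

lemma \<Phi>_immersion:
  assumes "(U, \<kappa>) \<in> A" "z \<in> ball 0 1" "\<Phi> z \<in> U"
  shows "inj (frechet_derivative (\<kappa> \<circ> \<Phi>) (at z))"
  using embedding assms unfolding holomorphic_embedding_def by fast

lemma \<Phi>_homeomorphic: "homeomorphic_map (top_of_set (ball 0 1)) (subtopology X B) \<Phi>"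
  using embedding unfolding holomorphic_embedding_def embedding_map_def by (simp add: B_def)

lemma \<Phi>_P_maps: "homeomorphic_maps (top_of_set (ball 0 1)) (subtopology X B) \<Phi> P"
  using homeomorphic_map_inv_into[OF \<Phi>_homeomorphic] by (simp add: P_def)

lemma inj_\<Phi>: "inj_on \<Phi> (ball 0 1)"
  using \<Phi>_homeomorphic by (simp add: homeomorphic_eq_everything_map)

lemma P_\<Phi> [simp]: "z \<in> ball 0 1 \<Longrightarrow> P (\<Phi> z) = z"
  unfolding P_def using inj_\<Phi> by simp

lemma \<Phi>_P: "q \<in> B \<Longrightarrow> \<Phi> (P q) = q" "q \<in> B \<Longrightarrow> P q \<in> ball 0 1"
  unfolding P_def B_def by (rule f_inv_into_f, simp) (rule inv_into_into)

lemma \<Phi>_in_topspace: "z \<in> ball 0 1 \<Longrightarrow> \<Phi> z \<in> topspace X"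
  using \<Phi>_continuous by (auto simp: continuous_map_def)

lemma open_\<Phi>_preimage:
  assumes "openin X V"
  shows "open {z \<in> ball 0 1. \<Phi> z \<in> V}"
  by (rule continuous_map_open_preimage[OF \<Phi>_continuous assms]) simp

text \<open>An embedding is only a homeomorphism onto its image. Openness of that image comes from
  equality of dimensions, by invariance of domain in a chart.\<close>

lemma openin_\<Phi>_image:
  assumes V: "open V" "V \<subseteq> ball 0 1"
  shows "openin X (\<Phi> ` V)"
proof (subst openin_subopen, safe)
  fix z assume z: "z \<in> V"
  obtain U \<kappa> where U: "(U, \<kappa>) \<in> A" "\<Phi> z \<in> U"
    using chart_at \<Phi>_in_topspace V z by blast
  define W where "W = {z \<in> ball 0 1. \<Phi> z \<in> U} \<inter> V"
  have oW: "open W" unfolding W_def using V chart(1)[OF U(1)] by (intro open_Int open_\<Phi>_preimage)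
  have injU: "inj_on \<kappa> U" by (metis U(1) chart_inv inj_on_inverseI)
  have "inj_on (\<kappa> \<circ> \<Phi>) W"
    using injU inj_\<Phi> by (auto simp: W_def inj_on_def)
  moreover have "continuous_on W (\<kappa> \<circ> \<Phi>)"
    by (rule continuous_on_subset[OF chart_comp_continuous[OF U(1) \<Phi>_continuous]]) (auto simp: W_def)
  ultimately have "open ((\<kappa> \<circ> \<Phi>) ` W)" using oW invariance_of_domain by blast
  moreover have "(\<kappa> \<circ> \<Phi>) ` W \<subseteq> \<kappa> ` U" by (auto simp: W_def)
  moreover have "open_map (top_of_set (\<kappa> ` U)) (subtopology X U) (inv_into U \<kappa>)"
    using chart_maps[OF U(1)] by (meson homeomorphic_imp_open_map homeomorphic_maps_map homeomorphic_maps_sym)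
  ultimately have "openin (subtopology X U) (inv_into U \<kappa> ` ((\<kappa> \<circ> \<Phi>) ` W))"
    unfolding open_map_def by (metis open_openin openin_open_eq openin_subtopology_self chart(2)[OF U(1)] openin_open_subtopology)
  moreover have "inv_into U \<kappa> ` ((\<kappa> \<circ> \<Phi>) ` W) = \<Phi> ` W"
    using chart_inv[OF U(1)] by (force simp: W_def)
  ultimately have "openin X (\<Phi> ` W)" using chart(1)[OF U(1)] openin_trans_full by metis
  then show "\<exists>T. openin X T \<and> \<Phi> z \<in> T \<and> T \<subseteq> \<Phi> ` V"
    using z U V by (intro exI[of _ "\<Phi> ` W"]) (auto simp: W_def)
qed

lemma openin_B: "openin X B"
  unfolding B_def by (rule openin_\<Phi>_image) auto

text \<open>Compact sets are closed because the manifold is Hausdorff. Hence the complement of a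
  small closed ball is open, which makes it possible to extend functions from the ball by a
  constant, and curves can leave the ball only across its spheres.\<close>

lemma closedin_\<Phi>_cball:
  assumes "cball w r \<subseteq> ball 0 1"
  shows "closedin X (\<Phi> ` cball w r)"
proof (rule compactin_imp_closedin[OF Hausdorff])
  show "compactin X (\<Phi> ` cball w r)"
    using assms by (intro image_compactin[OF _ \<Phi>_continuous]) (auto simp: compactin_subtopology)
qed

lemma P_comp_continuous:
  assumes "continuous_map (top_of_set S) X c" "c ` S \<subseteq> B"
  shows "continuous_on S (P \<circ> c)"
proof -
  have "continuous_map (top_of_set S) (subtopology X B) c"
    using assms by (auto simp: continuous_map_in_subtopology)
  moreover have "continuous_map (subtopology X B) (top_of_set (ball 0 1)) P"
    using \<Phi>_P_maps by (simp add: homeomorphic_maps_def)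
  ultimately have "continuous_map (top_of_set S) (top_of_set (ball 0 1)) (P \<circ> c)"
    by (rule continuous_map_compose)
  then show ?thesis by (simp add: continuous_map_in_subtopology)
qed

lemma P_holomorphic:
  assumes U: "(U, \<kappa>) \<in> A"
  shows "holomorphic_vec (\<kappa> ` (U \<inter> B)) (P \<circ> inv_into U \<kappa>)"
proof -
  define W where "W = {z \<in> ball 0 1. \<Phi> z \<in> U}"
  have oW: "open W" unfolding W_def by (rule open_\<Phi>_preimage[OF chart(1)[OF U]])
  have injU: "inj_on \<kappa> U" by (metis U chart_inv inj_on_inverseI)
  have inj: "inj_on (\<kappa> \<circ> \<Phi>) W"
    using injU inj_\<Phi> by (auto simp: W_def inj_on_def)
  have hol: "holomorphic_vec ((\<kappa> \<circ> \<Phi>) ` W) (inv_into W (\<kappa> \<circ> \<Phi>))" "open ((\<kappa> \<circ> \<Phi>) ` W)"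
    using holomorphic_vec_inv_into[OF \<Phi>_holomorphic[OF U, folded W_def] oW inj] \<Phi>_immersion[OF U]
    by (auto simp: W_def)
  have im: "(\<kappa> \<circ> \<Phi>) ` W = \<kappa> ` (U \<inter> B)" by (auto simp: W_def B_def)
  have "inv_into W (\<kappa> \<circ> \<Phi>) y = (P \<circ> inv_into U \<kappa>) y" if "y \<in> (\<kappa> \<circ> \<Phi>) ` W" for y
  proof -
    obtain z where z: "z \<in> W" "y = \<kappa> (\<Phi> z)" using \<open>y \<in> (\<kappa> \<circ> \<Phi>) ` W\<close> by auto
    then show ?thesis using inv_into_f_f[OF inj z(1)] chart_inv[OF U] by (auto simp: W_def)
  qed
  with hol show ?thesis unfolding im[symmetric] using holomorphic_vec_cong by blast
qed

text \<open>The domain of \<open>c\<close> is left general: it is the complex disc for holomorphic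
  discs and a real interval for curves.\<close>

lemma P_comp_derivative:
  assumes U: "(U, \<kappa>) \<in> A" and N: "open N" "t \<in> N" and c: "continuous_map (top_of_set N) X c"
    and ct: "c t \<in> U" "c t \<in> B"
    and L: "((P \<circ> inv_into U \<kappa>) has_derivative L) (at (\<kappa> (c t)))"
    and E: "((\<kappa> \<circ> c) has_derivative E) (at t)"
  shows "((P \<circ> c) has_derivative (L \<circ> E)) (at t)"
proof -
  have "((P \<circ> inv_into U \<kappa> \<circ> (\<kappa> \<circ> c)) has_derivative (L \<circ> E)) (at t)"
    using diff_chain_at[OF E] L by simp
  moreover have "open {t \<in> N. c t \<in> U}"
    by (rule continuous_map_open_preimage[OF c chart(1)[OF U] N(1)])
  ultimately show ?thesis
    by (rule has_derivative_transform_within_open) (use N ct chart_inv[OF U] in auto)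
qed

end

subsection \<open>Holomorphic discs through an embedded ball\<close>

lemma cmod_sum_cnj_le:
  fixes x y :: "complex ^ 'n"
  shows "cmod (\<Sum>i\<in>UNIV. x $ i * cnj (y $ i)) \<le> norm x * norm y"
proof -
  have "cmod (\<Sum>i\<in>UNIV. x $ i * cnj (y $ i)) \<le> (\<Sum>i\<in>UNIV. \<bar>cmod (x $ i)\<bar> * \<bar>cmod (y $ i)\<bar>)"
    by (rule order_trans[OF norm_sum]) (simp add: norm_mult)
  also have "\<dots> \<le> norm x * norm y"
    unfolding norm_vec_def by (rule L2_set_mult_ineq)
  finally show ?thesis .
qed

lemma norm_vec_square_sum: "(norm (x :: complex ^ 'n))\<^sup>2 = (\<Sum>i\<in>UNIV. (cmod (x $ i))\<^sup>2)"
  by (simp add: norm_vec_def L2_set_def sum_nonneg)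

lemma has_hessian_on_cong_open:
  assumes "has_hessian_on u u' u'' S" "open S" "\<And>x. x \<in> S \<Longrightarrow> u x = v x"
  shows "has_hessian_on v u' u'' S"
  using assms unfolding has_hessian_on_def by (metis has_derivative_transform_within_open)

text \<open>Used with b = 16 near the centre of Sibony's function, where the squared norm has to be
  absorbed, and with b = 0 on the plateau.\<close>

lemma has_hessian_on_diff_norm:
  fixes u :: "'b::real_inner \<Rightarrow> real"
  assumes "has_hessian_on u u' u'' S"
  shows "has_hessian_on (\<lambda>x. a * u x - b * (norm (x - w))\<^sup>2)
    (\<lambda>x. a *\<^sub>R u' x - (2 * b) *\<^sub>R blinfun_inner_right (x - w))
    (\<lambda>x h. a *\<^sub>R u'' x h - (2 * b) *\<^sub>R blinfun_inner_right h) S"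
  unfolding has_hessian_on_def
proof (intro ballI conjI)
  fix x assume x: "x \<in> S"
  have 1: "((\<lambda>x. x - w) has_derivative (\<lambda>h. h)) (at x)"
    by (auto intro!: derivative_eq_intros)
  have "((\<lambda>x. (norm (x - w))\<^sup>2) has_derivative (\<lambda>h. 2 * ((x - w) \<bullet> h))) (at x)"
    unfolding power2_norm_eq_inner using has_derivative_inner[OF 1 1]
    by (rule has_derivative_eq_rhs) (auto simp: inner_commute)
  from has_derivative_diff[OF has_derivative_mult_right[OF has_hessian_onD(1)[OF assms x], of a]
        has_derivative_mult_right[OF this, of b]]
  show "((\<lambda>x. a * u x - b * (norm (x - w))\<^sup>2) has_derivative
      blinfun_apply (a *\<^sub>R u' x - (2 * b) *\<^sub>R blinfun_inner_right (x - w))) (at x)"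
    by (rule has_derivative_eq_rhs) (auto simp: blinfun.diff_left blinfun.scaleR_left)
  have "((\<lambda>x. blinfun_inner_right (x - w)) has_derivative (\<lambda>h. blinfun_inner_right h)) (at x)"
    by (rule bounded_linear.has_derivative[OF bounded_linear_blinfun_inner_right 1])
  then show "((\<lambda>x. a *\<^sub>R u' x - (2 * b) *\<^sub>R blinfun_inner_right (x - w)) has_derivative
      (\<lambda>h. a *\<^sub>R u'' x h - (2 * b) *\<^sub>R blinfun_inner_right h)) (at x)"
    by (intro has_derivative_diff has_derivative_scaleR_right has_hessian_onD(2)[OF assms x])
qed

text \<open>Taking logarithms turns the weighted product into
  \<open>u (g z) + Re (q z) + \<epsilon> * (cmod z)\<^sup>2\<close>: both |l|^2 and |z|^(-\<beta>)
  have logarithms that are locally real parts of holomorphic functions.\<close>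

lemma no_max_weighted:
  fixes g :: "complex \<Rightarrow> complex ^ 'n"
  assumes u: "has_hessian_on u u' u'' S" and W: "open W" "z0 \<in> W" and gS: "g ` W \<subseteq> S"
    and g: "\<And>i. (\<lambda>z. g z $ i) holomorphic_on W" and l: "l holomorphic_on W"
    and levi: "\<And>x. u'' (g z0) x x + u'' (g z0) (\<i> *s x) (\<i> *s x) \<ge> 0"
    and \<epsilon>: "\<epsilon> > 0" and z0: "z0 \<noteq> 0" "l z0 \<noteq> 0"
    and max: "\<And>z. z \<in> W \<Longrightarrow> z \<noteq> 0 \<Longrightarrow> (cmod (l z))\<^sup>2 * exp (u (g z) + \<epsilon> * (cmod z)\<^sup>2 - \<beta> * ln (cmod z))
       \<le> (cmod (l z0))\<^sup>2 * exp (u (g z0) + \<epsilon> * (cmod z0)\<^sup>2 - \<beta> * ln (cmod z0))"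
  shows False
proof -
  define q where "q z = 2 * Ln (l z / l z0) - of_real \<beta> * Ln (z / z0)" for z
  \<comment> \<open>On \<open>V\<close> both quotients have positive real part, so the principal
    logarithms in \<open>q\<close> are holomorphic there. Dividing by the values at
    \<open>z0\<close> puts both quotients at 1 in \<open>z0\<close>.\<close>
  define V where "V = {z \<in> W. 0 < Re (l z / l z0)} \<inter> {z. 0 < Re (z / z0)}"
  have "continuous_on W l" by (rule holomorphic_on_imp_continuous_on[OF l])
  then have "open (W \<inter> (\<lambda>z. l z / l z0) -` {z. 0 < Re z})"
    using z0 W(1) by (intro continuous_open_preimage continuous_intros open_halfspace_Re_gt) auto
  moreover have "W \<inter> (\<lambda>z. l z / l z0) -` {z. 0 < Re z} = {z \<in> W. 0 < Re (l z / l z0)}" by auto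
  moreover have "open ((\<lambda>z. z / z0) -` {z. 0 < Re z})"
    using z0 by (intro open_vimage continuous_intros open_halfspace_Re_gt) auto
  moreover have "(\<lambda>z. z / z0) -` {z. 0 < Re z} = {z. 0 < Re (z / z0)}" by auto
  ultimately have V: "open V" "V \<subseteq> W" "z0 \<in> V" using W z0 unfolding V_def by auto
  have nr: "z \<notin> \<real>\<^sub>\<le>\<^sub>0" if "0 < Re z" for z using that by (auto simp: complex_nonpos_Reals_iff)
  have nz: "l z \<noteq> 0" "z \<noteq> 0" if "z \<in> V" for z using that by (auto simp: V_def)
  have qV: "q holomorphic_on V"
    unfolding q_def
    by (intro holomorphic_intros holomorphic_on_subset[OF l V(2)]) (use z0 nr in \<open>auto simp: V_def\<close>)
  have Req: "Re (q z) = 2 * (ln (cmod (l z)) - ln (cmod (l z0))) - \<beta> * (ln (cmod z) - ln (cmod z0))"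
    if "z \<in> V" for z
    using nz[OF that] z0 by (simp add: q_def Re_Ln norm_divide ln_div)
  have q0: "Re (q z0) = 0" using z0 by (simp add: q_def)
  have "u (g z) + Re (q z) + \<epsilon> * (cmod z)\<^sup>2 \<le> u (g z0) + Re (q z0) + \<epsilon> * (cmod z0)\<^sup>2" if z: "z \<in> V" for z
  proof -
    have sq: "(cmod (l y))\<^sup>2 * exp c = exp (2 * ln (cmod (l y)) + c)" if "l y \<noteq> 0" for y c
      using that by (simp add: exp_add exp_double)
    have "exp (2 * ln (cmod (l z)) + (u (g z) + \<epsilon> * (cmod z)\<^sup>2 - \<beta> * ln (cmod z)))
       \<le> exp (2 * ln (cmod (l z0)) + (u (g z0) + \<epsilon> * (cmod z0)\<^sup>2 - \<beta> * ln (cmod z0)))"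
      using max[OF subsetD[OF V(2) z] nz(2)[OF z]] unfolding sq[OF nz(1)[OF z]] sq[OF z0(2)] .
    then show ?thesis unfolding exp_le_cancel_iff Req[OF z] q0 by (simp add: algebra_simps)
  qed
  then show False
    using no_local_max_holomorphic_pullback[OF u V(1,3) _ holomorphic_on_subset[OF g V(2)] qV levi \<epsilon>]
      gS V(2) by blast
qed

text \<open>The maximum is at x = 1, exactly where \<tau> is truncated. The plateau value exp(-1)
  therefore dominates the untruncated profile.\<close>

lemma mult_exp_minus_le: "x * exp (- x) \<le> exp (- 1 :: real)"
proof -
  have "x \<le> exp (x - 1)" using exp_ge_add_one_self[of "x - 1"] by simp
  then have "x * exp (- x) \<le> exp (x - 1) * exp (- x)" by (intro mult_right_mono) auto
  then show ?thesis by (simp add: exp_add[symmetric])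
qed

lemma (in embedded_ball) disc_P_holomorphic:
  assumes f: "holomorphic_disc X A f"
  shows "open {z \<in> ball 0 1. f z \<in> B}"
    "(\<lambda>z. P (f z) $ i) holomorphic_on {z \<in> ball 0 1. f z \<in> B}"
proof -
  have fc: "continuous_map (top_of_set (ball 0 1)) X f" using f by (simp add: holomorphic_disc_def)
  show op: "open {z \<in> ball 0 1. f z \<in> B}"
    by (rule continuous_map_open_preimage[OF fc openin_B]) simp
  have "\<exists>d. ((P \<circ> f) has_derivative (\<lambda>c. c *s d)) (at z)" if z: "z \<in> ball 0 1" "f z \<in> B" for z
  proof -
    have "f z \<in> topspace X" using openin_B z openin_subset by blast
    then obtain U \<kappa> where U: "(U, \<kappa>) \<in> A" "f z \<in> U" using chart_at by blast
    have "open {z \<in> ball 0 1. f z \<in> U}"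
      by (rule continuous_map_open_preimage[OF fc chart(1)[OF U(1)]]) simp
    moreover have "(\<lambda>z. \<kappa> (f z) $ i) holomorphic_on {z \<in> ball 0 1. f z \<in> U}" for i
      using f U(1) unfolding holomorphic_disc_def by fast
    ultimately have E: "((\<kappa> \<circ> f) has_derivative (\<lambda>c. c *s (\<chi> i. deriv (\<lambda>z. \<kappa> (f z) $ i) z))) (at z)"
      unfolding has_derivative_smult_iff using z U by (auto intro!: holomorphic_derivI)
    obtain L where L: "((P \<circ> inv_into U \<kappa>) has_derivative L) (at (\<kappa> (f z)))"
        "Vector_Spaces.linear (*s) (*s) L"
      using P_holomorphic[OF U(1)] z U unfolding holomorphic_vec_def by blast
    from P_comp_derivative[OF U(1) open_ball z(1) fc U(2) z(2) L(1) E]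
    show ?thesis unfolding o_def linear_smultD[OF L(2)] by blast
  qed
  then show "(\<lambda>z. P (f z) $ i) holomorphic_on {z \<in> ball 0 1. f z \<in> B}"
    unfolding holomorphic_on_open[OF op] by (auto simp: has_derivative_smult_iff o_def)
qed

section \<open>Sibony's function and a Schwarz-type estimate for discs\<close>

locale wHHR_ball = embedded_ball X A \<Phi>
  for X :: "'a topology" and A :: "('a, 'n::finite) chart set" and \<Phi> :: "complex ^ 'n \<Rightarrow> 'a" +
  fixes \<phi> :: "'a \<Rightarrow> real" and s :: real
  assumes s: "s > 0" and C2: "C2_function A \<phi>" and psh: "continuous_psh X A \<phi>"
    and range: "\<phi> ` topspace X \<subseteq> {0..1}"
    and levi: "\<And>w x. w \<in> ball 0 1 \<Longrightarrow> levi_form (\<phi> \<circ> \<Phi>) w x \<ge> s\<^sup>2 * (\<Sum>j\<in>UNIV. (cmod (x $ j))\<^sup>2)"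
begin

lemma chart_hessian:
  assumes U: "(U, \<kappa>) \<in> A"
  obtains u' u'' where "has_hessian_on (\<phi> \<circ> inv_into U \<kappa>) u' u'' (\<kappa> ` U)"
    "\<And>y x. y \<in> \<kappa> ` U \<Longrightarrow> u'' y x x + u'' y (\<i> *s x) (\<i> *s x) \<ge> 0"
proof -
  have "C2_on (\<kappa> ` U) (\<phi> \<circ> inv_into U \<kappa>)" using C2 U unfolding C2_function_def by fast
  then obtain u' u'' where u: "has_hessian_on (\<phi> \<circ> inv_into U \<kappa>) u' u'' (\<kappa> ` U)"
    by (rule C2_on_has_hessian)
  have mean: "\<forall>(U, \<kappa>)\<in>A. \<forall>a b. (\<forall>\<zeta>\<in>cball 0 1. a + \<zeta> *s b \<in> \<kappa> ` U) \<longrightarrow>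
        \<phi> (inv_into U \<kappa> a)
          \<le> 1 / (2 * pi) * integral {0..2 * pi} (\<lambda>\<theta>. \<phi> (inv_into U \<kappa> (a + cis \<theta> *s b)))"
    using psh by (simp add: continuous_psh_def)
  have "u'' y x x + u'' y (\<i> *s x) (\<i> *s x) \<ge> 0" if y: "y \<in> \<kappa> ` U" for y x
  proof (rule hessian_nonneg_of_sub_mean_value[OF u chart(2)[OF U] y])
    fix b assume "\<forall>\<zeta>\<in>cball 0 1. y + \<zeta> *s b \<in> \<kappa> ` U"
    then show "(\<phi> \<circ> inv_into U \<kappa>) y \<le> 1 / (2 * pi) * integral {0..2 * pi} (\<lambda>\<theta>. (\<phi> \<circ> inv_into U \<kappa>) (y + cis \<theta> *s b))"
      using mean[rule_format, OF U] by simp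
  qed
  with u that show ?thesis by blast
qed

text \<open>Smoothness of \<open>\<phi>\<close> is expressed in charts, so the pullback is treated
  on the part of the ball that \<Phi> maps into a single chart. The factor 4 is the one relating the
  Levi form to the real Hessian.\<close>

lemma ball_hessian:
  assumes z: "z \<in> ball 0 1"
  obtains S u' u'' where "open S" "z \<in> S" "S \<subseteq> ball 0 1" "has_hessian_on (\<phi> \<circ> \<Phi>) u' u'' S"
    "\<And>x. u'' z x x + u'' z (\<i> *s x) (\<i> *s x) \<ge> 4 * s\<^sup>2 * (norm x)\<^sup>2"
proof -
  obtain U \<kappa> where U: "(U, \<kappa>) \<in> A" "\<Phi> z \<in> U" using chart_at \<Phi>_in_topspace z by blast
  define S where "S = {z \<in> ball 0 1. \<Phi> z \<in> U}"
  have S: "open S" unfolding S_def by (rule open_\<Phi>_preimage[OF chart(1)[OF U(1)]])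
  have zS: "z \<in> S" using z U by (simp add: S_def)
  obtain v' v'' where v: "has_hessian_on (\<phi> \<circ> inv_into U \<kappa>) v' v'' (\<kappa> ` U)"
    by (rule chart_hessian[OF U(1)])
  have "(\<kappa> \<circ> \<Phi>) ` S \<subseteq> \<kappa> ` U" by (auto simp: S_def)
  then obtain u' u'' where "has_hessian_on (\<phi> \<circ> inv_into U \<kappa> \<circ> (\<kappa> \<circ> \<Phi>)) u' u'' S"
    by (rule has_hessian_on_compose_holomorphic_vec[OF v \<Phi>_holomorphic[OF U(1), folded S_def] S])
  then have u: "has_hessian_on (\<phi> \<circ> \<Phi>) u' u'' S"
    by (rule has_hessian_on_cong_open[OF _ S]) (auto simp: S_def chart_inv[OF U(1)])
  have "u'' z x x + u'' z (\<i> *s x) (\<i> *s x) \<ge> 4 * s\<^sup>2 * (norm x)\<^sup>2" for x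
    using levi_form_eq_hessian[OF u S zS, of x] levi[OF z, of x] by (simp add: norm_vec_square_sum)
  moreover have "S \<subseteq> ball 0 1" by (auto simp: S_def)
  ultimately show ?thesis using that[OF S zS _ u] by blast
qed

text \<open>With this constant, \<open>a \<phi> - 16 |\<Phi>\<^sup>-\<^sup>1 - w|\<^sup>2\<close> is still plurisubharmonic on the image of the ball.\<close>

definition a where "a = 16 / s\<^sup>2"

lemma a_pos: "a > 0" using s by (simp add: a_def)

lemma as: "a * s\<^sup>2 = 16" using s by (simp add: a_def)

text \<open>The factor 4 makes the value 1 occur on the sphere of radius 1/4 about w. For |w| < 1/2
  this sphere lies inside the unit ball, so the extension by 1 is continuous.\<close>

definition \<tau> where "\<tau> w q = (if q \<in> B then min 1 (4 * norm (P q - w)) else 1)"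

text \<open>Sibony's function: up to the factor \<open>16\<close> it behaves like \<open>|\<Phi>\<^sup>-\<^sup>1 - w|\<^sup>2\<close> times a positive function
  near \<open>\<Phi> w\<close>, and it is bounded and log-plurisubharmonic on the whole manifold.
  It is not \<open>C\<^sup>2\<close> where \<open>4 |\<Phi>\<^sup>-\<^sup>1 - w| = 1\<close>, but there \<open>t\<^sup>2 exp (- t\<^sup>2)\<close>, with \<open>t = 4 |\<Phi>\<^sup>-\<^sup>1 - w|\<close>,
  supports it from below.\<close>

definition \<Lambda> where "\<Lambda> w q = (\<tau> w q)\<^sup>2 * exp (- (\<tau> w q)\<^sup>2) * exp (a * \<phi> q)"

lemma \<phi>_range: "q \<in> topspace X \<Longrightarrow> 0 \<le> \<phi> q" "q \<in> topspace X \<Longrightarrow> \<phi> q \<le> 1"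
  using range by auto

lemma \<Lambda>_le: "q \<in> topspace X \<Longrightarrow> \<Lambda> w q \<le> exp (a - 1)"
proof -
  assume q: "q \<in> topspace X"
  have "\<Lambda> w q \<le> exp (- 1) * exp (a * 1)"
    unfolding \<Lambda>_def using \<phi>_range[OF q] a_pos
    by (intro mult_mono mult_exp_minus_le) (auto simp: mult_left_le)
  then show ?thesis by (simp add: exp_add[symmetric])
qed

lemma cball_quarter: "w \<in> ball 0 (1/2) \<Longrightarrow> cball w (1/4) \<subseteq> ball (0 :: complex ^ 'n) 1"
proof
  fix z assume "w \<in> ball 0 (1/2)" "z \<in> cball w (1/4)"
  then show "z \<in> ball 0 1" using dist_triangle[of 0 z w] by (auto simp: dist_commute)
qed

lemma \<tau>_eq_1:
  assumes "q \<notin> \<Phi> ` cball w (1/4)"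
  shows "\<tau> w q = 1"
proof (cases "q \<in> B")
  case True
  then have "P q \<notin> cball w (1/4)" using assms \<Phi>_P(1)[OF True] by (metis imageI)
  then show ?thesis by (simp add: \<tau>_def dist_norm norm_minus_commute)
qed (simp add: \<tau>_def)

lemma \<tau>_continuous:
  assumes w: "w \<in> ball 0 (1/2)" and f: "continuous_map (top_of_set S) X f" and S: "open S"
  shows "continuous_on S (\<lambda>z. \<tau> w (f z))"
proof -
  define S1 where "S1 = {z \<in> S. f z \<in> B}"
  define S2 where "S2 = {z \<in> S. f z \<in> topspace X - \<Phi> ` cball w (1/4)}"
  have o1: "open S1" unfolding S1_def by (rule continuous_map_open_preimage[OF f openin_B S])
  have o2: "open S2" unfolding S2_def
    using closedin_\<Phi>_cball[OF cball_quarter[OF w]] by (intro continuous_map_open_preimage[OF f _ S]) auto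
  have "continuous_map (top_of_set S1) X f"
    using f by (rule continuous_map_from_subtopology_mono) (auto simp: S1_def)
  then have "continuous_on S1 (P \<circ> f)" by (rule P_comp_continuous) (auto simp: S1_def)
  then have "continuous_on S1 (\<lambda>z. min 1 (4 * norm ((P \<circ> f) z - w)))" by (intro continuous_intros)
  then have c1: "continuous_on S1 (\<lambda>z. \<tau> w (f z))"
    by (rule continuous_on_eq) (auto simp: S1_def \<tau>_def)
  have "continuous_on S2 (\<lambda>z. 1 :: real)" by simp
  then have c2: "continuous_on S2 (\<lambda>z. \<tau> w (f z))"
    by (rule continuous_on_eq) (auto simp: S2_def \<tau>_eq_1)
  have "f ` S \<subseteq> topspace X" using f by (auto simp: continuous_map_def)
  then have "S = S1 \<union> S2"
    using cball_quarter[OF w] by (auto simp: S1_def S2_def B_def)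
  with continuous_on_open_Un[OF o1 o2 c1 c2] show ?thesis by simp
qed

text \<open>Near \<open>z0\<close> the function \<Lambda> along the disc is replaced by a C^2
  minorant, up to the factor of a squared holomorphic modulus, with the same value at
  \<open>z0\<close>. A maximum of the original is then a maximum of the minorant, which
  \<open>no_max_weighted\<close> excludes.\<close>

lemma disc_no_interior_max:
  assumes w: "w \<in> ball 0 (1/2)" and f: "holomorphic_disc X A f" and z0: "z0 \<in> ball 0 1" "z0 \<noteq> 0"
    and pos: "\<Lambda> w (f z0) > 0" and \<epsilon>: "\<epsilon> > 0" and V: "open V" "z0 \<in> V"
    and max: "\<And>z. z \<in> V \<Longrightarrow> z \<noteq> 0 \<Longrightarrow> z \<in> ball 0 1 \<Longrightarrow> \<Lambda> w (f z) * exp (\<epsilon> * (cmod z)\<^sup>2 - \<beta> * ln (cmod z))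
       \<le> \<Lambda> w (f z0) * exp (\<epsilon> * (cmod z0)\<^sup>2 - \<beta> * ln (cmod z0))"
  shows False
proof -
  have fc: "continuous_map (top_of_set (ball 0 1)) X f" using f by (simp add: holomorphic_disc_def)
  have ft: "f z \<in> topspace X" if "z \<in> ball 0 1" for z
    using fc that by (auto simp: continuous_map_def)
  show False
  proof (cases "f z0 \<in> \<Phi> ` cball w (1/4)")
    case True
    then have fB: "f z0 \<in> B" using cball_quarter[OF w] by (auto simp: B_def)
    define g where "g z = P (f z)" for z
    have g0: "g z0 \<in> ball 0 1" using \<Phi>_P(2)[OF fB] by (simp add: g_def)
    have g0w: "norm (g z0 - w) \<le> 1/4"
      using True cball_quarter[OF w] by (auto simp: g_def dist_norm norm_minus_commute)
    obtain S u' u'' where S: "open S" "g z0 \<in> S" "S \<subseteq> ball 0 1"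
      and u: "has_hessian_on (\<phi> \<circ> \<Phi>) u' u'' S"
      and lv: "\<And>x. u'' (g z0) x x + u'' (g z0) (\<i> *s x) (\<i> *s x) \<ge> 4 * s\<^sup>2 * (norm x)\<^sup>2"
      using ball_hessian[OF g0] by blast
    define W where "W = {z \<in> ball 0 1. f z \<in> \<Phi> ` S} \<inter> V"
    have SB: "\<Phi> ` S \<subseteq> B" using S by (auto simp: B_def)
    have W: "open W"
      unfolding W_def
      by (intro open_Int continuous_map_open_preimage[OF fc openin_\<Phi>_image[OF S(1,3)]] open_ball V(1))
    have "f z0 \<in> \<Phi> ` S" using \<Phi>_P(1)[OF fB] S(2) unfolding g_def by (metis imageI)
    then have zW: "z0 \<in> W" using V(2) z0(1) by (simp add: W_def)
    have gS: "g ` W \<subseteq> S" using S by (auto simp: W_def g_def)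
    have gh: "(\<lambda>z. g z $ i) holomorphic_on W" for i
      unfolding g_def by (rule holomorphic_on_subset[OF disc_P_holomorphic(2)[OF f]])
        (use SB in \<open>auto simp: W_def\<close>)
    define d where "d = g z0 - w"
    have d: "d \<noteq> 0" using pos fB by (auto simp: \<Lambda>_def \<tau>_def d_def g_def)
    \<comment> \<open>By Cauchy-Schwarz |l| is at most 4 |g - w|, with equality at \<open>z0\<close>
      because the functional is taken in the direction d of g(z0) - w. This trades the norm for the
      modulus of a holomorphic function.\<close>
    define l where "l z = 4 * (\<Sum>i\<in>UNIV. (g z - w) $ i * cnj (d $ i)) / norm d" for z
    have lh: "l holomorphic_on W"
      unfolding l_def by (intro holomorphic_intros, simp, intro holomorphic_intros gh) (use d in auto)
    have l_le: "cmod (l z) \<le> 4 * norm (g z - w)" for z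
      using cmod_sum_cnj_le[of "g z - w" d] d by (simp add: l_def norm_mult norm_divide divide_le_eq)
    have "(\<Sum>i\<in>UNIV. d $ i * cnj (d $ i)) = of_real ((norm d)\<^sup>2)"
      by (simp only: norm_vec_square_sum of_real_sum complex_norm_square)
    then have l0: "l z0 = of_real (4 * norm d)"
      using d by (simp add: l_def d_def[symmetric] power2_eq_square)
    show False
    proof (rule no_max_weighted[OF has_hessian_on_diff_norm[OF u, of a 16 w] W zW gS gh lh _ \<epsilon> z0(2)])
      fix x
      \<comment> \<open>The bound 4 a s^2 |x|^2 = 64 |x|^2 exactly offsets the subtracted squared
        norm, which costs 32 |x|^2 in each of the directions x and \<i> x.\<close>
      have "a * (4 * s\<^sup>2 * (norm x)\<^sup>2) \<le> a * (u'' (g z0) x x + u'' (g z0) (\<i> *s x) (\<i> *s x))"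
        using lv a_pos by (intro mult_left_mono) auto
      also have "a * (4 * s\<^sup>2 * (norm x)\<^sup>2) = 4 * (a * s\<^sup>2) * (norm x)\<^sup>2" by simp
      finally have "64 * (norm x)\<^sup>2 \<le> a * u'' (g z0) x x + a * u'' (g z0) (\<i> *s x) (\<i> *s x)"
        unfolding as by (simp add: algebra_simps)
      moreover have "(\<i> *s x) \<bullet> (\<i> *s x) = (norm x)\<^sup>2"
        by (simp add: power2_norm_eq_inner[symmetric] norm_smult)
      ultimately show "0 \<le> (a *\<^sub>R u'' (g z0) x - (2 * 16) *\<^sub>R blinfun_inner_right x) x +
         (a *\<^sub>R u'' (g z0) (\<i> *s x) - (2 * 16) *\<^sub>R blinfun_inner_right (\<i> *s x)) (\<i> *s x)"
        by (simp add: blinfun.diff_left blinfun.scaleR_left power2_norm_eq_inner[symmetric] algebra_simps)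
    next
      show "l z0 \<noteq> 0" using l0 d by simp
    next
      fix z assume z: "z \<in> W" "z \<noteq> 0"
      define E where "E z = exp (\<epsilon> * (cmod z)\<^sup>2 - \<beta> * ln (cmod z))" for z
      have z1: "z \<in> ball 0 1" "z \<in> V" "f z \<in> B" using z SB by (auto simp: W_def)
      have split: "(cmod (l y))\<^sup>2 * exp (a * (\<phi> \<circ> \<Phi>) (g y) - 16 * (norm (g y - w))\<^sup>2 + \<epsilon> * (cmod y)\<^sup>2 - \<beta> * ln (cmod y))
         = (cmod (l y))\<^sup>2 * exp (- (4 * norm (g y - w))\<^sup>2) * exp (a * \<phi> (f y)) * E y" if "f y \<in> B" for y
        using \<Phi>_P(1)[OF that] by (simp add: E_def exp_add[symmetric] g_def power_mult_distrib algebra_simps)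
      have "(cmod (l z))\<^sup>2 * exp (- (4 * norm (g z - w))\<^sup>2) \<le> (\<tau> w (f z))\<^sup>2 * exp (- (\<tau> w (f z))\<^sup>2)"
      proof -
        have "(cmod (l z))\<^sup>2 * exp (- (4 * norm (g z - w))\<^sup>2) \<le> (4 * norm (g z - w))\<^sup>2 * exp (- (4 * norm (g z - w))\<^sup>2)"
          using l_le by (intro mult_right_mono power_mono) auto
        \<comment> \<open>Where 4 |g - w| is at most 1 the two sides agree; beyond that the right
          side is exp(-1), the maximum of the profile.\<close>
        also have "\<dots> \<le> (\<tau> w (f z))\<^sup>2 * exp (- (\<tau> w (f z))\<^sup>2)"
          using mult_exp_minus_le[of "(4 * norm (g z - w))\<^sup>2"] z1(3)
          by (cases "4 * norm (g z - w) \<le> 1") (auto simp: \<tau>_def g_def min_def)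
        finally show ?thesis .
      qed
      then have "(cmod (l z))\<^sup>2 * exp (- (4 * norm (g z - w))\<^sup>2) * exp (a * \<phi> (f z)) * E z \<le> \<Lambda> w (f z) * E z"
        unfolding \<Lambda>_def by (intro mult_right_mono) (auto simp: E_def)
      also have "\<dots> \<le> \<Lambda> w (f z0) * E z0" unfolding E_def using max z1 z by blast
      also have "\<dots> = (cmod (l z0))\<^sup>2 * exp (- (4 * norm (g z0 - w))\<^sup>2) * exp (a * \<phi> (f z0)) * E z0"
        using g0w fB by (simp add: \<Lambda>_def \<tau>_def l0 g_def d_def norm_mult power_mult_distrib)
      finally show "(cmod (l z))\<^sup>2 * exp (a * (\<phi> \<circ> \<Phi>) (g z) - 16 * (norm (g z - w))\<^sup>2 + \<epsilon> * (cmod z)\<^sup>2 - \<beta> * ln (cmod z))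
         \<le> (cmod (l z0))\<^sup>2 * exp (a * (\<phi> \<circ> \<Phi>) (g z0) - 16 * (norm (g z0 - w))\<^sup>2 + \<epsilon> * (cmod z0)\<^sup>2 - \<beta> * ln (cmod z0))"
        unfolding split[OF z1(3)] split[OF fB] .
    qed
  next
    \<comment> \<open>Near \<open>f z0\<close> the value of \<tau> is 1, so \<Lambda> equals exp(-1)
      exp(a \<phi>) and plurisubharmonicity of \<open>\<phi>\<close> suffices. The weight is the
      constant 1 and no squared norm is subtracted.\<close>
    case False
    obtain U \<kappa> where U: "(U, \<kappa>) \<in> A" "f z0 \<in> U" using chart_at ft z0 by blast
    obtain u' u'' where u: "has_hessian_on (\<phi> \<circ> inv_into U \<kappa>) u' u'' (\<kappa> ` U)"
      and lv: "\<And>y x. y \<in> \<kappa> ` U \<Longrightarrow> u'' y x x + u'' y (\<i> *s x) (\<i> *s x) \<ge> 0"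
      using chart_hessian[OF U(1)] by blast
    define g where "g z = \<kappa> (f z)" for z
    define Q where "Q = topspace X - \<Phi> ` cball w (1/4)"
    have oQ: "openin X Q" unfolding Q_def using closedin_\<Phi>_cball[OF cball_quarter[OF w]] by auto
    define W where "W = {z \<in> ball 0 1. f z \<in> U} \<inter> {z \<in> ball 0 1. f z \<in> Q} \<inter> V"
    have W: "open W" "z0 \<in> W"
      unfolding W_def
      by (intro open_Int continuous_map_open_preimage[OF fc] chart(1)[OF U(1)] oQ open_ball V(1))
         (use V(2) z0 U(2) False ft in \<open>simp add: Q_def\<close>)
    have gS: "g ` W \<subseteq> \<kappa> ` U" by (auto simp: W_def g_def)
    have gh: "(\<lambda>z. g z $ i) holomorphic_on W" for i
    proof -
      have "(\<lambda>z. \<kappa> (f z) $ i) holomorphic_on {z \<in> ball 0 1. f z \<in> U}"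
        using f U(1) unfolding holomorphic_disc_def by fast
      then show ?thesis unfolding g_def by (rule holomorphic_on_subset) (auto simp: W_def)
    qed
    have L: "\<Lambda> w (f z) = exp (- 1) * exp (a * \<phi> (f z))" if "z \<in> W" for z
      using that \<tau>_eq_1[of "f z" w] by (simp add: W_def Q_def \<Lambda>_def)
    show False
    proof (rule no_max_weighted[OF has_hessian_on_diff_norm[OF u, of a 0 0] W gS gh, of "\<lambda>_. 1" \<epsilon> \<beta>])
      fix x
      show "0 \<le> (a *\<^sub>R u'' (g z0) x - (2 * 0) *\<^sub>R blinfun_inner_right x) x +
         (a *\<^sub>R u'' (g z0) (\<i> *s x) - (2 * 0) *\<^sub>R blinfun_inner_right (\<i> *s x)) (\<i> *s x)"
        using mult_nonneg_nonneg[OF less_imp_le[OF a_pos] lv[of "g z0" x]] gS W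
        by (simp add: blinfun.scaleR_left algebra_simps image_subset_iff)
    next
      fix z assume z: "z \<in> W" "z \<noteq> 0"
      have split: "exp (- 1) * ((cmod 1)\<^sup>2 * exp (a * (\<phi> \<circ> inv_into U \<kappa>) (g y) - 0 * (norm (g y - 0))\<^sup>2 + \<epsilon> * (cmod y)\<^sup>2 - \<beta> * ln (cmod y)))
         = \<Lambda> w (f y) * exp (\<epsilon> * (cmod y)\<^sup>2 - \<beta> * ln (cmod y))" if "y \<in> W" for y
      proof -
        have "inv_into U \<kappa> (g y) = f y" using that chart_inv[OF U(1)] by (simp add: g_def W_def)
        then show ?thesis using L[OF that] by (simp add: exp_add[symmetric] algebra_simps)
      qed
      have "\<Lambda> w (f z) * exp (\<epsilon> * (cmod z)\<^sup>2 - \<beta> * ln (cmod z))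
         \<le> \<Lambda> w (f z0) * exp (\<epsilon> * (cmod z0)\<^sup>2 - \<beta> * ln (cmod z0))"
        using max z by (auto simp: W_def)
      then show "(cmod 1)\<^sup>2 * exp (a * (\<phi> \<circ> inv_into U \<kappa>) (g z) - 0 * (norm (g z - 0))\<^sup>2 + \<epsilon> * (cmod z)\<^sup>2 - \<beta> * ln (cmod z))
        \<le> (cmod 1)\<^sup>2 * exp (a * (\<phi> \<circ> inv_into U \<kappa>) (g z0) - 0 * (norm (g z0 - 0))\<^sup>2 + \<epsilon> * (cmod z0)\<^sup>2 - \<beta> * ln (cmod z0))"
        unfolding split[OF z(1), symmetric] split[OF W(2), symmetric] by simp
    qed (use \<epsilon> z0 in auto)
  qed
qed

text \<open>Since \<Lambda> vanishes to second order at the origin and \<beta> < 2, the weighted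
  function tends to 0 there. Its maximum on the punctured closed disc is thus attained, it cannot be
  interior, and on the circle of radius r the bound \<open>\<Lambda>_le\<close> applies.\<close>

lemma disc_bound_param:
  assumes w: "w \<in> ball 0 (1/2)" and f: "holomorphic_disc X A f" "f 0 = \<Phi> w"
    and z1: "z1 \<noteq> 0" "cmod z1 < r" "r < 1" and pos: "\<Lambda> w (f z1) > 0"
    and \<epsilon>: "\<epsilon> > 0" and \<beta>: "0 < \<beta>" "\<beta> < 2"
  shows "\<Lambda> w (f z1) * exp (\<epsilon> * (cmod z1)\<^sup>2 - \<beta> * ln (cmod z1)) \<le> exp (a - 1) * exp (\<epsilon> * r\<^sup>2 - \<beta> * ln r)"
proof -
  define K where "K z = \<Lambda> w (f z) * exp (\<epsilon> * (cmod z)\<^sup>2 - \<beta> * ln (cmod z))" for z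
  have fc: "continuous_map (top_of_set (ball 0 1)) X f" using f by (simp add: holomorphic_disc_def)
  have ft: "f z \<in> topspace X" if "z \<in> ball 0 1" for z
    using fc that by (auto simp: continuous_map_def)
  have w1: "w \<in> ball 0 1" using w by auto
  have f0B: "f 0 \<in> B" using f(2) w1 by (auto simp: B_def)
  have K1: "K z1 > 0" using pos by (simp add: K_def)
  \<comment> \<open>Inside radius \<open>\<rho>\<close> the weighted function stays below its value
    at \<open>z1\<close>, so a maximum over the compact annulus is a maximum over the whole
    punctured disc.\<close>
  obtain \<rho> where \<rho>: "0 < \<rho>" "\<And>z. z \<noteq> 0 \<Longrightarrow> cmod z < \<rho> \<Longrightarrow> K z < K z1"
  proof -
    define D where "D = {z \<in> ball 0 1. f z \<in> B}"
    have D: "open D" "0 \<in> D" using disc_P_holomorphic(1)[OF f(1)] f0B by (auto simp: D_def)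
    define d where "d = (\<chi> i. deriv (\<lambda>z. P (f z) $ i) 0)"
    have "((\<lambda>z. P (f z)) has_derivative (\<lambda>c. c *s d)) (at 0)"
      unfolding has_derivative_smult_iff d_def
      using holomorphic_derivI[OF disc_P_holomorphic(2)[OF f(1), folded D_def] D] by simp
    then obtain e where e: "e > 0" "\<And>z. cmod z < e \<Longrightarrow> norm (P (f z) - P (f 0) - z *s d) \<le> cmod z"
      unfolding has_derivative_at_alt by (metis diff_zero mult_1 zero_less_one)
    obtain e' where e': "e' > 0" "ball 0 e' \<subseteq> D" using D openE by blast
    define C where "C = 16 * (1 + norm d)\<^sup>2 * exp a * exp \<epsilon>"
    have "1 + norm d > 0" using norm_ge_zero[of d] by linarith
    then have C: "C > 0" by (simp add: C_def)
    \<comment> \<open>The first bound keeps z where the first-order estimate and membership in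
      \<open>D\<close> hold; the second makes C |z|^(2 - \<beta>) smaller than
      \<open>K z1\<close>.\<close>
    define m where "m = min (ln (min e e')) (ln (K z1 / C) / (2 - \<beta>)) - 1"
    show thesis
    proof (rule that[of "exp m"])
      fix z assume z: "z \<noteq> 0" "cmod z < exp m"
      have lz: "ln (cmod z) < m" using z by (metis ln_exp ln_less_cancel_iff exp_gt_zero zero_less_norm_iff)
      have "ln (cmod z) < ln (min e e')" using lz unfolding m_def by linarith
      then have z': "cmod z < e" "cmod z < e'" using z e e' by auto
      have zD: "z \<in> D" using z' e' by auto
      have zb: "z \<in> ball 0 1" "f z \<in> B" using zD by (auto simp: D_def)
      have "norm (P (f z) - w) \<le> norm (P (f z) - P (f 0) - z *s d) + norm (z *s d)"
        using norm_triangle_ineq[of "P (f z) - P (f 0) - z *s d" "z *s d"] w1 by (simp add: f)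
      also have "\<dots> \<le> cmod z * (1 + norm d)" using e(2)[OF z'(1)] by (simp add: norm_smult algebra_simps)
      finally have n: "norm (P (f z) - w) \<le> cmod z * (1 + norm d)" .
      have "\<tau> w (f z) \<le> 4 * (cmod z * (1 + norm d))" "0 \<le> \<tau> w (f z)" using n zb by (auto simp: \<tau>_def)
      then have "(\<tau> w (f z))\<^sup>2 \<le> (4 * (cmod z * (1 + norm d)))\<^sup>2" by (intro power_mono)
      moreover have "exp (a * \<phi> (f z)) \<le> exp a"
        using \<phi>_range[OF ft[OF zb(1)]] a_pos by (auto simp: mult_left_le)
      ultimately have "\<Lambda> w (f z) \<le> (4 * (cmod z * (1 + norm d)))\<^sup>2 * 1 * exp a"
        unfolding \<Lambda>_def by (intro mult_mono) auto
      moreover have "(cmod z)\<^sup>2 \<le> 1" using zb by (simp add: power_le_one)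
      then have "exp (\<epsilon> * (cmod z)\<^sup>2 - \<beta> * ln (cmod z)) \<le> exp (\<epsilon> - \<beta> * ln (cmod z))"
        using \<epsilon> by (simp add: mult_left_le)
      ultimately have "K z \<le> ((4 * (cmod z * (1 + norm d)))\<^sup>2 * 1 * exp a) * exp (\<epsilon> - \<beta> * ln (cmod z))"
        unfolding K_def by (intro mult_mono) auto
      also have "\<dots> = C * ((cmod z)\<^sup>2 * exp (- \<beta> * ln (cmod z)))"
      proof -
        have "exp (\<epsilon> - \<beta> * ln (cmod z)) = exp \<epsilon> * exp (- \<beta> * ln (cmod z))" by (simp add: exp_add[symmetric])
        moreover have "(4 * (cmod z * (1 + norm d)))\<^sup>2 = 16 * ((cmod z)\<^sup>2 * (1 + norm d)\<^sup>2)"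
          by (simp add: power_mult_distrib)
        ultimately show ?thesis by (simp only: C_def mult_1_right mult_ac)
      qed
      also have "(cmod z)\<^sup>2 = exp (2 * ln (cmod z))" using z by (simp add: exp_double)
      also have "exp (2 * ln (cmod z)) * exp (- \<beta> * ln (cmod z)) = exp ((2 - \<beta>) * ln (cmod z))"
        by (simp add: exp_add[symmetric] algebra_simps)
      also have "(2 - \<beta>) * ln (cmod z) < ln (K z1 / C)"
      proof -
        have "ln (cmod z) < ln (K z1 / C) / (2 - \<beta>)" using lz unfolding m_def by linarith
        then show ?thesis using \<beta> by (simp add: field_simps)
      qed
      then have "C * exp ((2 - \<beta>) * ln (cmod z)) < C * exp (ln (K z1 / C))" using C by simp
      finally show "K z < K z1" using C K1 by simp
    qed simp
  qed
  have \<rho>1: "\<rho> \<le> cmod z1" using \<rho>(2)[of z1] z1 by force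
  define R where "R = cball 0 r - ball (0::complex) \<rho>"
  have "compact R" unfolding R_def by (intro compact_diff) auto
  moreover have "z1 \<in> R" using \<rho>1 z1 by (auto simp: R_def)
  moreover have "continuous_on R K"
  proof -
    have R1: "R \<subseteq> ball 0 1" "0 \<notin> R" using z1 \<rho> by (auto simp: R_def)
    have "continuous_map X euclideanreal \<phi>" using psh by (simp add: continuous_psh_def)
    from continuous_map_compose[OF fc this] have "continuous_on (ball 0 1) (\<lambda>z. \<phi> (f z))"
      by (simp add: o_def)
    then have "continuous_on (ball 0 1) (\<lambda>z. \<Lambda> w (f z))"
      unfolding \<Lambda>_def by (intro continuous_intros \<tau>_continuous[OF w fc]) auto
    then show ?thesis
      unfolding K_def by (intro continuous_intros) (use R1 continuous_on_subset in auto)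
  qed
  ultimately obtain z0 where z0: "z0 \<in> R" "\<And>z. z \<in> R \<Longrightarrow> K z \<le> K z0"
    using continuous_attains_sup[of R K] by blast
  have z0': "z0 \<noteq> 0" "cmod z0 \<le> r" using z0 \<rho> by (auto simp: R_def)
  have K10: "K z1 \<le> K z0" using z0 \<open>z1 \<in> R\<close> by blast
  have glob: "K z \<le> K z0" if "z \<noteq> 0" "cmod z \<le> r" for z
    using z0(2)[of z] \<rho>(2)[of z] that K10 by (cases "cmod z < \<rho>") (auto simp: R_def)
  have "cmod z0 = r"
  proof (rule ccontr)
    assume "cmod z0 \<noteq> r"
    then have z0r: "z0 \<in> ball 0 r" using z0' by auto
    have "K z0 > 0" using K1 K10 by linarith
    then have L0: "\<Lambda> w (f z0) > 0" by (simp add: K_def zero_less_mult_iff)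
    have "z0 \<in> ball 0 1" using z0r z1 by auto
    then show False
    proof (rule disc_no_interior_max[OF w f(1) _ z0'(1) L0 \<epsilon> open_ball z0r])
      fix z :: complex assume "z \<in> ball 0 r" "z \<noteq> 0"
      then show "\<Lambda> w (f z) * exp (\<epsilon> * (cmod z)\<^sup>2 - \<beta> * ln (cmod z))
          \<le> \<Lambda> w (f z0) * exp (\<epsilon> * (cmod z0)\<^sup>2 - \<beta> * ln (cmod z0))"
        using glob[of z] by (simp add: K_def)
    qed
  qed
  then have "K z0 \<le> exp (a - 1) * exp (\<epsilon> * r\<^sup>2 - \<beta> * ln r)"
    unfolding K_def using \<Lambda>_le[OF ft[of z0], of w] z1 by (simp add: mult_right_mono)
  with K10 show ?thesis by (simp add: K_def)
qed

text \<open>The limit of the preceding estimate with \<epsilon> = \<eta>, \<beta> = 2 - \<eta> and r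
  tending to 1, taken along one parameter \<eta> after passing to logarithms.\<close>

lemma disc_bound:
  assumes w: "w \<in> ball 0 (1/2)" and f: "holomorphic_disc X A f" "f 0 = \<Phi> w" and z: "z \<in> ball 0 1" "z \<noteq> 0"
  shows "\<Lambda> w (f z) \<le> exp (a - 1) * (cmod z)\<^sup>2"
proof (cases "\<Lambda> w (f z) > 0")
  case True
  define x where "x = ln (\<Lambda> w (f z))"
  define y where "y = a - 1 + 2 * ln (cmod z)"
  \<comment> \<open>Collects the errors of order \<eta>: 1 from \<epsilon> r^2, 2 from the logarithm
    of r, and -ln |z| from the deficit 2 - \<beta>.\<close>
  define c where "c = 3 - ln (cmod z)"
  have lz: "ln (cmod z) < 0" using z by simp
  have "x \<le> y + \<eta> * c" if \<eta>: "0 < \<eta>" "\<eta> < 1" for \<eta>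
  proof -
    \<comment> \<open>The first entry gives -ln r \<le> \<eta>; the midpoint keeps r above
      |z|.\<close>
    define r where "r = max (exp (- \<eta>)) ((1 + cmod z) / 2)"
    have r: "cmod z < r" "r < 1" using z \<eta> unfolding r_def less_max_iff_disj max_less_iff_conj by auto
    have r0: "0 < r" by (simp add: r_def less_max_iff_disj)
    have "- \<eta> \<le> ln r" using r0 by (subst ln_ge_iff) (auto simp: r_def)
    then have lr: "- ((2 - \<eta>) * ln r) \<le> 2 * \<eta>"
      using \<eta> mult_mono[of "2 - \<eta>" 2 "- ln r" \<eta>] r r0 by simp
    have "\<Lambda> w (f z) * exp (\<eta> * (cmod z)\<^sup>2 - (2 - \<eta>) * ln (cmod z)) \<le> exp (a - 1) * exp (\<eta> * r\<^sup>2 - (2 - \<eta>) * ln r)"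
      using \<eta> r z True by (intro disc_bound_param[OF w f]) auto
    then have "exp (x + (\<eta> * (cmod z)\<^sup>2 - (2 - \<eta>) * ln (cmod z))) \<le> exp (a - 1 + (\<eta> * r\<^sup>2 - (2 - \<eta>) * ln r))"
      using True by (simp add: exp_add x_def)
    then have "x + \<eta> * (cmod z)\<^sup>2 - (2 - \<eta>) * ln (cmod z) \<le> a - 1 + \<eta> * r\<^sup>2 - (2 - \<eta>) * ln r" by simp
    moreover have "\<eta> * (cmod z)\<^sup>2 \<ge> 0" using \<eta> by simp
    moreover have "\<eta> * r\<^sup>2 \<le> \<eta>" using \<eta> r r0 by (simp add: mult_left_le power_le_one)
    ultimately have "x \<le> a - 1 + \<eta> + 2 * \<eta> + (2 - \<eta>) * ln (cmod z)" using lr by linarith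
    then show ?thesis by (simp add: y_def c_def algebra_simps)
  qed
  moreover have "((\<lambda>\<eta>. y + \<eta> * c) \<longlongrightarrow> y + 0 * c) (at_right 0)" by (intro tendsto_intros)
  moreover have "eventually (\<lambda>\<eta>::real. 0 < \<eta> \<and> \<eta> < 1) (at_right 0)"
    by (auto simp: eventually_at_right_field intro: exI[of _ 1])
  ultimately have "x \<le> y + 0 * c"
    by (intro tendsto_lowerbound[of "\<lambda>\<eta>. y + \<eta> * c" _ "at_right 0"]) (auto elim: eventually_mono)
  then have "exp x \<le> exp y" by simp
  then show ?thesis using True z by (simp add: x_def y_def exp_add exp_double)
next
  case False
  have "0 \<le> exp (a - 1) * (cmod z)\<^sup>2" by simp
  then show ?thesis using False by linarith
qed

text \<open>Both sides of \<open>disc_bound\<close> are of second order at the origin, and comparing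
  their leading terms bounds the first derivative, as in the Schwarz lemma.\<close>

lemma disc_derivative_bound:
  assumes w: "w \<in> ball 0 (1/2)" and f: "holomorphic_disc X A f" "f 0 = \<Phi> w"
    and d: "((\<lambda>z. P (f z)) has_derivative (\<lambda>c. c *s d)) (at 0)"
  shows "norm d \<le> exp a"
proof (rule field_le_epsilon)
  fix \<eta> :: real assume \<eta>: "\<eta> > 0"
  have fc: "continuous_map (top_of_set (ball 0 1)) X f" using f by (simp add: holomorphic_disc_def)
  have w1: "w \<in> ball 0 1" using w by auto
  have f0B: "f 0 \<in> B" using f(2) w1 by (auto simp: B_def)
  have P0: "P (f 0) = w" using f w1 by simp
  obtain e1 where e1: "e1 > 0" "\<And>z. cmod z < e1 \<Longrightarrow> norm (P (f z) - w - z *s d) \<le> \<eta> * cmod z"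
    using d \<eta> unfolding has_derivative_at_alt P0 by (metis diff_zero)
  obtain e2 where e2: "e2 > 0" "ball 0 e2 \<subseteq> {z \<in> ball 0 1. f z \<in> B}"
    using openE[OF disc_P_holomorphic(1)[OF f(1)], of 0] f0B by auto
  have "continuous (at 0) (\<lambda>z. P (f z))" using d has_derivative_continuous by blast
  then obtain e3 where e3: "e3 > 0" "\<And>z. cmod z < e3 \<Longrightarrow> norm (P (f z) - w) < 1/4"
    unfolding continuous_at_eps_delta dist_norm P0 by (metis diff_zero zero_less_divide_1_iff zero_less_numeral)
  define z where "z = complex_of_real (min e1 (min e2 e3) / 2)"
  have z: "cmod z < e1" "cmod z < e2" "cmod z < e3" "cmod z > 0" using e1 e2 e3 by (auto simp: z_def)
  have zB: "z \<in> ball 0 1" "f z \<in> B" using z(2) e2(2) by auto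
  define t where "t = 4 * norm (P (f z) - w)"
  have t: "0 \<le> t" "t \<le> 1" "\<tau> w (f z) = t" using e3(2)[OF z(3)] zB by (auto simp: t_def \<tau>_def)
  have ft: "f z \<in> topspace X" using zB openin_B openin_subset by blast
  \<comment> \<open>Here t \<le> 1 bounds exp(-t^2) below by exp(-1), and \<phi> \<ge> 0 bounds the
    last factor below by 1.\<close>
  have "t\<^sup>2 * exp (- 1) * 1 \<le> t\<^sup>2 * exp (- t\<^sup>2) * exp (a * \<phi> (f z))"
    using t a_pos \<phi>_range(1)[OF ft] by (intro mult_mono mult_left_mono) (auto simp: power_le_one)
  also have "\<dots> \<le> exp (a - 1) * (cmod z)\<^sup>2"
    using disc_bound[OF w f zB(1)] z by (auto simp: \<Lambda>_def t)
  also have "exp (a - 1) = exp a * exp (- 1)" by (simp add: exp_add[symmetric])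
  finally have "t\<^sup>2 \<le> exp a * (cmod z)\<^sup>2" by simp
  \<comment> \<open>A deliberate loss: enlarging exp a to its square lets the root be taken with the
    simple constant exp a. The factor 4 in t is given away afterwards for the same reason.\<close>
  also have "\<dots> \<le> (exp a * cmod z)\<^sup>2"
  proof -
    have "exp a \<le> (exp a)\<^sup>2" using a_pos by (intro self_le_power) auto
    then show ?thesis by (simp add: power_mult_distrib mult_right_mono)
  qed
  finally have "t \<le> exp a * cmod z" by (rule power2_le_imp_le) simp
  then have "norm (P (f z) - w) \<le> exp a * cmod z" unfolding t_def by (smt (verit) norm_ge_zero)
  moreover have "norm (z *s d) \<le> norm (P (f z) - w) + norm (P (f z) - w - z *s d)"
    using norm_triangle_ineq4[of "P (f z) - w" "P (f z) - w - z *s d"] by simp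
  ultimately have "cmod z * norm d \<le> cmod z * (exp a + \<eta>)"
    using e1(2)[OF z(1)] by (simp add: norm_smult algebra_simps)
  then show "norm d \<le> exp a + \<eta>" using z(4) by simp
qed

end

subsection \<open>Lower bound for the Kobayashi distance\<close>

text \<open>Away from the break points a small closed interval around t is admissible, and t is
  interior to it, so the derivative within the interval is two-sided.\<close>

lemma (in cmanifold) piecewise_C1_curve_differentiable:
  assumes "piecewise_C1_curve X A \<sigma>"
  obtains F where "finite F"
    "\<And>t U \<kappa>. 0 < t \<Longrightarrow> t < 1 \<Longrightarrow> t \<notin> F \<Longrightarrow> (U, \<kappa>) \<in> A \<Longrightarrow> \<sigma> t \<in> U \<Longrightarrow>
       \<exists>D. ((\<kappa> \<circ> \<sigma>) has_vector_derivative D) (at t)"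
proof -
  obtain F where F: "finite F"
    "\<And>a b. 0 \<le> a \<Longrightarrow> a < b \<Longrightarrow> b \<le> 1 \<Longrightarrow> {a<..<b} \<inter> F = {} \<Longrightarrow> C1_curve_on X A a b \<sigma>"
    using assms unfolding piecewise_C1_curve_def by blast
  have "\<exists>D. ((\<kappa> \<circ> \<sigma>) has_vector_derivative D) (at t)"
    if t: "0 < t" "t < 1" "t \<notin> F" and U: "(U, \<kappa>) \<in> A" "\<sigma> t \<in> U" for t U \<kappa>
  proof -
    have "open ({0<..<1} - F)" using F(1) by (intro open_Diff finite_imp_closed) auto
    then obtain e where e: "e > 0" "ball t e \<subseteq> {0<..<1} - F" using t openE[of "{0<..<1} - F" t] by auto
    define a where "a = t - e / 2"
    define b where "b = t + e / 2"
    have sub: "{a..b} \<subseteq> {0<..<1} - F"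
      using e by (intro order_trans[OF _ e(2)]) (auto simp: a_def b_def dist_real_def abs_le_iff)
    have ab: "a < t" "t < b" using e by (auto simp: a_def b_def)
    then have "a \<in> {a..b}" "b \<in> {a..b}" by auto
    with sub have "0 \<le> a" "b \<le> 1" by (meson DiffD1 greaterThanLessThan_iff less_imp_le subsetD)+
    moreover have "{a<..<b} \<inter> F = {}" using sub greaterThanLessThan_subseteq_atLeastAtMost_iff[of a b a b] by blast
    ultimately have "C1_curve_on X A a b \<sigma>" using F(2) ab by auto
    then obtain D where "\<forall>t\<in>{a..b}. \<sigma> t \<in> U \<longrightarrow> ((\<kappa> \<circ> \<sigma>) has_vector_derivative D t) (at t within {a..b})"
      using U(1) unfolding C1_curve_on_def by fast
    then have "((\<kappa> \<circ> \<sigma>) has_vector_derivative D t) (at t within {a..b})" using ab U(2) by auto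
    moreover have "at t within {a..b} = at t" using ab by (intro at_within_interior) auto
    ultimately show ?thesis by auto
  qed
  with F(1) that show ?thesis by blast
qed

context wHHR_ball
begin

text \<open>For a disc competing in the infimum, comparing tangent vectors in the chart U gives D =
  \<xi> d. Applying the complex linear map L yields L D = \<xi> (L d), where L d is the derivative
  of P along the disc and has norm at most exp a.\<close>

lemma kobayashi_metric_lower_bound:
  assumes \<sigma>: "continuous_map (top_of_set {0..1}) X \<sigma>" and t: "0 < t" "t < 1"
    and w: "\<sigma> t = \<Phi> w" "w \<in> ball 0 (1/2)"
    and U: "(U, \<kappa>) \<in> A" "\<sigma> t \<in> U" and D: "((\<kappa> \<circ> \<sigma>) has_vector_derivative D) (at t)"
  obtains v where "((P \<circ> \<sigma>) has_vector_derivative v) (at t)"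
    "ennreal (norm v) \<le> ennreal (exp a) * kobayashi_metric X A (\<sigma> t) (velocity A \<sigma> t)"
proof -
  have B: "\<sigma> t \<in> B" using w by (auto simp: B_def)
  have "\<kappa> (\<sigma> t) \<in> \<kappa> ` (U \<inter> B)" using U B by auto
  then obtain L where L: "((P \<circ> inv_into U \<kappa>) has_derivative L) (at (\<kappa> (\<sigma> t)))" "Vector_Spaces.linear (*s) (*s) L"
    using P_holomorphic[OF U(1)] unfolding holomorphic_vec_def by blast
  interpret L: bounded_linear L by (rule has_derivative_bounded_linear[OF L(1)])
  have c: "continuous_map (top_of_set {0<..<1}) X \<sigma>"
    using \<sigma> by (rule continuous_map_from_subtopology_mono) auto
  have "((P \<circ> \<sigma>) has_derivative (L \<circ> (\<lambda>x. x *\<^sub>R D))) (at t)"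
    using t D[unfolded has_vector_derivative_def]
    by (intro P_comp_derivative[OF U(1) _ _ c U(2) B L(1)]) auto
  then have v: "((P \<circ> \<sigma>) has_vector_derivative (L D)) (at t)"
    by (simp add: has_vector_derivative_def o_def L.scaleR)
  have vD: "vector_derivative (\<kappa> \<circ> \<sigma>) (at t within {0..1}) = D"
    using vector_derivative_within_cbox[of 0 1 t "\<kappa> \<circ> \<sigma>" D] t has_vector_derivative_at_within[OF D] by auto
  have "ennreal (norm (L D) / exp a) \<le> kobayashi_metric X A (\<sigma> t) (velocity A \<sigma> t)"
    unfolding kobayashi_metric_def
  proof (rule Inf_greatest, safe)
    fix \<xi> f assume f: "holomorphic_disc X A f" and f0: "f 0 = \<sigma> t" and fd: "disc_differential A f \<xi> = velocity A \<sigma> t"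
    define d where "d = (\<chi> i. deriv (\<lambda>z. \<kappa> (f z) $ i) 0)"
    have fc: "continuous_map (top_of_set (ball 0 1)) X f" using f by (simp add: holomorphic_disc_def)
    have "disc_differential A f \<xi> (U, \<kappa>) = \<xi> *s d" using U f0 by (simp add: disc_differential_def d_def)
    moreover have "velocity A \<sigma> t (U, \<kappa>) = D" using U vD by (simp add: velocity_def)
    ultimately have xd: "\<xi> *s d = D" using fd by simp
    have "open {z \<in> ball 0 1. f z \<in> U}"
      by (rule continuous_map_open_preimage[OF fc chart(1)[OF U(1)]]) simp
    moreover have "(\<lambda>z. \<kappa> (f z) $ i) holomorphic_on {z \<in> ball 0 1. f z \<in> U}" for i
      using f U(1) unfolding holomorphic_disc_def by fast
    ultimately have E: "((\<kappa> \<circ> f) has_derivative (\<lambda>c. c *s d)) (at 0)"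
      unfolding has_derivative_smult_iff d_def using f0 U by (auto intro!: holomorphic_derivI)
    have "((P \<circ> f) has_derivative (L \<circ> (\<lambda>c. c *s d))) (at 0)"
      using f0 U B L(1) E by (intro P_comp_derivative[OF U(1) open_ball _ fc]) auto
    then have "((\<lambda>z. P (f z)) has_derivative (\<lambda>c. c *s L d)) (at 0)"
      by (simp add: o_def linear_smultD[OF L(2)])
    then have "norm (L d) \<le> exp a"
      using disc_derivative_bound[OF w(2) f] f0 w(1) by simp
    moreover have "norm (L D) = cmod \<xi> * norm (L d)"
      unfolding xd[symmetric] linear_smultD[OF L(2)] norm_smult ..
    ultimately have "norm (L D) / exp a \<le> cmod \<xi>"
      by (simp add: divide_le_eq mult_left_mono)
    then show "ennreal (norm (L D) / exp a) \<le> ennreal (cmod \<xi>)" by (rule ennreal_leI)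
  qed
  then have "ennreal (exp a) * ennreal (norm (L D) / exp a) \<le> ennreal (exp a) * kobayashi_metric X A (\<sigma> t) (velocity A \<sigma> t)"
    by (rule mult_left_mono) simp
  moreover have "ennreal (exp a) * ennreal (norm (L D) / exp a) = ennreal (norm (L D))"
    by (simp add: ennreal_mult[symmetric])
  ultimately show ?thesis using that v by simp
qed

text \<open>Only the part of the curve up to the first exit time T from the ball of radius r is
  measured. Its pullback runs from 0 to the sphere of radius r, and r \<le> 1/2 keeps it where the
  metric bound is valid.\<close>

lemma curve_length_lower_bound:
  assumes \<sigma>: "piecewise_C1_curve X A \<sigma>" and \<sigma>0: "\<sigma> 0 = \<Phi> 0" and r: "0 < r" "r \<le> 1/2"
    and \<sigma>1: "\<sigma> 1 \<notin> \<Phi> ` ball 0 r"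
  shows "ennreal (r / exp a) \<le> (\<integral>\<^sup>+t\<in>{0..1}. kobayashi_metric X A (\<sigma> t) (velocity A \<sigma> t) \<partial>lborel)"
proof -
  define k where "k t = kobayashi_metric X A (\<sigma> t) (velocity A \<sigma> t)" for t
  have c: "continuous_map (top_of_set {0..1}) X \<sigma>" using \<sigma> by (simp add: piecewise_C1_curve_def)
  have r1: "ball 0 r \<subseteq> ball (0 :: complex ^ 'n) 1" "cball 0 r \<subseteq> ball (0 :: complex ^ 'n) 1"
    using r by auto
  define E where "E = {t \<in> {0..1}. \<sigma> t \<in> topspace X - \<Phi> ` ball 0 r}"
  have "closedin X (topspace X - \<Phi> ` ball 0 r)" using openin_\<Phi>_image[OF open_ball r1(1)] by auto
  from closedin_continuous_map_preimage[OF c this]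
  have "closedin (top_of_set {0..1}) E" by (simp add: E_def)
  then have clE: "closed E" using closedin_closed_trans by blast
  have t\<sigma>: "\<sigma> t \<in> topspace X" if "t \<in> {0..1}" for t using c that by (auto simp: continuous_map_def)
  have E1: "1 \<in> E" using \<sigma>1 t\<sigma>[of 1] by (auto simp: E_def)
  define T where "T = Inf E"
  have bdd: "bdd_below E" by (auto simp: E_def intro: bdd_belowI[of _ 0])
  have TE: "T \<in> E" unfolding T_def using closed_contains_Inf[OF _ bdd clE] E1 by blast
  have T01: "0 \<le> T" "T \<le> 1" using TE by (auto simp: E_def)
  have "0 \<notin> E" using \<sigma>0 r by (auto simp: E_def)
  then have T0: "0 < T" using T01 TE by (metis less_eq_real_def)
  have before: "\<sigma> t \<in> \<Phi> ` ball 0 r" if "0 \<le> t" "t < T" for t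
  proof -
    have "t \<notin> E" using that cInf_lower[OF _ bdd, of t] unfolding T_def by auto
    then show ?thesis using that T01 t\<sigma>[of t] by (auto simp: E_def)
  qed
  have cT: "continuous_map (top_of_set {0..T}) X \<sigma>"
    using c by (rule continuous_map_from_subtopology_mono) (use T01 in auto)
  \<comment> \<open>The image of the compact closed ball is closed, so the exit point is still in
    it. The curve therefore cannot leave the embedded ball without meeting the sphere.\<close>
  have "\<sigma> T \<in> \<Phi> ` cball 0 r"
  proof -
    have "closedin (top_of_set {0..T}) {t \<in> {0..T}. \<sigma> t \<in> \<Phi> ` cball 0 r}"
      using closedin_continuous_map_preimage[OF cT closedin_\<Phi>_cball[OF r1(2)]] by simp
    then have cl: "closed {t \<in> {0..T}. \<sigma> t \<in> \<Phi> ` cball 0 r}" using closedin_closed_trans by blast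
    have "{0..<T} \<subseteq> {t \<in> {0..T}. \<sigma> t \<in> \<Phi> ` cball 0 r}" using before by force
    then have "closure {0..<T} \<subseteq> {t \<in> {0..T}. \<sigma> t \<in> \<Phi> ` cball 0 r}" using cl by (rule closure_minimal)
    moreover have "T \<in> closure {0..<T}" using T0 by (simp add: closure_atLeastLessThan)
    ultimately show ?thesis by blast
  qed
  then obtain wT where wT: "wT \<in> cball 0 r" "\<sigma> T = \<Phi> wT" by auto
  have nT: "norm wT = r" using wT TE by (auto simp: E_def)
  have inB: "\<sigma> ` {0..T} \<subseteq> B"
  proof safe
    fix t assume "t \<in> {0..T}"
    then show "\<sigma> t \<in> B" using before[of t] wT r1 by (cases "t = T") (auto simp: B_def)
  qed
  have contP: "continuous_on {0..T} (P \<circ> \<sigma>)" by (rule P_comp_continuous[OF cT inB])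
  obtain F where F: "finite F"
    "\<And>t U \<kappa>. 0 < t \<Longrightarrow> t < 1 \<Longrightarrow> t \<notin> F \<Longrightarrow> (U, \<kappa>) \<in> A \<Longrightarrow> \<sigma> t \<in> U \<Longrightarrow>
       \<exists>D. ((\<kappa> \<circ> \<sigma>) has_vector_derivative D) (at t)"
    using piecewise_C1_curve_differentiable[OF \<sigma>] by blast
  define \<gamma>' where "\<gamma>' t = vector_derivative (P \<circ> \<sigma>) (at t)" for t
  have der: "((P \<circ> \<sigma>) has_vector_derivative \<gamma>' t) (at t) \<and> ennreal (norm (\<gamma>' t)) \<le> ennreal (exp a) * k t"
    if t: "0 < t" "t < T" "t \<notin> F" for t
  proof -
    have t1: "t < 1" using t T01 by simp
    obtain U \<kappa> where U: "(U, \<kappa>) \<in> A" "\<sigma> t \<in> U" using chart_at[OF t\<sigma>[of t]] t t1 by auto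
    obtain D where D: "((\<kappa> \<circ> \<sigma>) has_vector_derivative D) (at t)" using F(2)[OF t(1) t1 t(3) U] by blast
    obtain w where w: "\<sigma> t = \<Phi> w" "w \<in> ball 0 (1/2)" using before[of t] t r by auto
    obtain v where v: "((P \<circ> \<sigma>) has_vector_derivative v) (at t)" "ennreal (norm v) \<le> ennreal (exp a) * k t"
      unfolding k_def by (rule kobayashi_metric_lower_bound[OF c t(1) t1 w U D])
    then show ?thesis unfolding \<gamma>'_def using vector_derivative_at[OF v(1)] by simp
  qed
  have "P (\<sigma> T) = wT" "P (\<sigma> 0) = 0" using wT r1 \<sigma>0 by auto
  then have "ennreal r = ennreal (norm ((P \<circ> \<sigma>) T - (P \<circ> \<sigma>) 0))" using nT by simp
  also have "\<dots> \<le> (\<integral>\<^sup>+t\<in>{0<..<T} - F. ennreal (norm (\<gamma>' t)) \<partial>lborel)"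
    using T01 der by (intro norm_diff_le_nn_integral_deriv[OF _ F(1) contP]) auto
  finally have "ennreal (1 / exp a) * ennreal r \<le> ennreal (1 / exp a) * (\<integral>\<^sup>+t\<in>{0<..<T} - F. ennreal (norm (\<gamma>' t)) \<partial>lborel)"
    by (rule mult_left_mono) simp
  also have "\<dots> \<le> (\<integral>\<^sup>+t\<in>{0..1}. k t \<partial>lborel)"
  proof (cases "(\<integral>\<^sup>+t\<in>{0..1}. k t \<partial>lborel) = \<infinity>")
    case False
    have "(\<integral>\<^sup>+t\<in>{0<..<T} - F. ennreal (norm (\<gamma>' t)) \<partial>lborel) \<le> (\<integral>\<^sup>+t. ennreal (exp a) * (k t * indicator {0..1} t) \<partial>lborel)"
      using der T01 by (intro nn_integral_mono) (auto simp: indicator_def)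
    also have "\<dots> \<le> ennreal (exp a) * (\<integral>\<^sup>+t\<in>{0..1}. k t \<partial>lborel)"
      by (rule nn_integral_cmult_le) simp
    finally have "ennreal (1 / exp a) * (\<integral>\<^sup>+t\<in>{0<..<T} - F. ennreal (norm (\<gamma>' t)) \<partial>lborel)
      \<le> ennreal (1 / exp a) * (ennreal (exp a) * (\<integral>\<^sup>+t\<in>{0..1}. k t \<partial>lborel))"
      by (rule mult_left_mono) simp
    then show ?thesis by (simp add: mult.assoc[symmetric] ennreal_mult[symmetric])
  qed simp
  finally show ?thesis using r by (simp add: ennreal_mult[symmetric] k_def)
qed

lemma kobayashi_dist_lower_bound:
  assumes "0 < r" "r \<le> 1/2" and "kobayashi_dist X A (\<Phi> 0) q < ennreal (r / exp a)"
  shows "q \<in> \<Phi> ` ball 0 r"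
proof (rule ccontr)
  assume "q \<notin> \<Phi> ` ball 0 r"
  then have "ennreal (r / exp a) \<le> kobayashi_dist X A (\<Phi> 0) q"
    unfolding kobayashi_dist_def using curve_length_lower_bound[OF _ _ assms(1,2)]
    by (intro Inf_greatest) auto
  with assms(3) show False by simp
qed

end

subsection \<open>Upper bound for the Kobayashi distance in a chart\<close>

context cmanifold
begin

lemma kobayashi_dist_le_length:
  assumes "piecewise_C1_curve X A \<sigma>"
  shows "kobayashi_dist X A (\<sigma> 0) (\<sigma> 1)
     \<le> (\<integral>\<^sup>+t\<in>{0..1}. kobayashi_metric X A (\<sigma> t) (velocity A \<sigma> t) \<partial>lborel)"
  unfolding kobayashi_dist_def using assms by (intro Inf_lower CollectI exI[of _ \<sigma>]) simp

text \<open>\<open>C1_curve_on\<close> demands continuous velocities in every chart, while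
  \<open>holomorphic_vec\<close> supplies only pointwise derivatives; the gap is closed by the
  regularity obtained from Cauchy's formula.\<close>

lemma transition_derivative:
  assumes U: "(U, \<kappa>) \<in> A" and V: "(V, \<mu>) \<in> A"
  obtains h' :: "complex ^ 'n \<Rightarrow> (complex ^ 'n) \<Rightarrow>\<^sub>L (complex ^ 'n)" where
    "\<And>y. y \<in> \<kappa> ` (U \<inter> V) \<Longrightarrow> ((\<mu> \<circ> inv_into U \<kappa>) has_derivative blinfun_apply (h' y)) (at y)"
    "\<And>y c x. y \<in> \<kappa> ` (U \<inter> V) \<Longrightarrow> h' y (c *s x) = c *s h' y x"
    "continuous_on (\<kappa> ` (U \<inter> V)) h'"
proof (rule holomorphic_vec_twice_differentiable[OF transition[OF U V] chart_open_image[OF U chart(1)[OF V]]])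
  fix h' :: "complex ^ 'n \<Rightarrow> (complex ^ 'n) \<Rightarrow>\<^sub>L (complex ^ 'n)"
  assume h': "\<And>y. y \<in> \<kappa> ` (U \<inter> V) \<Longrightarrow> ((\<mu> \<circ> inv_into U \<kappa>) has_derivative blinfun_apply (h' y)) (at y)"
    "\<And>y c x. y \<in> \<kappa> ` (U \<inter> V) \<Longrightarrow> h' y (c *s x) = c *s h' y x"
    "\<And>y. y \<in> \<kappa> ` (U \<inter> V) \<Longrightarrow> h' differentiable at y"
  have "continuous_on (\<kappa> ` (U \<inter> V)) h'"
    using h'(3) by (meson continuous_at_imp_continuous_on differentiable_imp_continuous_within)
  with that h' show thesis by blast
qed

lemma inv_into_mem_iff:
  assumes "(U, \<kappa>) \<in> A" "y \<in> \<kappa> ` U"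
  shows "inv_into U \<kappa> y \<in> V \<longleftrightarrow> y \<in> \<kappa> ` (U \<inter> V)"
  using assms chart_inv[OF assms(1)] by auto

lemma segment_C1_curve:
  assumes U: "(U, \<kappa>) \<in> A" and sub: "\<And>t. t \<in> {a..b} \<Longrightarrow> y0 + t *\<^sub>R v \<in> \<kappa> ` U"
  shows "C1_curve_on X A a b (\<lambda>t. inv_into U \<kappa> (y0 + t *\<^sub>R v))"
  unfolding C1_curve_on_def
proof (intro conjI ballI)
  have "continuous_map (top_of_set {a..b}) (top_of_set (\<kappa> ` U)) (\<lambda>t. y0 + t *\<^sub>R v)"
    using sub by (auto simp: continuous_map_in_subtopology intro!: continuous_intros)
  from continuous_map_compose[OF this chart_inv_continuous[OF U]]
  show "continuous_map (top_of_set {a..b}) X (\<lambda>t. inv_into U \<kappa> (y0 + t *\<^sub>R v))" by (simp add: o_def)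
next
  fix c assume c: "c \<in> A"
  obtain V \<mu> where cV: "c = (V, \<mu>)" by (cases c)
  with c have V: "(V, \<mu>) \<in> A" by simp
  obtain h' where h': "\<And>y. y \<in> \<kappa> ` (U \<inter> V) \<Longrightarrow> ((\<mu> \<circ> inv_into U \<kappa>) has_derivative blinfun_apply (h' y)) (at y)"
    "\<And>y c x. y \<in> \<kappa> ` (U \<inter> V) \<Longrightarrow> h' y (c *s x) = c *s h' y x"
    "continuous_on (\<kappa> ` (U \<inter> V)) h'"
    by (rule transition_derivative[OF U V]) (rule that)
  define I where "I = {t \<in> {a..b}. inv_into U \<kappa> (y0 + t *\<^sub>R v) \<in> V}"
  have mem: "y0 + t *\<^sub>R v \<in> \<kappa> ` (U \<inter> V)" if "t \<in> I" for t
    using that inv_into_mem_iff[OF U sub] by (auto simp: I_def)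
  have "continuous_on I (\<lambda>t. h' (y0 + t *\<^sub>R v) v)"
    by (intro continuous_intros continuous_on_compose2[OF h'(3)]) (use mem in auto)
  moreover have "((\<mu> \<circ> (\<lambda>t. inv_into U \<kappa> (y0 + t *\<^sub>R v))) has_vector_derivative h' (y0 + t *\<^sub>R v) v) (at t within {a..b})"
    if "t \<in> I" for t
  proof -
    have "((\<lambda>t. y0 + t *\<^sub>R v) has_derivative (\<lambda>x. x *\<^sub>R v)) (at t within {a..b})"
      by (auto intro!: derivative_eq_intros)
    from has_derivative_compose[OF this h'(1)[OF mem[OF that]]]
    show ?thesis by (simp add: has_vector_derivative_def o_def blinfun.scaleR_right)
  qed
  ultimately show "case c of (V, \<mu>) \<Rightarrow> \<exists>D. continuous_on {t \<in> {a..b}. inv_into U \<kappa> (y0 + t *\<^sub>R v) \<in> V} D \<and>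
      (\<forall>t\<in>{a..b}. inv_into U \<kappa> (y0 + t *\<^sub>R v) \<in> V \<longrightarrow>
        ((\<mu> \<circ> (\<lambda>t. inv_into U \<kappa> (y0 + t *\<^sub>R v))) has_vector_derivative D t) (at t within {a..b}))"
    unfolding cV I_def by auto
qed

text \<open>The competitor is the affine disc in direction v scaled by r / e, which stays in the
  ball of radius r; its differential maps e / r to v. Taking e strictly above \<open>norm v\<close>
  includes v = 0 without a division by zero.\<close>

lemma kobayashi_metric_segment_le:
  assumes U: "(U, \<kappa>) \<in> A" and sub: "\<And>t. t \<in> {0..1} \<Longrightarrow> ball (y0 + t *\<^sub>R v) r \<subseteq> \<kappa> ` U"
    and r: "0 < r" and e: "norm v < e" and t: "t \<in> {0..1}"
  shows "kobayashi_metric X A (inv_into U \<kappa> (y0 + t *\<^sub>R v)) (velocity A (\<lambda>t. inv_into U \<kappa> (y0 + t *\<^sub>R v)) t)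
     \<le> ennreal (e / r)"
proof -
  define y where "y = y0 + t *\<^sub>R v"
  define \<sigma> where "\<sigma> t = inv_into U \<kappa> (y0 + t *\<^sub>R v)" for t
  have e0: "e > 0" using e norm_ge_zero[of v] by linarith
  define c where "c = complex_of_real (r / e)"
  define f where "f z = inv_into U \<kappa> (y + z *s (c *s v))" for z
  have fy: "y + z *s (c *s v) \<in> \<kappa> ` U" if z: "z \<in> ball 0 1" for z
  proof -
    have "cmod c = r / e" using e0 r unfolding c_def norm_of_real by simp
    then have "norm (z *s (c *s v)) = cmod z * (r * (norm v / e))" by (simp only: norm_smult) simp
    also have "\<dots> \<le> 1 * (r * (norm v / e))" using z r e0 by (intro mult_right_mono) auto
    also have "\<dots> < r" using e e0 r by (simp add: divide_less_eq)
    finally have "y + z *s (c *s v) \<in> ball y r" by (simp add: dist_norm)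
    then show ?thesis using sub[OF t] unfolding y_def by blast
  qed
  have f0: "f 0 = \<sigma> t" by (simp add: f_def y_def \<sigma>_def)
  have fder: "(\<lambda>z. \<mu> (f z) $ i) holomorphic_on {z \<in> ball 0 1. f z \<in> V}"
    "f 0 \<in> V \<Longrightarrow> complex_of_real (e / r) *s (\<chi> i. deriv (\<lambda>z. \<mu> (f z) $ i) 0) = vector_derivative (\<mu> \<circ> \<sigma>) (at t within {0..1})"
    if V: "(V, \<mu>) \<in> A" for V \<mu> i
  proof -
    obtain h' where h': "\<And>y. y \<in> \<kappa> ` (U \<inter> V) \<Longrightarrow> ((\<mu> \<circ> inv_into U \<kappa>) has_derivative blinfun_apply (h' y)) (at y)"
      "\<And>y c x. y \<in> \<kappa> ` (U \<inter> V) \<Longrightarrow> h' y (c *s x) = c *s h' y x"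
      "continuous_on (\<kappa> ` (U \<inter> V)) h'"
      by (rule transition_derivative[OF U V]) (rule that)
    have d: "((\<lambda>z. \<mu> (f z)) has_derivative (\<lambda>x. x *s (c *s h' (y + z *s (c *s v)) v))) (at z)"
      if z: "z \<in> ball 0 1" "f z \<in> V" for z
    proof -
      have m: "y + z *s (c *s v) \<in> \<kappa> ` (U \<inter> V)"
        using z inv_into_mem_iff[OF U fy[OF z(1)]] by (simp add: f_def)
      from has_derivative_compose[OF has_derivative_smult_line h'(1)[OF m]]
      show ?thesis unfolding f_def o_def h'(2)[OF m] .
    qed
    show "(\<lambda>z. \<mu> (f z) $ i) holomorphic_on {z \<in> ball 0 1. f z \<in> V}"
    proof (rule holomorphic_onI)
      fix z assume "z \<in> {z \<in> ball 0 1. f z \<in> V}"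
      then have "((\<lambda>z. \<mu> (f z) $ i) has_field_derivative (c *s h' (y + z *s (c *s v)) v) $ i) (at z)"
        using d[of z] unfolding has_derivative_smult_iff by blast
      then show "(\<lambda>z. \<mu> (f z) $ i) field_differentiable (at z within {z \<in> ball 0 1. f z \<in> V})"
        using has_field_derivative_at_within unfolding field_differentiable_def by blast
    qed
    assume V0: "f 0 \<in> V"
    have m: "y \<in> \<kappa> ` (U \<inter> V)" using V0 inv_into_mem_iff[OF U fy[of 0]] by (simp add: f_def)
    have "deriv (\<lambda>z. \<mu> (f z) $ i) 0 = (c *s h' y v) $ i" for i
      using d[of 0] V0 unfolding has_derivative_smult_iff by (intro DERIV_imp_deriv) auto
    then have "complex_of_real (e / r) *s (\<chi> i. deriv (\<lambda>z. \<mu> (f z) $ i) 0) = h' y v"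
      using e0 r by (simp add: vec_eq_iff c_def)
    moreover have "((\<lambda>t. y0 + t *\<^sub>R v) has_derivative (\<lambda>x. x *\<^sub>R v)) (at t within {0..1})"
      by (auto intro!: derivative_eq_intros)
    from has_derivative_compose[OF this h'(1)[OF m[unfolded y_def]]]
    have "((\<mu> \<circ> \<sigma>) has_vector_derivative h' y v) (at t within {0..1})"
      by (simp add: has_vector_derivative_def o_def blinfun.scaleR_right \<sigma>_def y_def)
    then have "vector_derivative (\<mu> \<circ> \<sigma>) (at t within {0..1}) = h' y v"
      using vector_derivative_within_cbox[of 0 1 t] t by auto
    ultimately show "complex_of_real (e / r) *s (\<chi> i. deriv (\<lambda>z. \<mu> (f z) $ i) 0) = vector_derivative (\<mu> \<circ> \<sigma>) (at t within {0..1})"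
      by simp
  qed
  have "continuous_map (top_of_set (ball 0 1)) (top_of_set (\<kappa> ` U)) (\<lambda>z. y + z *s (c *s v))"
    using fy by (auto simp: continuous_map_in_subtopology intro!: continuous_intros)
  from continuous_map_compose[OF this chart_inv_continuous[OF U]]
  have "continuous_map (top_of_set (ball 0 1)) X f" by (simp add: o_def f_def[abs_def])
  then have "holomorphic_disc X A f" unfolding holomorphic_disc_def using fder(1) by blast
  moreover have "disc_differential A f (complex_of_real (e / r)) = velocity A \<sigma> t"
    unfolding disc_differential_def velocity_def using fder(2) f0 by (intro ext) auto
  ultimately have "kobayashi_metric X A (\<sigma> t) (velocity A \<sigma> t) \<le> ennreal (cmod (complex_of_real (e / r)))"
    unfolding kobayashi_metric_def using f0 by (intro Inf_lower) auto
  then show ?thesis using e0 r by (simp add: \<sigma>_def[abs_def] norm_divide)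
qed

text \<open>Along the segment from y0 to y every point keeps a ball of radius r/2 inside the chart,
  whence the metric is at most 2 e / r.\<close>

lemma kobayashi_dist_chart_le:
  assumes U: "(U, \<kappa>) \<in> A" and sub: "ball y0 r \<subseteq> \<kappa> ` U" and y: "norm (y - y0) < r / 2" "norm (y - y0) < e"
  shows "kobayashi_dist X A (inv_into U \<kappa> y0) (inv_into U \<kappa> y) \<le> ennreal (2 * e / r)"
proof -
  define v where "v = y - y0"
  define \<sigma> where "\<sigma> t = inv_into U \<kappa> (y0 + t *\<^sub>R v)" for t
  have r: "r > 0" using y(1) norm_ge_zero[of "y - y0"] by linarith
  have sub': "ball (y0 + t *\<^sub>R v) (r / 2) \<subseteq> \<kappa> ` U" if "t \<in> {0..1}" for t
  proof
    fix x assume "x \<in> ball (y0 + t *\<^sub>R v) (r / 2)"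
    then have "norm (y0 + t *\<^sub>R v - x) < r / 2" by (simp add: dist_norm)
    moreover have "norm (t *\<^sub>R v) \<le> norm v" using that by (simp add: mult_left_le_one_le)
    ultimately have "norm (y0 - x) < r"
      using norm_triangle_ineq4[of "y0 + t *\<^sub>R v - x" "t *\<^sub>R v"] y(1) by (simp add: v_def[symmetric])
    then show "x \<in> \<kappa> ` U" using sub by (auto simp: dist_norm)
  qed
  then have "y0 + t *\<^sub>R v \<in> \<kappa> ` U" if "t \<in> {0..1}" for t
    using that r by (meson centre_in_ball half_gt_zero subsetD)
  then have C1: "C1_curve_on X A a b \<sigma>" if "0 \<le> a" "b \<le> 1" for a b
    unfolding \<sigma>_def[abs_def] using that by (intro segment_C1_curve[OF U]) auto
  have kb: "kobayashi_metric X A (\<sigma> t) (velocity A \<sigma> t) \<le> ennreal (e / (r / 2))" if t: "t \<in> {0..1}" for t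
    unfolding \<sigma>_def[abs_def]
  proof (rule kobayashi_metric_segment_le[OF U])
    show "ball (y0 + t *\<^sub>R v) (r / 2) \<subseteq> \<kappa> ` U" if "t \<in> {0..1}" for t using that by (rule sub')
    show "norm v < e" using y(2) by (simp add: v_def)
  qed (use r t in auto)
  have "piecewise_C1_curve X A \<sigma>"
    unfolding piecewise_C1_curve_def
  proof (intro conjI exI[of _ "{}"])
    show "continuous_map (top_of_set {0..1}) X \<sigma>" using C1[of 0 1] by (simp add: C1_curve_on_def)
  qed (use C1 in auto)
  moreover have "\<sigma> 0 = inv_into U \<kappa> y0" "\<sigma> 1 = inv_into U \<kappa> y" by (simp_all add: \<sigma>_def v_def)
  ultimately have "kobayashi_dist X A (inv_into U \<kappa> y0) (inv_into U \<kappa> y)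
     \<le> (\<integral>\<^sup>+t\<in>{0..1}. kobayashi_metric X A (\<sigma> t) (velocity A \<sigma> t) \<partial>lborel)"
    using kobayashi_dist_le_length[of \<sigma>] by simp
  also have "(\<integral>\<^sup>+t\<in>{0..1}. kobayashi_metric X A (\<sigma> t) (velocity A \<sigma> t) \<partial>lborel)
     \<le> (\<integral>\<^sup>+t. ennreal (e / (r / 2)) * indicator {0..1::real} t \<partial>lborel)"
    by (rule nn_integral_mono) (use kb in \<open>auto simp: indicator_def\<close>)
  also have "\<dots> = ennreal (e / (r / 2))" by (simp add: nn_integral_cmult_indicator)
  finally show ?thesis by (simp add: mult.commute)
qed

subsection \<open>Reparametrization of curves\<close>

text \<open>Negative m covers reversal and m = 2 the halves of a concatenation. The curve
  \<open>\<nu>\<close> is prescribed only on [a, b] because a concatenation is given by another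
  formula outside.\<close>

lemma C1_curve_on_affine:
  assumes m: "m \<noteq> 0" and \<sigma>: "C1_curve_on X A a' b' \<sigma>" and im: "(\<lambda>t. c + m * t) ` {a..b} \<subseteq> {a'..b'}"
    and \<nu>: "\<And>t. t \<in> {a..b} \<Longrightarrow> \<nu> t = \<sigma> (c + m * t)"
  shows "C1_curve_on X A a b \<nu>"
  unfolding C1_curve_on_def
proof (intro conjI ballI)
  have c\<sigma>: "continuous_map (top_of_set {a'..b'}) X \<sigma>" using \<sigma> by (simp add: C1_curve_on_def)
  have "continuous_map (top_of_set {a..b}) (top_of_set {a'..b'}) (\<lambda>t. c + m * t)"
    using im by (auto simp: continuous_map_in_subtopology intro!: continuous_intros)
  from continuous_map_compose[OF this c\<sigma>]
  show "continuous_map (top_of_set {a..b}) X \<nu>"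
    by (rule continuous_map_eq) (use \<nu> in auto)
next
  fix ch assume ch: "ch \<in> A"
  obtain U \<kappa> where U: "ch = (U, \<kappa>)" by (cases ch)
  obtain D where D: "continuous_on {t \<in> {a'..b'}. \<sigma> t \<in> U} D"
    "\<forall>t\<in>{a'..b'}. \<sigma> t \<in> U \<longrightarrow> ((\<kappa> \<circ> \<sigma>) has_vector_derivative D t) (at t within {a'..b'})"
    using \<sigma> ch unfolding U C1_curve_on_def by fast
  have im': "c + m * t \<in> {a'..b'}" if "t \<in> {a..b}" for t using im that by blast
  have "continuous_on {t \<in> {a..b}. \<nu> t \<in> U} (\<lambda>t. m *\<^sub>R D (c + m * t))"
    by (intro continuous_intros continuous_on_compose2[OF D(1)]) (use im' \<nu> in auto)
  moreover have "((\<kappa> \<circ> \<nu>) has_vector_derivative m *\<^sub>R D (c + m * t)) (at t within {a..b})"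
    if t: "t \<in> {a..b}" "\<nu> t \<in> U" for t
  proof -
    have 1: "((\<lambda>t. c + m * t) has_vector_derivative m) (at t within {a..b})"
      by (auto intro!: derivative_eq_intros)
    have "((\<kappa> \<circ> \<sigma>) has_vector_derivative D (c + m * t)) (at (c + m * t) within {a'..b'})"
      using D(2) t \<nu> im' by auto
    then have 2: "((\<kappa> \<circ> \<sigma>) has_vector_derivative D (c + m * t)) (at (c + m * t) within (\<lambda>t. c + m * t) ` {a..b})"
      using im by (rule has_vector_derivative_within_subset)
    show ?thesis
      by (rule has_vector_derivative_transform[OF t(1) _ vector_diff_chain_within[OF 1 2]]) (use \<nu> in auto)
  qed
  ultimately show "case ch of (U, \<kappa>) \<Rightarrow> \<exists>D. continuous_on {t \<in> {a..b}. \<nu> t \<in> U} D \<and>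
      (\<forall>t\<in>{a..b}. \<nu> t \<in> U \<longrightarrow> ((\<kappa> \<circ> \<nu>) has_vector_derivative D t) (at t within {a..b}))"
    unfolding U by auto
qed

text \<open>Multiplying \<xi> by m turns each competitor for v into one for m v, with the same
  disc.\<close>

lemma kobayashi_metric_scale_le:
  assumes m: "m \<noteq> 0"
  shows "kobayashi_metric X A p (\<lambda>ch. m *\<^sub>R v ch) \<le> ennreal \<bar>m\<bar> * kobayashi_metric X A p v"
proof -
  have "ennreal (1 / \<bar>m\<bar>) * kobayashi_metric X A p (\<lambda>ch. m *\<^sub>R v ch) \<le> kobayashi_metric X A p v"
    unfolding kobayashi_metric_def[of X A p v]
  proof (rule Inf_greatest, safe)
    fix \<xi> f assume f: "holomorphic_disc X A f" "p = f 0" "v = disc_differential A f \<xi>"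
    have "disc_differential A f (of_real m * \<xi>) = (\<lambda>ch. m *\<^sub>R disc_differential A f \<xi> ch)"
      by (auto simp: disc_differential_def fun_eq_iff smult_of_real[symmetric] vec_eq_iff)
    then have "kobayashi_metric X A (f 0) (\<lambda>ch. m *\<^sub>R disc_differential A f \<xi> ch) \<le> ennreal (cmod (of_real m * \<xi>))"
      unfolding kobayashi_metric_def using f(1) by (intro Inf_lower) force
    then have "ennreal (1 / \<bar>m\<bar>) * kobayashi_metric X A (f 0) (\<lambda>ch. m *\<^sub>R disc_differential A f \<xi> ch)
       \<le> ennreal (1 / \<bar>m\<bar>) * ennreal (\<bar>m\<bar> * cmod \<xi>)"
      by (intro mult_left_mono) (auto simp: norm_mult)
    also have "\<dots> = ennreal (cmod \<xi>)" using m by (simp add: ennreal_mult[symmetric])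
    finally show "ennreal (1 / \<bar>m\<bar>) * kobayashi_metric X A (f 0) (\<lambda>ch. m *\<^sub>R disc_differential A f \<xi> ch) \<le> ennreal (cmod \<xi>)" .
  qed
  then have "ennreal \<bar>m\<bar> * (ennreal (1 / \<bar>m\<bar>) * kobayashi_metric X A p (\<lambda>ch. m *\<^sub>R v ch))
      \<le> ennreal \<bar>m\<bar> * kobayashi_metric X A p v"
    by (rule mult_left_mono) simp
  then show ?thesis using m by (simp add: mult.assoc[symmetric] ennreal_mult[symmetric])
qed

lemma curve_length_affine_le:
  assumes m: "m \<noteq> 0" and \<sigma>: "piecewise_C1_curve X A \<sigma>" and ab: "0 \<le> a" "b \<le> 1"
    and im: "(\<lambda>t. c + m * t) ` {a..b} \<subseteq> {0..1}"
    and \<nu>: "\<And>t. t \<in> {a..b} \<Longrightarrow> \<nu> t = \<sigma> (c + m * t)"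
  shows "(\<integral>\<^sup>+t\<in>{a..b}. kobayashi_metric X A (\<nu> t) (velocity A \<nu> t) \<partial>lborel)
     \<le> (\<integral>\<^sup>+t\<in>{0..1}. kobayashi_metric X A (\<sigma> t) (velocity A \<sigma> t) \<partial>lborel)"
proof -
  define k where "k t = kobayashi_metric X A (\<sigma> t) (velocity A \<sigma> t)" for t
  obtain F where F: "finite F"
    "\<And>t U \<kappa>. 0 < t \<Longrightarrow> t < 1 \<Longrightarrow> t \<notin> F \<Longrightarrow> (U, \<kappa>) \<in> A \<Longrightarrow> \<sigma> t \<in> U \<Longrightarrow>
       \<exists>D. ((\<kappa> \<circ> \<sigma>) has_vector_derivative D) (at t)"
    using piecewise_C1_curve_differentiable[OF \<sigma>] by blast
  \<comment> \<open>Besides preimages of break points the end points are removed: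
    \<open>velocity\<close> is a derivative within [0, 1], and at a joint such as 1/2 it sees both
    curves. The removed set is finite, hence null.\<close>
  define G where "G = (\<lambda>t. c + m * t) -` F \<union> {a, b}"
  have G: "finite G" unfolding G_def using F(1) m by (auto intro!: finite_vimageI simp: inj_def)
  have le: "kobayashi_metric X A (\<nu> t) (velocity A \<nu> t) \<le> ennreal \<bar>m\<bar> * k (c + m * t)" if t: "t \<in> {a..b} - G" for t
  proof -
    have t': "a < t" "t < b" using t by (auto simp: G_def)
    have "c + m * a \<in> {0..1}" "c + m * b \<in> {0..1}"
      using im[unfolded image_subset_iff, rule_format, of a] im[unfolded image_subset_iff, rule_format, of b] t'
      by auto
    moreover have "m * a < m * t \<and> m * t < m * b \<or> m * b < m * t \<and> m * t < m * a"
      using m t' by (cases "m > 0") auto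
    ultimately have ct: "0 < c + m * t" "c + m * t < 1" by auto
    have cF: "c + m * t \<notin> F" using t by (auto simp: G_def)
    have nt: "\<nu> t = \<sigma> (c + m * t)" using \<nu> t by auto
    have t01: "0 < t" "t < 1" using t' ab by auto
    have "velocity A \<nu> t (U, \<kappa>) = m *\<^sub>R velocity A \<sigma> (c + m * t) (U, \<kappa>)" for U \<kappa>
    proof (cases "(U, \<kappa>) \<in> A \<and> \<sigma> (c + m * t) \<in> U")
      case True
      then obtain D where D: "((\<kappa> \<circ> \<sigma>) has_vector_derivative D) (at (c + m * t))"
        using F(2)[OF ct cF] by blast
      have "((\<lambda>t. c + m * t) has_vector_derivative m) (at t)"
        by (auto intro!: derivative_eq_intros)
      from vector_diff_chain_at[OF this D]
      have "((\<kappa> \<circ> \<sigma> \<circ> (\<lambda>t. c + m * t)) has_vector_derivative m *\<^sub>R D) (at t)" .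
      then have "((\<kappa> \<circ> \<nu>) has_vector_derivative m *\<^sub>R D) (at t)"
        by (rule has_vector_derivative_transform_within_open[where S="{a<..<b}"]) (use t' \<nu> in auto)
      then have "vector_derivative (\<kappa> \<circ> \<nu>) (at t within {0..1}) = m *\<^sub>R D"
        using vector_derivative_within_cbox[of 0 1 t] t01 has_vector_derivative_at_within by force
      moreover have "vector_derivative (\<kappa> \<circ> \<sigma>) (at (c + m * t) within {0..1}) = D"
        using vector_derivative_within_cbox[of 0 1 "c + m * t"] ct has_vector_derivative_at_within[OF D] by force
      ultimately show ?thesis using True nt by (simp add: velocity_def)
    qed (auto simp: velocity_def nt)
    then have "velocity A \<nu> t = (\<lambda>ch. m *\<^sub>R velocity A \<sigma> (c + m * t) ch)" by (auto simp: fun_eq_iff)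
    then show ?thesis unfolding k_def nt using kobayashi_metric_scale_le[OF m] by simp
  qed
  have "AE t in lborel. t \<notin> G"
    using finite_imp_null_set_lborel[OF G] by (rule AE_not_in)
  then have "(\<integral>\<^sup>+t\<in>{a..b}. kobayashi_metric X A (\<nu> t) (velocity A \<nu> t) \<partial>lborel)
     \<le> (\<integral>\<^sup>+t. ennreal \<bar>m\<bar> * (k (c + m * t) * indicator {0..1} (c + m * t)) \<partial>lborel)"
    using le im by (intro nn_integral_mono_AE) (auto elim!: eventually_mono simp: indicator_def image_subset_iff)
  also have "\<dots> \<le> (\<integral>\<^sup>+t\<in>{0..1}. k t \<partial>lborel)" by (rule nn_integral_affine_le[OF m])
  finally show ?thesis by (simp add: k_def)
qed

lemma kobayashi_dist_sym_le: "kobayashi_dist X A q p \<le> kobayashi_dist X A p q"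
  unfolding kobayashi_dist_def[of X A p q]
proof (rule Inf_greatest, safe)
  fix \<sigma> assume \<sigma>: "piecewise_C1_curve X A \<sigma>"
  define \<nu> where "\<nu> t = \<sigma> (1 + (- 1) * t)" for t
  have c: "continuous_map (top_of_set {0..1}) X \<sigma>" using \<sigma> by (simp add: piecewise_C1_curve_def)
  obtain S where S: "finite S" "\<And>a b. 0 \<le> a \<Longrightarrow> a < b \<Longrightarrow> b \<le> 1 \<Longrightarrow> {a<..<b} \<inter> S = {} \<Longrightarrow> C1_curve_on X A a b \<sigma>"
    using \<sigma> unfolding piecewise_C1_curve_def by blast
  have "piecewise_C1_curve X A \<nu>"
    unfolding piecewise_C1_curve_def
  proof (intro conjI exI[of _ "(\<lambda>t. 1 - t) ` S"] allI impI)
    have "continuous_map (top_of_set {0..1}) (top_of_set {0..1::real}) (\<lambda>t. 1 + (- 1) * t)"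
      by (auto simp: continuous_map_in_subtopology intro!: continuous_intros)
    from continuous_map_compose[OF this c]
    show "continuous_map (top_of_set {0..1}) X \<nu>" by (simp add: o_def \<nu>_def[abs_def])
  next
    fix a b assume ab: "0 \<le> a \<and> a < b \<and> b \<le> 1 \<and> {a<..<b} \<inter> (\<lambda>t. 1 - t) ` S = {}"
    have "C1_curve_on X A (1 - b) (1 - a) \<sigma>"
    proof (rule S(2))
      show "{1 - b<..<1 - a} \<inter> S = {}"
      proof (rule ccontr)
        assume "{1 - b<..<1 - a} \<inter> S \<noteq> {}"
        then obtain x where "x \<in> S" "1 - b < x" "x < 1 - a" by auto
        then have "1 - x \<in> {a<..<b} \<inter> (\<lambda>t. 1 - t) ` S" by auto
        with ab show False by blast
      qed
    qed (use ab in auto)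
    then show "C1_curve_on X A a b \<nu>"
      by (rule C1_curve_on_affine[rotated, where c=1 and m="-1"]) (auto simp: \<nu>_def)
  qed (use S(1) in auto)
  then have "kobayashi_dist X A (\<sigma> 1) (\<sigma> 0) \<le> (\<integral>\<^sup>+t\<in>{0..1}. kobayashi_metric X A (\<nu> t) (velocity A \<nu> t) \<partial>lborel)"
    using kobayashi_dist_le_length[of \<nu>] by (simp add: \<nu>_def[of 0] \<nu>_def[of 1])
  also have "\<dots> \<le> (\<integral>\<^sup>+t\<in>{0..1}. kobayashi_metric X A (\<sigma> t) (velocity A \<sigma> t) \<partial>lborel)"
    by (rule curve_length_affine_le[of "-1" _ _ _ 1]) (use \<sigma> in \<open>auto simp: \<nu>_def\<close>)
  finally show "kobayashi_dist X A (\<sigma> 1) (\<sigma> 0) \<le> (\<integral>\<^sup>+t\<in>{0..1}. kobayashi_metric X A (\<sigma> t) (velocity A \<sigma> t) \<partial>lborel)" .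
qed

lemma kobayashi_dist_sym: "kobayashi_dist X A q p = kobayashi_dist X A p q"
  by (intro antisym kobayashi_dist_sym_le)

lemma kobayashi_dist_concat:
  assumes \<sigma>1: "piecewise_C1_curve X A \<sigma>1" and \<sigma>2: "piecewise_C1_curve X A \<sigma>2" and eq: "\<sigma>1 1 = \<sigma>2 0"
  shows "kobayashi_dist X A (\<sigma>1 0) (\<sigma>2 1) \<le>
     (\<integral>\<^sup>+t\<in>{0..1}. kobayashi_metric X A (\<sigma>1 t) (velocity A \<sigma>1 t) \<partial>lborel) +
     (\<integral>\<^sup>+t\<in>{0..1}. kobayashi_metric X A (\<sigma>2 t) (velocity A \<sigma>2 t) \<partial>lborel)"
proof -
  define \<nu> where "\<nu> t = (if t \<le> 1/2 then \<sigma>1 (0 + 2 * t) else \<sigma>2 (- 1 + 2 * t))" for t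
  have \<nu>1: "\<nu> t = \<sigma>1 (0 + 2 * t)" if "t \<in> {a..b}" "b \<le> 1/2" for t a b using that by (simp add: \<nu>_def)
  \<comment> \<open>At t = 1/2 the definition selects \<open>\<sigma>1\<close>; by \<open>eq\<close>
    this is also the initial value of \<open>\<sigma>2\<close>, so the second formula holds on a
    closed interval starting at 1/2.\<close>
  have \<nu>2: "\<nu> t = \<sigma>2 (- 1 + 2 * t)" if "t \<in> {a..b}" "1/2 \<le> a" for t a b
  proof (cases "t = 1/2")
    case True
    show ?thesis unfolding True \<nu>_def using eq by simp
  qed (use that in \<open>auto simp: \<nu>_def\<close>)
  obtain S1 where S1: "finite S1" "\<And>a b. 0 \<le> a \<Longrightarrow> a < b \<Longrightarrow> b \<le> 1 \<Longrightarrow> {a<..<b} \<inter> S1 = {} \<Longrightarrow> C1_curve_on X A a b \<sigma>1"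
    using \<sigma>1 unfolding piecewise_C1_curve_def by blast
  obtain S2 where S2: "finite S2" "\<And>a b. 0 \<le> a \<Longrightarrow> a < b \<Longrightarrow> b \<le> 1 \<Longrightarrow> {a<..<b} \<inter> S2 = {} \<Longrightarrow> C1_curve_on X A a b \<sigma>2"
    using \<sigma>2 unfolding piecewise_C1_curve_def by blast
  define S where "S = (\<lambda>t. 0 + 2 * t) -` S1 \<union> (\<lambda>t. - 1 + 2 * t) -` S2 \<union> {1/2}"
  have "piecewise_C1_curve X A \<nu>"
    unfolding piecewise_C1_curve_def
  proof (intro conjI exI[of _ S] allI impI)
    have c1: "continuous_map (top_of_set {0..1}) X \<sigma>1" and c2: "continuous_map (top_of_set {0..1}) X \<sigma>2"
      using \<sigma>1 \<sigma>2 by (simp_all add: piecewise_C1_curve_def)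
    have "continuous_map (top_of_set {t \<in> {0..1}. t \<le> 1/2}) (top_of_set {0..1::real}) (\<lambda>t. 0 + 2 * t)"
      by (auto simp: continuous_map_in_subtopology intro!: continuous_intros)
    from continuous_map_compose[OF this c1]
    have 1: "continuous_map (top_of_set {t \<in> {0..1}. t \<le> 1/2}) X (\<lambda>t. \<sigma>1 (0 + 2 * t))" by (simp add: o_def)
    have "continuous_map (top_of_set {t \<in> {0..1}. 1/2 \<le> t}) (top_of_set {0..1::real}) (\<lambda>t. - 1 + 2 * t)"
      by (auto simp: continuous_map_in_subtopology intro!: continuous_intros)
    from continuous_map_compose[OF this c2]
    have 2: "continuous_map (top_of_set {t \<in> {0..1}. 1/2 \<le> t}) X (\<lambda>t. \<sigma>2 (- 1 + 2 * t))" by (simp add: o_def)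
    show "continuous_map (top_of_set {0..1}) X \<nu>"
      unfolding \<nu>_def[abs_def]
    proof (rule continuous_map_cases_le)
      show "continuous_map (subtopology (top_of_set {0..1}) {x \<in> topspace (top_of_set {0..1}). x \<le> 1/2}) X (\<lambda>t. \<sigma>1 (0 + 2 * t))"
        using 1 by (simp add: subtopology_subtopology Int_absorb1 Collect_mono_iff inf.absorb2 subset_iff)
      show "continuous_map (subtopology (top_of_set {0..1}) {x \<in> topspace (top_of_set {0..1}). 1/2 \<le> x}) X (\<lambda>t. \<sigma>2 (- 1 + 2 * t))"
        using 2 by (simp add: subtopology_subtopology Int_absorb1 Collect_mono_iff inf.absorb2 subset_iff)
      show "\<sigma>1 (0 + 2 * t) = \<sigma>2 (- 1 + 2 * t)" if "t = 1/2" for t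
        unfolding that using eq by simp
    qed auto
    show "finite S" unfolding S_def using S1(1) S2(1) by (auto intro!: finite_vimageI simp: inj_def)
  next
    fix a b assume "0 \<le> a \<and> a < b \<and> b \<le> 1 \<and> {a<..<b} \<inter> S = {}"
    then have ab: "0 \<le> a" "a < b" "b \<le> 1" and abS: "{a<..<b} \<inter> S = {}" by auto
    have "1/2 \<notin> {a<..<b}" using abS by (auto simp: S_def)
    then consider "b \<le> 1/2" | "1/2 \<le> a" by force
    then show "C1_curve_on X A a b \<nu>"
    proof cases
      case 1
      have "C1_curve_on X A (2 * a) (2 * b) \<sigma>1"
      proof (rule S1(2))
        show "{2 * a<..<2 * b} \<inter> S1 = {}"
        proof (rule ccontr)
          assume "{2 * a<..<2 * b} \<inter> S1 \<noteq> {}"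
          then obtain x where "x \<in> S1" "2 * a < x" "x < 2 * b" by auto
          then have "x / 2 \<in> {a<..<b} \<inter> S" by (auto simp: S_def)
          with abS show False by blast
        qed
      qed (use ab 1 in auto)
      then show ?thesis
        by (rule C1_curve_on_affine[rotated, where c=0 and m=2]) (use \<nu>1[OF _ 1] in auto)
    next
      case 2
      have "C1_curve_on X A (- 1 + 2 * a) (- 1 + 2 * b) \<sigma>2"
      proof (rule S2(2))
        show "{- 1 + 2 * a<..<- 1 + 2 * b} \<inter> S2 = {}"
        proof (rule ccontr)
          assume "{- 1 + 2 * a<..<- 1 + 2 * b} \<inter> S2 \<noteq> {}"
          then obtain x where "x \<in> S2" "- 1 + 2 * a < x" "x < - 1 + 2 * b" by auto
          moreover have "- 1 + 2 * ((x + 1) / 2) = x" by (simp add: field_simps)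
          ultimately have "(x + 1) / 2 \<in> {a<..<b} \<inter> S" by (simp add: S_def vimage_def)
          with abS show False by blast
        qed
      qed (use ab 2 in auto)
      then show ?thesis
        by (rule C1_curve_on_affine[rotated, where c="-1" and m=2]) (use \<nu>2[OF _ 2] in auto)
    qed
  qed
  then have "kobayashi_dist X A (\<sigma>1 0) (\<sigma>2 1) \<le> (\<integral>\<^sup>+t\<in>{0..1}. kobayashi_metric X A (\<nu> t) (velocity A \<nu> t) \<partial>lborel)"
    using kobayashi_dist_le_length[of \<nu>] by (simp add: \<nu>_def[of 0] \<nu>_def[of 1])
  also have "{0..1::real} = {0..1/2} \<union> {1/2..1}" by auto
  also have "(\<integral>\<^sup>+t\<in>{0..1/2} \<union> {1/2..1}. kobayashi_metric X A (\<nu> t) (velocity A \<nu> t) \<partial>lborel)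
     \<le> (\<integral>\<^sup>+t\<in>{0..1/2}. kobayashi_metric X A (\<nu> t) (velocity A \<nu> t) \<partial>lborel)
      + (\<integral>\<^sup>+t\<in>{1/2..1}. kobayashi_metric X A (\<nu> t) (velocity A \<nu> t) \<partial>lborel)"
    by (rule nn_integral_split_le) auto
  also have "\<dots> \<le> (\<integral>\<^sup>+t\<in>{0..1}. kobayashi_metric X A (\<sigma>1 t) (velocity A \<sigma>1 t) \<partial>lborel) +
     (\<integral>\<^sup>+t\<in>{0..1}. kobayashi_metric X A (\<sigma>2 t) (velocity A \<sigma>2 t) \<partial>lborel)"
  proof (rule add_mono)
    show "(\<integral>\<^sup>+t\<in>{0..1/2}. kobayashi_metric X A (\<nu> t) (velocity A \<nu> t) \<partial>lborel)
      \<le> (\<integral>\<^sup>+t\<in>{0..1}. kobayashi_metric X A (\<sigma>1 t) (velocity A \<sigma>1 t) \<partial>lborel)"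
      by (rule curve_length_affine_le[of 2 _ _ _ 0]) (use \<sigma>1 \<nu>1[of _ 0 "1/2"] in auto)
    show "(\<integral>\<^sup>+t\<in>{1/2..1}. kobayashi_metric X A (\<nu> t) (velocity A \<nu> t) \<partial>lborel)
      \<le> (\<integral>\<^sup>+t\<in>{0..1}. kobayashi_metric X A (\<sigma>2 t) (velocity A \<sigma>2 t) \<partial>lborel)"
      by (rule curve_length_affine_le[of 2 _ _ _ "-1"]) (use \<sigma>2 \<nu>2[of _ "1/2" 1] in auto)
  qed
  finally show ?thesis .
qed

end

subsection \<open>The Kobayashi distance as a metric\<close>

context cmanifold
begin

lemma kobayashi_dist_triangle: "kobayashi_dist X A p r \<le> kobayashi_dist X A p q + kobayashi_dist X A q r"
proof (rule ennreal_le_epsilon)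
  fix e :: real assume fin: "kobayashi_dist X A p q + kobayashi_dist X A q r < top" and e: "0 < e"
  have less: "x < x + ennreal (e / 2)" if "x < top" for x
    using ennreal_add_left_cancel_less[of x 0 "ennreal (e / 2)"] that e by auto
  have "kobayashi_dist X A p q < kobayashi_dist X A p q + ennreal (e / 2)"
    using fin by (intro less) auto
  then obtain \<sigma>1 where \<sigma>1: "piecewise_C1_curve X A \<sigma>1" "\<sigma>1 0 = p" "\<sigma>1 1 = q"
    "(\<integral>\<^sup>+t\<in>{0..1}. kobayashi_metric X A (\<sigma>1 t) (velocity A \<sigma>1 t) \<partial>lborel) < kobayashi_dist X A p q + ennreal (e / 2)"
    by (subst (asm) kobayashi_dist_def) (auto simp: Inf_less_iff)
  have "kobayashi_dist X A q r < kobayashi_dist X A q r + ennreal (e / 2)"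
    using fin by (intro less) auto
  then obtain \<sigma>2 where \<sigma>2: "piecewise_C1_curve X A \<sigma>2" "\<sigma>2 0 = q" "\<sigma>2 1 = r"
    "(\<integral>\<^sup>+t\<in>{0..1}. kobayashi_metric X A (\<sigma>2 t) (velocity A \<sigma>2 t) \<partial>lborel) < kobayashi_dist X A q r + ennreal (e / 2)"
    by (subst (asm) kobayashi_dist_def) (auto simp: Inf_less_iff)
  have "kobayashi_dist X A p r \<le> (kobayashi_dist X A p q + ennreal (e / 2)) + (kobayashi_dist X A q r + ennreal (e / 2))"
    using kobayashi_dist_concat[OF \<sigma>1(1) \<sigma>2(1)] \<sigma>1 \<sigma>2
    by (auto intro: order_trans[OF _ add_mono[OF less_imp_le less_imp_le]])
  also have "\<dots> = kobayashi_dist X A p q + kobayashi_dist X A q r + (ennreal (e / 2) + ennreal (e / 2))"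
    by (simp add: ac_simps)
  also have "ennreal (e / 2) + ennreal (e / 2) = ennreal e"
    using e by (simp add: ennreal_plus[symmetric] del: ennreal_plus)
  finally show "kobayashi_dist X A p r \<le> kobayashi_dist X A p q + kobayashi_dist X A q r + ennreal e" .
qed

text \<open>The manifold topology is at least as fine as that of the distance. This gives finiteness
  by connectedness, and later turns convergence of points in the ball into convergence in the
  distance.\<close>

lemma kobayashi_dist_near:
  assumes p: "p \<in> topspace X" and \<eta>: "\<eta> > 0"
  obtains V where "openin X V" "p \<in> V" "\<And>q. q \<in> V \<Longrightarrow> kobayashi_dist X A p q \<le> ennreal \<eta>"
proof -
  obtain U \<kappa> where U: "(U, \<kappa>) \<in> A" "p \<in> U" using chart_at[OF p] by blast
  have "\<kappa> p \<in> \<kappa> ` U" using U(2) by blast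
  then obtain r where r: "r > 0" "ball (\<kappa> p) r \<subseteq> \<kappa> ` U" using chart(2)[OF U(1)] openE by blast
  \<comment> \<open>The bound r/2 makes the chart estimate applicable, and with e = \<eta> r / 2 its
    value 2 e / r is exactly \<eta>.\<close>
  define d where "d = min (r / 2) (\<eta> * r / 2)"
  define V where "V = {q \<in> U. \<kappa> q \<in> ball (\<kappa> p) d}"
  have "continuous_map (subtopology X U) (top_of_set (\<kappa> ` U)) \<kappa>"
    using chart(3)[OF U(1)] homeomorphic_imp_continuous_map by blast
  then have "continuous_map (subtopology X U) euclidean \<kappa>"
    by (simp add: continuous_map_in_subtopology)
  then have "openin (subtopology X U) {q \<in> topspace (subtopology X U). \<kappa> q \<in> ball (\<kappa> p) d}"
    by (rule openin_continuous_map_preimage) simp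
  then have "openin (subtopology X U) V" by (simp only: chart_topspace(1)[OF U(1)] V_def)
  then have "openin X V" using chart(1)[OF U(1)] openin_trans_full by blast
  moreover have "p \<in> V" using U r \<eta> by (simp add: V_def d_def)
  moreover have "kobayashi_dist X A p q \<le> ennreal \<eta>" if q: "q \<in> V" for q
  proof -
    have "norm (\<kappa> q - \<kappa> p) < d" using q by (simp add: V_def dist_norm norm_minus_commute)
    then have n: "norm (\<kappa> q - \<kappa> p) < r / 2" "norm (\<kappa> q - \<kappa> p) < \<eta> * r / 2" by (auto simp: d_def)
    have "q \<in> U" using q by (simp add: V_def)
    then show ?thesis
      using kobayashi_dist_chart_le[OF U(1) r(2) n] chart_inv[OF U(1)] U(2) r by simp
  qed
  ultimately show ?thesis using that by blast
qed

lemma kobayashi_dist_refl: "p \<in> topspace X \<Longrightarrow> kobayashi_dist X A p p = 0"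
proof -
  assume p: "p \<in> topspace X"
  have "kobayashi_dist X A p p \<le> 0"
  proof (rule ennreal_le_epsilon)
    fix e :: real assume "0 < e"
    then obtain V where "p \<in> V" "\<And>q. q \<in> V \<Longrightarrow> kobayashi_dist X A p q \<le> ennreal e"
      using kobayashi_dist_near[OF p] by metis
    then show "kobayashi_dist X A p p \<le> 0 + ennreal e" by simp
  qed
  then show ?thesis by simp
qed

text \<open>The points at finite distance from p form an open set with open complement, since every
  point has a neighbourhood within distance 1. Connectedness of the manifold leaves only the whole
  space.\<close>

lemma kobayashi_dist_finite:
  assumes p: "p \<in> topspace X" and q: "q \<in> topspace X"
  shows "kobayashi_dist X A p q < \<infinity>"
proof -
  define T where "T = {q \<in> topspace X. kobayashi_dist X A p q < \<infinity>}"
  have tri: "kobayashi_dist X A p z < \<infinity>" if "kobayashi_dist X A p y < \<infinity>" "kobayashi_dist X A y z \<le> ennreal 1" for y z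
  proof -
    have "kobayashi_dist X A p z \<le> kobayashi_dist X A p y + kobayashi_dist X A y z"
      by (rule kobayashi_dist_triangle)
    also have "\<dots> < \<infinity>" using that by (auto simp: le_less_trans)
    finally show ?thesis .
  qed
  have "openin X T"
  proof (subst openin_subopen, safe)
    fix y assume y: "y \<in> T"
    then have "y \<in> topspace X" by (simp add: T_def)
    then obtain V where V: "openin X V" "y \<in> V" "\<And>z. z \<in> V \<Longrightarrow> kobayashi_dist X A y z \<le> ennreal 1"
      using kobayashi_dist_near[of y 1] by (metis zero_less_one)
    have "V \<subseteq> T" using tri[of y] y V(3) openin_subset[OF V(1)] by (auto simp: T_def)
    then show "\<exists>V. openin X V \<and> y \<in> V \<and> V \<subseteq> T" using V by blast
  qed
  moreover have "openin X (topspace X - T)"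
  proof (subst openin_subopen, safe)
    fix y assume y: "y \<in> topspace X" "y \<notin> T"
    then obtain V where V: "openin X V" "y \<in> V" "\<And>z. z \<in> V \<Longrightarrow> kobayashi_dist X A y z \<le> ennreal 1"
      using kobayashi_dist_near[of y 1] by (metis zero_less_one)
    have "z \<notin> T" if "z \<in> V" for z
      using tri[of z y] V(3)[OF that] kobayashi_dist_sym[of y z] y by (auto simp: T_def)
    then have "V \<subseteq> topspace X - T" using openin_subset[OF V(1)] by auto
    then show "\<exists>V. openin X V \<and> y \<in> V \<and> V \<subseteq> topspace X - T" using V by blast
  qed
  then have "closedin X T" by (simp add: closedin_def T_def)
  moreover have "connected_space X" using complex_manifold by (simp add: complex_manifold_def)
  moreover have "p \<in> T" using p kobayashi_dist_refl[OF p] by (simp add: T_def)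
  ultimately have "T = topspace X" unfolding connected_space_clopen_in by blast
  then show ?thesis using q by (auto simp: T_def)
qed

end

theorem theorem1p5:
  fixes X :: "'a topology" and A :: "('a, 'n::finite) chart set"
  assumes "complex_manifold X A"
    and "wHHR X A"
  shows "(\<forall>p\<in>topspace X. \<forall>q\<in>topspace X. kobayashi_dist X A p q < \<infinity>) \<and>
         Metric_space (topspace X) (\<lambda>p q. enn2real (kobayashi_dist X A p q)) \<and>
         Metric_space.mcomplete (topspace X) (\<lambda>p q. enn2real (kobayashi_dist X A p q))"
proof -
  interpret cmanifold X A by unfold_locales (rule assms(1))
  define d where "d p q = enn2real (kobayashi_dist X A p q)" for p q
  obtain s where s: "s > 0" and wb: "\<And>p. p \<in> topspace X \<Longrightarrow> \<exists>\<Phi> \<phi>. wHHR_ball X A \<Phi> \<phi> s \<and> \<Phi> 0 = p"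
  proof -
    obtain s where s: "s > 0" "\<forall>p\<in>topspace X. \<exists>(\<Phi> :: complex ^ 'n \<Rightarrow> 'a) (\<phi> :: 'a \<Rightarrow> real).
        holomorphic_embedding (ball 0 1) X A \<Phi> \<and> \<Phi> 0 = p \<and>
        C2_function A \<phi> \<and> continuous_psh X A \<phi> \<and> \<phi> ` topspace X \<subseteq> {0..1} \<and>
        (\<forall>w\<in>ball 0 1. \<forall>x. levi_form (\<phi> \<circ> \<Phi>) w x \<ge> s\<^sup>2 * (\<Sum>j\<in>UNIV. (cmod (x $ j))\<^sup>2))"
      using assms(2) unfolding wHHR_def by blast
    show thesis
    proof (rule that[OF s(1)])
      fix p assume "p \<in> topspace X"
      with s(2) obtain \<Phi> :: "complex ^ 'n \<Rightarrow> 'a" and \<phi> :: "'a \<Rightarrow> real" where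
        "holomorphic_embedding (ball 0 1) X A \<Phi>" "\<Phi> 0 = p"
        "C2_function A \<phi>" "continuous_psh X A \<phi>" "\<phi> ` topspace X \<subseteq> {0..1}"
        "\<forall>w\<in>ball 0 1. \<forall>x. levi_form (\<phi> \<circ> \<Phi>) w x \<ge> s\<^sup>2 * (\<Sum>j\<in>UNIV. (cmod (x $ j))\<^sup>2)"
        by blast
      moreover from this have "wHHR_ball X A \<Phi> \<phi> s"
        using s(1) by unfold_locales auto
      ultimately show "\<exists>\<Phi> \<phi>. wHHR_ball X A \<Phi> \<phi> s \<and> \<Phi> 0 = p" by blast
    qed
  qed
  \<comment> \<open>The constant \<open>a\<close> depends on \<open>s\<close> alone, so the same
    \<open>c\<close> serves the embedded balls at all points.\<close>
  define c where "c = exp (wHHR_ball.a s)"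
  have c: "c > 0" by (simp add: c_def)
  \<comment> \<open>\<open>enn2real\<close> sends infinity to 0, so finiteness must be known before
    estimates are moved between real and extended values.\<close>
  have ennd: "ennreal (d p q) = kobayashi_dist X A p q" if "p \<in> topspace X" "q \<in> topspace X" for p q
    unfolding d_def using kobayashi_dist_finite[OF that] by (simp add: less_top)
  have lower: "q \<in> \<Phi> ` ball 0 r"
    if "wHHR_ball X A \<Phi> \<phi> s" "\<Phi> 0 = p" "p \<in> topspace X" "q \<in> topspace X" "0 < r" "r \<le> 1/2" "d p q < r / c"
    for p q \<Phi> \<phi> r
  proof -
    have "kobayashi_dist X A (\<Phi> 0) q < ennreal (r / c)"
      using that c ennd[of p q] by (metis d_def enn2real_nonneg ennreal_less_iff)
    then show ?thesis using wHHR_ball.kobayashi_dist_lower_bound[OF that(1,5,6)] by (simp add: c_def)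
  qed
  interpret M: Metric_space "topspace X" d
  proof
    show "0 \<le> d p q" for p q by (simp add: d_def)
    show "d p q = d q p" for p q unfolding d_def by (subst kobayashi_dist_sym) simp
    show "d p q = 0 \<longleftrightarrow> p = q" if pq: "p \<in> topspace X" "q \<in> topspace X" for p q
    proof
      assume 0: "d p q = 0"
      obtain \<Phi> \<phi> where \<Phi>: "wHHR_ball X A \<Phi> \<phi> s" "\<Phi> 0 = p" using wb[OF pq(1)] by blast
      have mem: "q \<in> \<Phi> ` ball 0 r" if "0 < r" "r \<le> 1/2" for r
        using that c 0 by (intro lower[OF \<Phi> pq]) auto
      interpret wHHR_ball X A \<Phi> \<phi> s by (rule \<Phi>(1))
      obtain w where w: "w \<in> ball 0 (1/2)" "q = \<Phi> w" using mem[of "1/2"] by auto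
      \<comment> \<open>The point q lies in the image of every smaller ball. Taking the radius to be
        the norm of its own preimage w contradicts injectivity of \<Phi> unless w = 0.\<close>
      have "w = 0"
      proof (rule ccontr)
        assume "w \<noteq> 0"
        then obtain w' where w': "w' \<in> ball 0 (norm w)" "q = \<Phi> w'" using mem[of "norm w"] w by auto
        then have "w = w'" using w inj_\<Phi> by (auto simp: inj_on_def)
        with w' show False by simp
      qed
      then show "p = q" using w \<Phi>(2) by simp
    next
      assume "p = q"
      then show "d p q = 0" using kobayashi_dist_refl pq by (simp add: d_def)
    qed
    show "d p r \<le> d p q + d q r" if "p \<in> topspace X" "q \<in> topspace X" "r \<in> topspace X" for p q r
    proof -
      have "ennreal (d p r) \<le> ennreal (d p q) + ennreal (d q r)"
        using kobayashi_dist_triangle[of p r q] that by (simp add: ennd)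
      then show ?thesis by (simp add: d_def ennreal_plus[symmetric] del: ennreal_plus)
    qed
  qed
  have "M.mcomplete"
    unfolding M.mcomplete_def
  proof (intro allI impI)
    fix x assume x: "M.MCauchy x"
    then have xX: "x n \<in> topspace X" for n by (auto simp: M.MCauchy_def)
    \<comment> \<open>Radius 1/4 is within the range of the lower bound, and the closed ball of this
      radius is a compact part of the domain of \<Phi>, so a limit of the preimages still has an
      image in the manifold.\<close>
    have "1 / 4 / c > 0" using c by simp
    then obtain N where N: "\<And>n m. N \<le> n \<Longrightarrow> N \<le> m \<Longrightarrow> d (x n) (x m) < 1 / 4 / c"
      using x unfolding M.MCauchy_def by meson
    obtain \<Phi> \<phi> where \<Phi>: "wHHR_ball X A \<Phi> \<phi> s" "\<Phi> 0 = x N" using wb[OF xX] by blast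
    interpret wHHR_ball X A \<Phi> \<phi> s by (rule \<Phi>(1))
    have mem: "x (N + n) \<in> \<Phi> ` ball 0 (1/4)" for n
      using N[of N "N + n"] by (intro lower[OF \<Phi> xX xX]) auto
    define w where "w n = P (x (N + n))" for n
    have w: "w n \<in> cball 0 (1/4)" "\<Phi> (w n) = x (N + n)" for n
      using mem[of n] by (auto simp: w_def)
    obtain l r where l: "l \<in> cball 0 (1/4)" and r: "strict_mono r" and lim: "(w \<circ> r) \<longlonglongrightarrow> l"
      using compact_cball[of 0 "1/4"] w(1) unfolding compact_def by metis
    have l1: "l \<in> ball 0 1" using l by auto
    define R where "R n = N + r n" for n
    have "limitin M.mtopology (x \<circ> R) (\<Phi> l) sequentially"
      unfolding M.limitin_metric
    proof (intro conjI allI impI)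
      show lX: "\<Phi> l \<in> topspace X" using l1 by (rule \<Phi>_in_topspace)
      fix \<epsilon> :: real assume \<epsilon>: "\<epsilon> > 0"
      then have "\<epsilon> / 2 > 0" by simp
      \<comment> \<open>Convergence has been obtained for preimages in the Euclidean ball.
        Continuity of \<Phi> brings the points into V, on which the distance to the limit is
        small.\<close>
      then obtain V where V: "openin X V" "\<Phi> l \<in> V" "\<And>q. q \<in> V \<Longrightarrow> kobayashi_dist X A (\<Phi> l) q \<le> ennreal (\<epsilon> / 2)"
        using kobayashi_dist_near[OF lX, of "\<epsilon> / 2"] by blast
      have "open {z \<in> ball 0 1. \<Phi> z \<in> V}" by (rule open_\<Phi>_preimage[OF V(1)])
      then have "eventually (\<lambda>n. (w \<circ> r) n \<in> {z \<in> ball 0 1. \<Phi> z \<in> V}) sequentially"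
        using lim l1 V(2) by (intro topological_tendstoD[OF lim]) auto
      then show "\<forall>\<^sub>F n in sequentially. (x \<circ> R) n \<in> topspace X \<and> d ((x \<circ> R) n) (\<Phi> l) < \<epsilon>"
      proof (rule eventually_mono)
        fix n assume "(w \<circ> r) n \<in> {z \<in> ball 0 1. \<Phi> z \<in> V}"
        then have "x (R n) \<in> V" using w(2)[of "r n"] by (simp add: R_def)
        then have "ennreal (d (\<Phi> l) (x (R n))) \<le> ennreal (\<epsilon> / 2)" using V(3) ennd[OF lX xX] by simp
        then have "d (\<Phi> l) (x (R n)) \<le> \<epsilon> / 2" using \<epsilon> by (simp add: ennreal_le_iff)
        then show "(x \<circ> R) n \<in> topspace X \<and> d ((x \<circ> R) n) (\<Phi> l) < \<epsilon>"
          using \<epsilon> xX M.commute[of "\<Phi> l" "x (R n)"] by simp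
      qed
    qed
    moreover have "strict_mono R" using r by (simp add: R_def strict_mono_def)
    ultimately show "\<exists>x'. limitin M.mtopology x x' sequentially"
      using M.MCauchy_convergent_subsequence[OF x] by blast
  qed
  then show ?thesis
    using kobayashi_dist_finite M.Metric_space_axioms unfolding d_def[abs_def] by blast
qed

end
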